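(* Let $m,n\in\mathbb N$ be such that $n\ge2$ and $m\le n-1$, and let $\Omega\subset\mathbb R^n$ be a bounded domain with Lipschitz boundary. Suppose that $Y_1,Y_2$ are r.i. spaces over $\Omega$ on the same fundamental level, i.e. $\varphi_{Y_1}\approx\varphi_{Y_2}$. For $j=1,2$, let $X_j$ be the optimal (i.e. largest) r.i. domain space in the embedding $$W^mX_j(\Omega)\hookrightarrow Y_j(\Omega).$$ Then $X_1$ and $X_2$ are also on the same fundamental level, i.e. $\varphi_{X_1}\approx\varphi_{X_2}$.
   Context: $\Omega$ carries Lebesgue measure $|\cdot|$. For measurable $f$ on $\Omega$, $f_*(\lambda)=|\{|f|>\lambda\}|$, $f^*(t)=\inf\{\lambda\ge0:f_*(\lambda)\le t\}$. An r.i. norm is a map $\rho$ from non-negative measurable functions on $\Omega$ to $[0,\infty]$ such that: (P1) $\rho(f+g)\le\rho(f)+\rho(g)$, $\rho(\lambda f)=\lambda\rho(f)$ for $\lambda\ge0$, and $\rho(f)=0$ implies $f=0$ a.e.; (P2) $f\le g$ a.e. implies $\rho(f)\le\rho(g)$; (P3) $f_k\nearrow f$ a.e. implies $\rho(f_k)\nearrow\rho(f)$; (P4) $\rho(\chi_E)<\infty$ if $|E|<\infty$; (P5) if $|E|<\infty$ there is $C_E>0$ with $\int_Ef\le C_E\rho(f)$; (P6) $f^*=g^*$ implies $\rho(f)=\rho(g)$. The r.i. space is $X(\Omega)=\{f\text{ measurable}:\|f\|_X:=\rho(|f|)<\infty\}$; r.i. spaces are identified if equal as sets and ordered by inclusion.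 The fundamental function is $\varphi_X(t)=\|\chi_E\|_X$ for $|E|=t\in[0,|\Omega|]$, extended constantly by $\varphi_X(|\Omega|)$ for $t\ge|\Omega|$. $\varphi\approx\psi$ means that each is bounded by a constant multiple of the other. $W^mX(\Omega)$ is the space of ($m$-times) weakly differentiable $u:\Omega\to\mathbb R$ with $|\nabla^ku|\in X(\Omega)$ for $k=0,\dots,m$, where $\nabla^ku$ is the vector of all $k$-th order weak partial derivatives, $\nabla^0u=u$ and $|\cdot|$ is the Euclidean norm, with norm $\|u\|_{W^mX}=\sum_{k=0}^m\||\nabla^ku|\|_X$. $W^mX(\Omega)\hookrightarrow Y(\Omega)$ means $\|u\|_Y\le C\|u\|_{W^mX}$ for all $u\in W^mX(\Omega)$, with some constant $C$. Given $Y$, the optimal r.i. domain space is the largest r.i. space $X$ (w.r.t. inclusion) for which $W^mX(\Omega)\hookrightarrow Y(\Omega)$ holds; it always exists. *)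

theory Defs
  imports "HOL-Analysis.Analysis"
begin

section \<open>Rearrangement-invariant spaces\<close>

definition distribution_function ::
    "(real^'n) set \<Rightarrow> (real^'n \<Rightarrow> ennreal) \<Rightarrow> ennreal \<Rightarrow> ennreal" where
  "distribution_function \<Omega> f l = emeasure (lebesgue_on \<Omega>) {x \<in> \<Omega>. f x > l}"

(* The value l = \<infinity> always qualifies, so it never affects the infimum over finite l and
   yields the convention inf {} = \<infinity>. *)
definition decreasing_rearrangement ::
    "(real^'n) set \<Rightarrow> (real^'n \<Rightarrow> ennreal) \<Rightarrow> ennreal \<Rightarrow> ennreal" where
  "decreasing_rearrangement \<Omega> f t = Inf {l. distribution_function \<Omega> f l \<le> t}"

(* Functions on \<Omega> are total functions on real^'n; by P2 only their values on \<Omega> matter.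
   The non-negative measurable functions are taken to be [0,\<infinity>]-valued. *)
locale ri_norm =
  fixes \<Omega> :: "(real^'n) set" and \<rho> :: "(real^'n \<Rightarrow> ennreal) \<Rightarrow> ennreal"
  assumes P1_triangle:
      "\<lbrakk>f \<in> borel_measurable (lebesgue_on \<Omega>); g \<in> borel_measurable (lebesgue_on \<Omega>)\<rbrakk>
        \<Longrightarrow> \<rho> (\<lambda>x. f x + g x) \<le> \<rho> f + \<rho> g"
    and P1_homogeneous:
      "\<lbrakk>f \<in> borel_measurable (lebesgue_on \<Omega>); (0::real) \<le> c\<rbrakk>
        \<Longrightarrow> \<rho> (\<lambda>x. ennreal c * f x) = ennreal c * \<rho> f"
    and P1_definite:
      "\<lbrakk>f \<in> borel_measurable (lebesgue_on \<Omega>); \<rho> f = 0\<rbrakk> \<Longrightarrow> AE x in lebesgue_on \<Omega>. f x = 0"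
    and P2:
      "\<lbrakk>f \<in> borel_measurable (lebesgue_on \<Omega>); g \<in> borel_measurable (lebesgue_on \<Omega>);
        AE x in lebesgue_on \<Omega>. f x \<le> g x\<rbrakk> \<Longrightarrow> \<rho> f \<le> \<rho> g"
    and P3:
      "\<lbrakk>\<And>k::nat. F k \<in> borel_measurable (lebesgue_on \<Omega>); f \<in> borel_measurable (lebesgue_on \<Omega>);
        AE x in lebesgue_on \<Omega>. incseq (\<lambda>k. F k x) \<and> (\<lambda>k. F k x) \<longlonglongrightarrow> f x\<rbrakk>
        \<Longrightarrow> incseq (\<lambda>k. \<rho> (F k)) \<and> (\<lambda>k. \<rho> (F k)) \<longlonglongrightarrow> \<rho> f"
    and P4:
      "\<lbrakk>E \<in> sets (lebesgue_on \<Omega>); emeasure (lebesgue_on \<Omega>) E < \<infinity>\<rbrakk> \<Longrightarrow> \<rho> (indicator E) < \<infinity>"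
    and P5:
      "\<lbrakk>E \<in> sets (lebesgue_on \<Omega>); emeasure (lebesgue_on \<Omega>) E < \<infinity>\<rbrakk>
        \<Longrightarrow> \<exists>C>0::real. \<forall>f \<in> borel_measurable (lebesgue_on \<Omega>).
              (\<integral>\<^sup>+x\<in>E. f x \<partial>lebesgue_on \<Omega>) \<le> ennreal C * \<rho> f"
    and P6:
      "\<lbrakk>f \<in> borel_measurable (lebesgue_on \<Omega>); g \<in> borel_measurable (lebesgue_on \<Omega>);
        decreasing_rearrangement \<Omega> f = decreasing_rearrangement \<Omega> g\<rbrakk> \<Longrightarrow> \<rho> f = \<rho> g"

definition norm_of :: "((real^'n \<Rightarrow> ennreal) \<Rightarrow> ennreal) \<Rightarrow> (real^'n \<Rightarrow> real) \<Rightarrow> ennreal" where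
  "norm_of \<rho> f = \<rho> (\<lambda>x. ennreal \<bar>f x\<bar>)"

definition ri_space ::
    "(real^'n) set \<Rightarrow> ((real^'n \<Rightarrow> ennreal) \<Rightarrow> ennreal) \<Rightarrow> (real^'n \<Rightarrow> real) set" where
  "ri_space \<Omega> \<rho> = {f \<in> borel_measurable (lebesgue_on \<Omega>). norm_of \<rho> f < \<infinity>}"

(* Meant for t \<ge> 0. The value does not depend on E by P6, and a suitable E exists because
   Lebesgue measure has no atoms; the minimum encodes the constant extension beyond |\<Omega>|. *)
definition fundamental_function ::
    "(real^'n) set \<Rightarrow> ((real^'n \<Rightarrow> ennreal) \<Rightarrow> ennreal) \<Rightarrow> real \<Rightarrow> ennreal" where
  "fundamental_function \<Omega> \<rho> t = (THE c. \<exists>E \<in> sets (lebesgue_on \<Omega>).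
     emeasure (lebesgue_on \<Omega>) E = min (ennreal t) (emeasure (lebesgue_on \<Omega>) \<Omega>) \<and>
     c = \<rho> (indicator E))"

definition equivalent_functions :: "(real \<Rightarrow> ennreal) \<Rightarrow> (real \<Rightarrow> ennreal) \<Rightarrow> bool" where
  "equivalent_functions \<phi> \<psi> \<longleftrightarrow>
     (\<exists>C>0::real. \<forall>t\<ge>0. \<phi> t \<le> ennreal C * \<psi> t \<and> \<psi> t \<le> ennreal C * \<phi> t)"

definition same_fundamental_level ::
    "(real^'n) set \<Rightarrow> ((real^'n \<Rightarrow> ennreal) \<Rightarrow> ennreal) \<Rightarrow> ((real^'n \<Rightarrow> ennreal) \<Rightarrow> ennreal) \<Rightarrow> bool"
  where
  "same_fundamental_level \<Omega> \<rho>\<^sub>1 \<rho>\<^sub>2 \<longleftrightarrow>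
     equivalent_functions (fundamental_function \<Omega> \<rho>\<^sub>1) (fundamental_function \<Omega> \<rho>\<^sub>2)"


section \<open>Weak derivatives and Sobolev spaces\<close>

definition partial_derivative :: "'n \<Rightarrow> (real^'n \<Rightarrow> real) \<Rightarrow> real^'n \<Rightarrow> real" where
  "partial_derivative i f x = frechet_derivative f (at x) (axis i 1)"

fun iterated_partial :: "'n list \<Rightarrow> (real^'n \<Rightarrow> real) \<Rightarrow> real^'n \<Rightarrow> real" where
  "iterated_partial [] f = f"
| "iterated_partial (i # is) f = partial_derivative i (iterated_partial is f)"

(* Smooth functions with compact support in \<Omega>, extended by zero to the whole space. *)
definition test_functions :: "(real^'n) set \<Rightarrow> (real^'n \<Rightarrow> real) set" where
  "test_functions \<Omega> = {\<phi>. (\<forall>is. iterated_partial is \<phi> differentiable_on UNIV) \<and>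
     compact (closure {x. \<phi> x \<noteq> 0}) \<and> closure {x. \<phi> x \<noteq> 0} \<subseteq> \<Omega>}"

definition locally_integrable :: "(real^'n) set \<Rightarrow> (real^'n \<Rightarrow> real) \<Rightarrow> bool" where
  "locally_integrable \<Omega> u \<longleftrightarrow> u \<in> borel_measurable (lebesgue_on \<Omega>) \<and>
     (\<forall>K. compact K \<and> K \<subseteq> \<Omega> \<longrightarrow> set_integrable lebesgue K u)"

definition has_weak_derivative ::
    "(real^'n) set \<Rightarrow> 'n list \<Rightarrow> (real^'n \<Rightarrow> real) \<Rightarrow> (real^'n \<Rightarrow> real) \<Rightarrow> bool" where
  "has_weak_derivative \<Omega> is u v \<longleftrightarrow> locally_integrable \<Omega> u \<and> locally_integrable \<Omega> v \<and>
     (\<forall>\<phi> \<in> test_functions \<Omega>.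
        (\<integral>x. u x * iterated_partial is \<phi> x \<partial>lebesgue_on \<Omega>) =
        (-1) ^ length is * (\<integral>x. v x * \<phi> x \<partial>lebesgue_on \<Omega>))"

(* Weak derivatives are unique up to null sets, on which r.i. norms do not depend. *)
definition weak_derivative ::
    "(real^'n) set \<Rightarrow> 'n list \<Rightarrow> (real^'n \<Rightarrow> real) \<Rightarrow> real^'n \<Rightarrow> real" where
  "weak_derivative \<Omega> is u = (if is = [] then u else (SOME v. has_weak_derivative \<Omega> is u v))"

definition weakly_differentiable :: "(real^'n) set \<Rightarrow> nat \<Rightarrow> (real^'n \<Rightarrow> real) \<Rightarrow> bool" where
  "weakly_differentiable \<Omega> m u \<longleftrightarrow>
     (\<forall>is. length is \<le> m \<longrightarrow> (\<exists>v. has_weak_derivative \<Omega> is u v))"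

(* Euclidean norm of the k-th order gradient, whose components are indexed by the k-tuples of
   coordinate directions. *)
definition gradient_norm :: "(real^'n) set \<Rightarrow> nat \<Rightarrow> (real^'n \<Rightarrow> real) \<Rightarrow> real^'n \<Rightarrow> real" where
  "gradient_norm \<Omega> k u x = L2_set (\<lambda>is. weak_derivative \<Omega> is u x) {is. length is = k}"

definition sobolev_space ::
    "(real^'n) set \<Rightarrow> nat \<Rightarrow> ((real^'n \<Rightarrow> ennreal) \<Rightarrow> ennreal) \<Rightarrow> (real^'n \<Rightarrow> real) set" where
  "sobolev_space \<Omega> m \<rho> =
     {u. weakly_differentiable \<Omega> m u \<and> (\<forall>k\<le>m. gradient_norm \<Omega> k u \<in> ri_space \<Omega> \<rho>)}"

definition sobolev_norm ::
    "(real^'n) set \<Rightarrow> nat \<Rightarrow> ((real^'n \<Rightarrow> ennreal) \<Rightarrow> ennreal) \<Rightarrow> (real^'n \<Rightarrow> real) \<Rightarrow> ennreal" where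
  "sobolev_norm \<Omega> m \<rho> u = (\<Sum>k\<le>m. norm_of \<rho> (gradient_norm \<Omega> k u))"

definition sobolev_embedding ::
    "(real^'n) set \<Rightarrow> nat \<Rightarrow> ((real^'n \<Rightarrow> ennreal) \<Rightarrow> ennreal) \<Rightarrow>
     ((real^'n \<Rightarrow> ennreal) \<Rightarrow> ennreal) \<Rightarrow> bool" where
  "sobolev_embedding \<Omega> m \<rho>X \<rho>Y \<longleftrightarrow>
     (\<exists>C::real. \<forall>u \<in> sobolev_space \<Omega> m \<rho>X. norm_of \<rho>Y u \<le> ennreal C * sobolev_norm \<Omega> m \<rho>X u)"

definition optimal_domain ::
    "(real^'n) set \<Rightarrow> nat \<Rightarrow> ((real^'n \<Rightarrow> ennreal) \<Rightarrow> ennreal) \<Rightarrow>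
     ((real^'n \<Rightarrow> ennreal) \<Rightarrow> ennreal) \<Rightarrow> bool" where
  "optimal_domain \<Omega> m \<rho>Y \<rho>X \<longleftrightarrow> ri_norm \<Omega> \<rho>X \<and> sobolev_embedding \<Omega> m \<rho>X \<rho>Y \<and>
     (\<forall>\<rho>. ri_norm \<Omega> \<rho> \<and> sobolev_embedding \<Omega> m \<rho> \<rho>Y \<longrightarrow> ri_space \<Omega> \<rho> \<subseteq> ri_space \<Omega> \<rho>X)"


section \<open>Lipschitz domains\<close>

(* Near each boundary point, \<Omega> lies strictly above the graph of a Lipschitz function, after a
   change of orthonormal coordinates that makes the unit vector v the last axis; the other
   coordinates are those of the hyperplane orthogonal to v. *)
definition lipschitz_boundary :: "(real^'n) set \<Rightarrow> bool" where
  "lipschitz_boundary \<Omega> \<longleftrightarrow> (\<forall>p \<in> frontier \<Omega>. \<exists>r>0. \<exists>v \<gamma> L.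
     norm v = 1 \<and> L-lipschitz_on {y. y \<bullet> v = 0} \<gamma> \<and>
     \<Omega> \<inter> ball p r = {x \<in> ball p r. x \<bullet> v > (\<gamma> (x - (x \<bullet> v) *\<^sub>R v) :: real)})"

definition bounded_lipschitz_domain :: "(real^'n) set \<Rightarrow> bool" where
  "bounded_lipschitz_domain \<Omega> \<longleftrightarrow>
     open \<Omega> \<and> connected \<Omega> \<and> \<Omega> \<noteq> {} \<and> bounded \<Omega> \<and> lipschitz_boundary \<Omega>"

end

theory Submission
  imports Defs
begin

text \<open>
  Write \<open>n\<close> for the dimension and \<open>\<phi>\<^sub>Z\<close> for the fundamental function of a space \<open>Z\<close>.  The
  fundamental function of the optimal domain \<open>X\<close> depends on the target \<open>Y\<close> only through
  \<open>\<phi>\<^sub>Y\<close>, because up to constants \<open>\<phi>\<^sub>X(s)\<close> is \<open>s\<close> times the supremum of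
  \<open>a powr (m/n - 1) * \<phi>\<^sub>Y(a)\<close> over \<open>s \<le> a \<le> |\<Omega>|\<close>.  Fundamental functions are increasing
  and doubling, so everything is done at the dyadic values \<open>t k = |\<Omega>| / 2^k\<close>, where the two
  halves of this equivalence become inequalities between sequences.

  The lower bound for \<open>\<phi>\<^sub>X\<close> comes from scaling.  A fixed smooth bump concentrated on a cube of
  volume \<open>a\<close> is of size 1 there while its derivatives of order \<open>k \<le> m\<close> are of size
  \<open>a powr (-k/n)\<close>, so an embedding into \<open>Y\<close> forces \<open>a powr (m/n) * \<phi>\<^sub>Y(a) \<le> C \<phi>\<^sub>X(a)\<close>
  (\<open>sobolev_embedding_fundamental_function_le\<close>).  That \<open>\<phi>\<^sub>X(a) / a\<close> is almost decreasing
  (\<open>ff_dyadic_le\<close>) turns this into the supremum above.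

  For the upper bound it is enough to exhibit some r.i. space \<open>Z\<close> with the right fundamental
  function that embeds into \<open>Y\<close>: then \<open>Z \<subseteq> X\<close> by optimality, and an inclusion of r.i. spaces
  is automatically bounded (\<open>ri_space_inclusion_fundamental_function_le\<close>, a gliding hump).  The
  space \<open>Z\<close> is obtained by applying \<open>m\<close> times a first-order construction,
  \<open>sobolev_domain\<close>, which to an r.i. norm \<open>\<rho>\<close> assigns the Lorentz norm whose fundamental
  function is comparable to \<open>s\<close> times the supremum of \<open>a powr (1/n - 1) * \<phi>\<^sub>\<rho>(a)\<close> over
  \<open>a \<ge> s\<close>.  Being a weighted sum of \<open>K\<close>-functionals between \<open>L\<^sup>1\<close> and \<open>L\<^sup>\<infinity>\<close> it is visibly
  an r.i. norm.  The first-order embedding holds for every r.i. norm \<open>\<rho>\<close>, so the construction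
  can be iterated, and iteration adds up the exponents \<open>1/n\<close>
  (\<open>iterated_domain_fundamental_function_le\<close>).

  The analytic core is thus the first-order embedding (\<open>first_order_embedding_borel\<close>).  The
  function \<open>u\<close> is cut at the levels \<open>\<lambda>\<^sub>j\<close> given by its decreasing rearrangement at \<open>t j\<close>.
  A relative isoperimetric estimate of weak type (\<open>level_set_estimate\<close>) bounds
  \<open>\<lambda>\<^sub>j\<^sub>+\<^sub>1 - \<lambda>\<^sub>j\<close>, for large \<open>j\<close> and up to a constant, by \<open>t j powr (1/n - 1)\<close> times
  the integral of the gradient over the slice \<open>\<lambda>\<^sub>j < |u| < \<lambda>\<^sub>j\<^sub>+\<^sub>1\<close>.  The slices are disjoint, and slice \<open>j\<close> lies in a set of measure at
  most \<open>t j\<close>; summing by parts gives exactly the \<open>K\<close>-functionals of the gradient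
  (\<open>weighted_slices_le_sobolev_domain\<close>).  Levels chosen by measure rather than by height are what
  keeps the sum sharp at the end point \<open>L\<^sup>1\<close>.

  The isoperimetric estimate itself uses only segments.  A Lipschitz domain is covered by finitely
  many patches, each with a ball of directions \<open>w\<close> such that \<open>x + s w\<close> stays in \<open>\<Omega>\<close> for all
  \<open>x\<close> in the patch and \<open>0 \<le> s \<le> 1\<close>.  On almost every such segment \<open>u\<close> is absolutely
  continuous (\<open>weak_gradient_along_segment\<close>).  If \<open>u\<close> is large at \<open>x\<close> then for half of the
  directions it is small at \<open>x + w\<close>, since the set where it is large has small measure; on the
  way \<open>u\<close> crosses the slice, and its gradient there pays for the difference of levels.
  Integrating over \<open>x\<close> and \<open>w\<close> gives the estimate by Fubini.
\<close>

section \<open>Partial derivatives and smooth functions\<close>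

lemma partial_derivative_eqI:
  "(f has_derivative f') (at x) \<Longrightarrow> partial_derivative i f x = f' (axis i 1)"
  unfolding partial_derivative_def by (simp add: frechet_derivative_at[symmetric])

lemma has_derivative_frechet:
  "f differentiable_on UNIV \<Longrightarrow> (f has_derivative frechet_derivative f (at x)) (at x)"
  by (simp add: differentiable_on_def frechet_derivative_works)

lemma partial_derivative_add:
  assumes "f differentiable_on UNIV" "g differentiable_on UNIV"
  shows "partial_derivative i (\<lambda>x. f x + g x) = (\<lambda>x. partial_derivative i f x + partial_derivative i g x)"
proof
  fix x
  show "partial_derivative i (\<lambda>x. f x + g x) x = partial_derivative i f x + partial_derivative i g x"
    using partial_derivative_eqI[OF has_derivative_add[OF has_derivative_frechet[OF assms(1), of x]
        has_derivative_frechet[OF assms(2), of x]], of i]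
    by (simp add: partial_derivative_def[of i f] partial_derivative_def[of i g])
qed

lemma partial_derivative_mult:
  assumes "f differentiable_on UNIV" "g differentiable_on UNIV"
  shows "partial_derivative i (\<lambda>x. f x * g x)
       = (\<lambda>x. f x * partial_derivative i g x + partial_derivative i f x * g x)"
proof
  fix x
  show "partial_derivative i (\<lambda>x. f x * g x) x
       = f x * partial_derivative i g x + partial_derivative i f x * g x"
    using partial_derivative_eqI[OF has_derivative_mult[OF has_derivative_frechet[OF assms(1), of x]
        has_derivative_frechet[OF assms(2), of x]], of i]
    by (simp add: partial_derivative_def[of i f] partial_derivative_def[of i g])
qed

lemma partial_derivative_affine:
  assumes "f differentiable_on UNIV"
  shows "partial_derivative i (\<lambda>x. a * f (c *\<^sub>R x + d)) = (\<lambda>x. a * c * partial_derivative i f (c *\<^sub>R x + d))"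
proof
  fix x
  have 1: "((\<lambda>x. c *\<^sub>R x + d) has_derivative (\<lambda>h. c *\<^sub>R h)) (at x)"
    by (auto intro!: derivative_eq_intros)
  have 2: "((\<lambda>x. a * f (c *\<^sub>R x + d)) has_derivative
      (\<lambda>h. a * frechet_derivative f (at (c *\<^sub>R x + d)) (c *\<^sub>R h))) (at x)"
    by (rule has_derivative_mult_right[OF has_derivative_compose[OF 1 has_derivative_frechet[OF assms]]])
  have "linear (frechet_derivative f (at (c *\<^sub>R x + d)))"
    using has_derivative_frechet[OF assms] has_derivative_linear by blast
  then show "partial_derivative i (\<lambda>x. a * f (c *\<^sub>R x + d)) x = a * c * partial_derivative i f (c *\<^sub>R x + d)"
    using partial_derivative_eqI[OF 2, of i]
    by (simp add: linear_cmul partial_derivative_def)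
qed

lemma frechet_derivative_eq_sum_partial:
  fixes f :: "real^'n \<Rightarrow> real"
  assumes "f differentiable_on UNIV"
  shows "frechet_derivative f (at x) w = (\<Sum>i\<in>UNIV. w $ i * partial_derivative i f x)"
proof -
  have l: "linear (frechet_derivative f (at x))"
    using has_derivative_frechet[OF assms] has_derivative_linear by blast
  have "frechet_derivative f (at x) w = frechet_derivative f (at x) (\<Sum>i\<in>UNIV. w $ i *\<^sub>R axis i 1)"
    using basis_expansion[of w] by (simp add: scalar_mult_eq_scaleR)
  also have "\<dots> = (\<Sum>i\<in>UNIV. w $ i * partial_derivative i f x)"
    by (simp add: linear_sum[OF l] linear_cmul[OF l] partial_derivative_def)
  finally show ?thesis .
qed

lemma iterated_partial_append:
  "iterated_partial (is @ js) f = iterated_partial is (iterated_partial js f)"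
  by (induction "is") auto

definition smooth :: "(real^'n \<Rightarrow> real) \<Rightarrow> bool" where
  "smooth f \<longleftrightarrow> (\<forall>is. iterated_partial is f differentiable_on UNIV)"

text \<open>Peels off the innermost derivative instead of the outermost one.  The product rule then reduces
  the order of both factors, so closure under products is an induction on the order.\<close>
primrec smooth_upto :: "nat \<Rightarrow> (real^'n \<Rightarrow> real) \<Rightarrow> bool" where
  "smooth_upto 0 f \<longleftrightarrow> f differentiable_on UNIV"
| "smooth_upto (Suc k) f \<longleftrightarrow>
     f differentiable_on UNIV \<and> (\<forall>i. smooth_upto k (partial_derivative i f))"

lemma smooth_upto_SucD: "smooth_upto (Suc k) f \<Longrightarrow> smooth_upto k f"
  by (induction k arbitrary: f) auto

lemma smooth_upto_add:
  "smooth_upto k f \<Longrightarrow> smooth_upto k g \<Longrightarrow> smooth_upto k (\<lambda>x. f x + g x)"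
  by (induction k arbitrary: f g) (auto simp: partial_derivative_add)

lemma smooth_upto_mult:
  "smooth_upto k f \<Longrightarrow> smooth_upto k g \<Longrightarrow> smooth_upto k (\<lambda>x. f x * g x)"
proof (induction k arbitrary: f g)
  case 0
  then show ?case by auto
next
  case (Suc k)
  then show ?case
    using smooth_upto_SucD[OF Suc.prems(1)] smooth_upto_SucD[OF Suc.prems(2)]
    by (auto simp: partial_derivative_mult intro!: smooth_upto_add Suc.IH)
qed

lemma smooth_iff_smooth_upto:
  fixes f :: "real^'n \<Rightarrow> real"
  shows "smooth f \<longleftrightarrow> (\<forall>k. smooth_upto k f)"
proof (intro iffI allI)
  fix k assume "smooth f"
  then show "smooth_upto k f"
  proof (induction k arbitrary: f)
    case 0
    then show ?case by (auto simp: smooth_def dest: spec[of _ "[]"])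
  next
    case (Suc k)
    have "smooth (partial_derivative i f)" for i
      unfolding smooth_def
    proof
      fix "is" :: "'n list"
      show "iterated_partial is (partial_derivative i f) differentiable_on UNIV"
        using Suc.prems iterated_partial_append[of "is" "[i]" f]
        by (metis iterated_partial.simps smooth_def)
    qed
    moreover have "f differentiable_on UNIV"
      using Suc.prems by (auto simp: smooth_def dest: spec[of _ "[]"])
    ultimately show ?case by (auto intro: Suc.IH)
  qed
next
  assume *: "\<forall>k. smooth_upto k f"
  show "smooth f" unfolding smooth_def
  proof
    fix "is" :: "'n list"
    from * have "smooth_upto (length is) f" by simp
    then show "iterated_partial is f differentiable_on UNIV"
    proof (induction "is" arbitrary: f rule: rev_induct)
      case Nil
      then show ?case by simp
    next
      case (snoc i "is")
      then show ?case by (simp add: iterated_partial_append)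
    qed
  qed
qed

lemma smooth_mult: "smooth f \<Longrightarrow> smooth g \<Longrightarrow> smooth (\<lambda>x. f x * g x)"
  by (simp add: smooth_iff_smooth_upto smooth_upto_mult)

lemma smooth_iterated_partial: "smooth f \<Longrightarrow> smooth (iterated_partial is f)"
  unfolding smooth_def iterated_partial_append[symmetric] by simp

lemma smooth_differentiable: "smooth f \<Longrightarrow> f differentiable_on UNIV"
  by (auto simp: smooth_def dest: spec[of _ "[]"])

lemma smooth_partial_derivative: "smooth f \<Longrightarrow> smooth (partial_derivative i f)"
  using smooth_iterated_partial[of f "[i]"] by simp

lemma smooth_continuous: "smooth f \<Longrightarrow> continuous_on UNIV f"
  by (simp add: smooth_differentiable differentiable_imp_continuous_on)

lemma iterated_partial_affine:
  assumes "smooth f"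
  shows "iterated_partial is (\<lambda>x. f (c *\<^sub>R x + d)) = (\<lambda>x. c ^ length is * iterated_partial is f (c *\<^sub>R x + d))"
proof (induction "is")
  case (Cons i "is")
  then show ?case
    using partial_derivative_affine[OF smooth_differentiable[OF smooth_iterated_partial[OF assms]], of i "c ^ length is" "is" c d]
    by (simp add: mult.commute mult.left_commute)
qed simp

lemma smooth_affine:
  fixes f :: "real^'n \<Rightarrow> real"
  assumes "smooth f"
  shows "smooth (\<lambda>x. f (c *\<^sub>R x + d))"
  unfolding smooth_def iterated_partial_affine[OF assms]
proof
  fix "is" :: "'n list"
  have "iterated_partial is f differentiable_on UNIV"
    using assms by (simp add: smooth_def)
  then have "(\<lambda>x. iterated_partial is f (c *\<^sub>R x + d)) differentiable_on UNIV"
    unfolding differentiable_on_def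
    by (intro ballI differentiable_compose[of "iterated_partial is f" "\<lambda>x. c *\<^sub>R x + d"]) auto
  then show "(\<lambda>x. c ^ length is * iterated_partial is f (c *\<^sub>R x + d)) differentiable_on UNIV"
    by (intro differentiable_on_mult differentiable_on_const)
qed

section \<open>Smooth bumps\<close>

text \<open>The functions \<open>p(1/t) exp(-1/t)\<close> with a polynomial \<open>p\<close>, continued by 0 to \<open>t \<le> 0\<close>.  The
  family is closed under differentiation, which makes the smoothness of \<open>exp(-1/t)\<close> at the origin
  a single limit instead of one for every order.\<close>
definition flat_exp :: "real poly \<Rightarrow> real \<Rightarrow> real" where
  "flat_exp p t = (if 0 < t then poly p (inverse t) * exp (- inverse t) else 0)"

lemma poly_times_exp_minus_tendsto_0:
  "((\<lambda>x::real. poly p x * exp (- x)) \<longlongrightarrow> 0) at_top"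
proof -
  have "((\<lambda>x::real. \<Sum>i\<le>degree p. coeff p i * (x ^ i / exp x)) \<longlongrightarrow> (\<Sum>i\<le>degree p. coeff p i * 0)) at_top"
    by (intro tendsto_sum tendsto_mult tendsto_const tendsto_power_div_exp_0)
  then show ?thesis
    by (simp add: poly_altdef exp_minus sum_distrib_right divide_inverse mult.assoc)
qed

lemma flat_exp_tendsto_0: "(flat_exp p \<longlongrightarrow> 0) (at_right 0)"
proof -
  have "((\<lambda>t::real. poly p (inverse t) * exp (- inverse t)) \<longlongrightarrow> 0) (at_right 0)"
    by (rule filterlim_compose[OF poly_times_exp_minus_tendsto_0 filterlim_inverse_at_top_right])
  then show ?thesis
    by (rule Lim_transform_eventually)
       (auto simp: flat_exp_def eventually_at_right_less intro!: eventually_mono[OF eventually_at_right_less])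
qed

text \<open>Only \<open>t = 0\<close> is not routine: there the difference quotient from the right is again in the
  family, with \<open>p\<close> multiplied by the variable, and so tends to 0.\<close>
lemma flat_exp_has_derivative:
  "(flat_exp p has_real_derivative flat_exp ([:0, 0, 1:] * (p - pderiv p)) t) (at t)"
proof -
  consider "t > 0" | "t < 0" | "t = 0" by linarith
  then show ?thesis
  proof cases
    case 1
    have "((\<lambda>t. poly p (inverse t) * exp (- inverse t)) has_real_derivative
        flat_exp ([:0, 0, 1:] * (p - pderiv p)) t) (at t)"
      using 1 by (auto intro!: derivative_eq_intros DERIV_chain'[where g = "poly p"]
          simp: flat_exp_def algebra_simps power2_eq_square)
    then show ?thesis
      by (rule DERIV_cong_ev[OF refl _ refl, THEN iffD1, rotated])
         (use 1 in \<open>auto simp: flat_exp_def intro!: eventually_mono[OF eventually_nhds_in_open[of "{0<..}"]]\<close>)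
  next
    case 2
    have "((\<lambda>t. 0) has_real_derivative 0) (at t)" by simp
    then have "(flat_exp p has_real_derivative 0) (at t)"
      by (rule DERIV_cong_ev[OF refl _ refl, THEN iffD1, rotated])
         (use 2 in \<open>auto simp: flat_exp_def intro!: eventually_mono[OF eventually_nhds_in_open[of "{..<0}"]]\<close>)
    then show ?thesis using 2 by (simp add: flat_exp_def)
  next
    case 3
    have "((\<lambda>h. (flat_exp p (0 + h) - flat_exp p 0) / h) \<longlongrightarrow> 0) (at_right 0)"
      by (rule Lim_transform_eventually[OF flat_exp_tendsto_0[of "[:0,1:] * p"]])
         (auto simp: flat_exp_def divide_inverse intro!: eventually_mono[OF eventually_at_right_less])
    moreover have "((\<lambda>h. (flat_exp p (0 + h) - flat_exp p 0) / h) \<longlongrightarrow> 0) (at_left 0)"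
      by (rule Lim_transform_eventually[OF tendsto_const])
         (auto simp: flat_exp_def eventually_at_filter)
    ultimately show ?thesis
      unfolding 3 has_field_derivative_iff
      by (auto simp: flat_exp_def filterlim_at_split)
  qed
qed

lemma smooth_flat_exp_coordinate: "smooth (\<lambda>x::real^'n. flat_exp p (c * x $ i + d))"
  unfolding smooth_iff_smooth_upto
proof
  fix k
  have deriv: "((\<lambda>x::real^'n. flat_exp p (c * x $ i + d)) has_derivative
      (\<lambda>h. flat_exp ([:0, 0, 1:] * (p - pderiv p)) (c * x $ i + d) * (c * h $ i))) (at x)" for p and x :: "real^'n"
  proof -
    have 1: "((\<lambda>x::real^'n. c * x $ i + d) has_derivative (\<lambda>h. c * h $ i)) (at x)"
      by (auto intro!: derivative_eq_intros bounded_linear.has_derivative[OF bounded_linear_vec_nth])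
    show ?thesis
      using has_derivative_compose[OF 1 flat_exp_has_derivative[unfolded has_field_derivative_def]] .
  qed
  show "smooth_upto k (\<lambda>x::real^'n. flat_exp p (c * x $ i + d))"
  proof (induction k arbitrary: p)
    case 0
    show ?case using deriv by (auto simp: differentiable_on_def differentiable_def)
  next
    case (Suc k)
    have "partial_derivative j (\<lambda>x::real^'n. flat_exp p (c * x $ i + d)) =
       (\<lambda>x. flat_exp (if i = j then smult c ([:0, 0, 1:] * (p - pderiv p)) else 0) (c * x $ i + d))" for j
      unfolding fun_eq_iff partial_derivative_eqI[OF deriv]
      by (auto simp: axis_def flat_exp_def)
    then show ?case
      using deriv Suc.IH by (auto simp: differentiable_on_def differentiable_def)
  qed
qed

lemma partial_derivative_const: "partial_derivative i (\<lambda>x. c) = (\<lambda>x. 0)"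
  by (simp add: fun_eq_iff partial_derivative_eqI[OF has_derivative_const])

lemma smooth_const: "smooth (\<lambda>x. c)"
proof -
  have "smooth_upto k (\<lambda>x. c)" for k
    by (induction k arbitrary: c) (auto simp: partial_derivative_const)
  then show ?thesis unfolding smooth_iff_smooth_upto by blast
qed

lemma smooth_prod: "finite S \<Longrightarrow> (\<And>i. i \<in> S \<Longrightarrow> smooth (f i)) \<Longrightarrow> smooth (\<lambda>x. \<Prod>i\<in>S. f i x)"
  by (induction S rule: finite_induct) (auto intro: smooth_const smooth_mult)

text \<open>A smooth function that is positive exactly on the open box; for growing \<open>k\<close> it converges to the
  indicator of the box.\<close>
definition box_bump :: "real \<Rightarrow> real^'n \<Rightarrow> real^'n \<Rightarrow> real^'n \<Rightarrow> real" where
  "box_bump k a b x = (\<Prod>i\<in>UNIV. flat_exp 1 (k * (x $ i - a $ i)) * flat_exp 1 (k * (b $ i - x $ i)))"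

lemma smooth_box_bump: "smooth (box_bump k a b)"
proof -
  have 1: "smooth (\<lambda>x. flat_exp 1 (k * (x $ i - a $ i)))" for i
    using smooth_flat_exp_coordinate[of 1 k i "- k * a $ i"] by (simp add: algebra_simps)
  have 2: "smooth (\<lambda>x. flat_exp 1 (k * (b $ i - x $ i)))" for i
    using smooth_flat_exp_coordinate[of 1 "-k" i "k * b $ i"] by (simp add: algebra_simps)
  show ?thesis unfolding box_bump_def[abs_def] by (intro smooth_prod smooth_mult 1 2) auto
qed

lemma flat_exp_1_bounds: "0 \<le> flat_exp 1 t" "flat_exp 1 t \<le> 1"
  by (auto simp: flat_exp_def)

lemma flat_exp_1_nz: "flat_exp 1 t \<noteq> 0 \<longleftrightarrow> 0 < t"
  by (auto simp: flat_exp_def)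

lemma box_bump_nonneg: "0 \<le> box_bump k a b x"
  by (auto simp: box_bump_def flat_exp_1_bounds intro!: prod_nonneg)

lemma box_bump_le_1: "box_bump k a b x \<le> 1"
  by (auto simp: box_bump_def flat_exp_1_bounds intro!: prod_le_1 mult_le_one)

lemma box_bump_nz_iff: "0 < k \<Longrightarrow> box_bump k a b x \<noteq> 0 \<longleftrightarrow> x \<in> box a b"
  by (auto simp: box_bump_def flat_exp_1_nz mem_box_cart zero_less_mult_iff)

lemma box_bump_support: "0 < k \<Longrightarrow> closure {x. box_bump k a b x \<noteq> 0} \<subseteq> cbox a b"
  by (intro closure_minimal) (auto simp: box_bump_nz_iff intro: subsetD[OF box_subset_cbox])

lemma box_bump_tendsto:
  "(\<lambda>k. box_bump (real (Suc k)) a b x) \<longlonglongrightarrow> indicator (box a b) x"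
proof (cases "x \<in> box a b")
  case True
  have lim: "(\<lambda>k. flat_exp 1 (real (Suc k) * t)) \<longlonglongrightarrow> 1" if "t > 0" for t
  proof -
    have "(\<lambda>k. exp (- (inverse (real (Suc k)) * inverse t))) \<longlonglongrightarrow> exp (- (0 * inverse t))"
      by (intro tendsto_exp tendsto_minus tendsto_mult tendsto_const LIMSEQ_inverse_real_of_nat)
    then show ?thesis using that by (simp add: flat_exp_def del: of_nat_Suc)
  qed
  have "(\<lambda>k. box_bump (real (Suc k)) a b x) \<longlonglongrightarrow> (\<Prod>i\<in>(UNIV::'a set). 1 * 1)"
    unfolding box_bump_def
    by (intro tendsto_prod tendsto_mult lim) (use True in \<open>auto simp: mem_box_cart\<close>)
  then show ?thesis using True by simp
next
  case False
  then have "box_bump (real (Suc k)) a b x = 0" for k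
    using box_bump_nz_iff[of "real (Suc k)" a b x] by auto
  then show ?thesis using False by simp
qed

section \<open>Test functions and integration by parts\<close>

lemma test_functions_iff:
  "\<phi> \<in> test_functions \<Omega> \<longleftrightarrow>
     smooth \<phi> \<and> compact (closure {x. \<phi> x \<noteq> 0}) \<and> closure {x. \<phi> x \<noteq> 0} \<subseteq> \<Omega>"
  by (simp add: test_functions_def smooth_def)

lemma box_bump_test:
  assumes "0 < k" "cbox a b \<subseteq> \<Omega>"
  shows "box_bump k a b \<in> test_functions \<Omega>"
  using box_bump_support[OF assms(1), of a b] assms(2) smooth_box_bump[of k a b]
  by (auto simp: test_functions_iff compact_eq_bounded_closed intro: bounded_subset[OF bounded_cbox])

lemma partial_derivative_support:
  "{x. partial_derivative i f x \<noteq> 0} \<subseteq> closure {x. f x \<noteq> 0}"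
proof (rule subsetI, rule ccontr)
  fix x assume x: "x \<in> {x. partial_derivative i f x \<noteq> 0}" "x \<notin> closure {x. f x \<noteq> 0}"
  have "(f has_derivative (\<lambda>h. 0)) (at x)"
    by (rule has_derivative_transform_within_open[where f="\<lambda>x. 0" and s = "- closure {x. f x \<noteq> 0}"])
       (use x closure_subset[of "{x. f x \<noteq> 0}"] in auto)
  from partial_derivative_eqI[OF this, of i] x show False by simp
qed

lemma test_functions_partial_derivative:
  assumes "\<phi> \<in> test_functions \<Omega>"
  shows "partial_derivative i \<phi> \<in> test_functions \<Omega>"
proof -
  have "closure {x. partial_derivative i \<phi> x \<noteq> 0} \<subseteq> closure {x. \<phi> x \<noteq> 0}"
    by (simp add: closure_minimal partial_derivative_support)
  then show ?thesis
    using assms smooth_partial_derivative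
    by (auto simp: test_functions_iff compact_eq_bounded_closed intro: bounded_subset)
qed

lemma test_functions_iterated_partial:
  "\<phi> \<in> test_functions \<Omega> \<Longrightarrow> iterated_partial is \<phi> \<in> test_functions \<Omega>"
  by (induction "is") (auto intro: test_functions_partial_derivative)

lemma test_functions_mult:
  assumes "\<phi> \<in> test_functions \<Omega>" "smooth g"
  shows "(\<lambda>x. g x * \<phi> x) \<in> test_functions \<Omega>"
proof -
  have "closure {x. g x * \<phi> x \<noteq> 0} \<subseteq> closure {x. \<phi> x \<noteq> 0}"
    by (intro closure_mono) auto
  then show ?thesis
    using assms smooth_mult
    by (auto simp: test_functions_iff compact_eq_bounded_closed intro: bounded_subset)
qed

lemma test_functions_zero_outside:
  "\<phi> \<in> test_functions \<Omega> \<Longrightarrow> x \<notin> \<Omega> \<Longrightarrow> \<phi> x = 0"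
  using closure_subset[of "{x. \<phi> x \<noteq> 0}"] by (auto simp: test_functions_iff)

lemma test_functions_borel [measurable (raw)]:
  "\<phi> \<in> test_functions \<Omega> \<Longrightarrow> \<phi> \<in> borel_measurable borel"
  by (auto simp: test_functions_iff dest!: smooth_continuous intro: borel_measurable_continuous_onI)

lemma test_functions_integrable: "\<phi> \<in> test_functions \<Omega> \<Longrightarrow> integrable lborel \<phi>"
proof -
  assume \<phi>: "\<phi> \<in> test_functions \<Omega>"
  let ?K = "closure {x. \<phi> x \<noteq> 0}"
  have "integrable lborel (\<lambda>x. indicator ?K x *\<^sub>R \<phi> x)"
    by (rule borel_integrable_compact)
       (use \<phi> in \<open>auto simp: test_functions_iff dest!: smooth_continuous intro: continuous_on_subset\<close>)
  also have "(\<lambda>x. indicator ?K x *\<^sub>R \<phi> x) = \<phi>"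
    using closure_subset[of "{x. \<phi> x \<noteq> 0}"] by (auto simp: fun_eq_iff indicator_def)
  finally show ?thesis .
qed

lemma test_functions_bounded:
  assumes "\<phi> \<in> test_functions \<Omega>"
  obtains M where "M > 0" "\<And>x. \<bar>\<phi> x\<bar> \<le> M"
proof -
  let ?K = "closure {x. \<phi> x \<noteq> 0}"
  have "compact (\<phi> ` ?K)"
    using assms by (auto simp: test_functions_iff dest!: smooth_continuous
        intro!: compact_continuous_image intro: continuous_on_subset)
  then obtain M where M: "M > 0" "\<And>y. y \<in> \<phi> ` ?K \<Longrightarrow> norm y \<le> M"
    using compact_imp_bounded bounded_pos by metis
  have "\<bar>\<phi> x\<bar> \<le> M" for x
  proof (cases "\<phi> x = 0")
    case True
    with M show ?thesis by auto
  next
    case False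
    then have "x \<in> ?K" using closure_subset[of "{x. \<phi> x \<noteq> 0}"] by auto
    with M(2)[of "\<phi> x"] show ?thesis by auto
  qed
  with M(1) that show ?thesis by blast
qed

lemma lborel_integral_translate:
  fixes f :: "'a::euclidean_space \<Rightarrow> real"
  assumes [measurable]: "f \<in> borel_measurable borel"
  shows "(\<integral>x. f (x + c) \<partial>lborel) = (\<integral>x. f x \<partial>lborel)"
proof -
  have "(\<integral>x. f x \<partial>lborel) = (\<integral>x. f x \<partial>distr lborel borel ((+) c))"
    by (simp add: lborel_distr_plus)
  also have "\<dots> = (\<integral>x. f (c + x) \<partial>lborel)"
    by (rule integral_distr) auto
  finally show ?thesis by (simp add: add.commute)
qed

lemma lborel_integrable_translate:
  fixes f :: "'a::euclidean_space \<Rightarrow> real"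
  assumes "integrable lborel f"
  shows "integrable lborel (\<lambda>x. f (x + c))"
proof -
  have "integrable (distr lborel borel ((+) c)) f"
    using assms by (simp add: lborel_distr_plus)
  then have "integrable lborel (\<lambda>x. f (c + x))"
    by (rule integrable_distr[rotated]) simp
  then show ?thesis by (simp add: add.commute)
qed

lemma lborel_nn_integral_translate:
  fixes f :: "'a::euclidean_space \<Rightarrow> ennreal"
  assumes [measurable]: "f \<in> borel_measurable borel"
  shows "(\<integral>\<^sup>+x. f (x + c) \<partial>lborel) = (\<integral>\<^sup>+x. f x \<partial>lborel)"
proof -
  have "(\<integral>\<^sup>+x. f x \<partial>lborel) = (\<integral>\<^sup>+x. f x \<partial>distr lborel borel ((+) c))"
    by (simp add: lborel_distr_plus)
  also have "\<dots> = (\<integral>\<^sup>+x. f (c + x) \<partial>lborel)"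
    by (rule nn_integral_distr) auto
  finally show ?thesis by (simp add: add.commute)
qed

lemma partial_derivative_line:
  assumes "f differentiable_on UNIV"
  shows "((\<lambda>t. f (x + t *\<^sub>R axis i 1)) has_real_derivative partial_derivative i f (x + t *\<^sub>R axis i 1)) (at t)"
proof -
  have 1: "((\<lambda>t. x + t *\<^sub>R axis i 1) has_derivative (\<lambda>h. h *\<^sub>R axis i 1)) (at t)"
    by (auto intro!: derivative_eq_intros)
  have "linear (frechet_derivative f (at (x + t *\<^sub>R axis i 1)))"
    using has_derivative_frechet[OF assms] has_derivative_linear by blast
  then show ?thesis
    using has_derivative_compose[OF 1 has_derivative_frechet[OF assms]]
    by (simp add: has_field_derivative_def linear_cmul partial_derivative_def
        mult.commute[of "frechet_derivative _ _ _"] mult_commute_abs)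
qed

text \<open>Translation invariance of Lebesgue measure makes the integral of every difference quotient vanish,
  and the difference quotients converge boundedly on a fixed ball.\<close>
lemma integral_partial_derivative_test:
  fixes f :: "real^'n \<Rightarrow> real"
  assumes f: "f \<in> test_functions \<Omega>"
  shows "(\<integral>x. partial_derivative i f x \<partial>lborel) = 0"
proof -
  \<comment> \<open>A step of length at most 1 keeps all difference quotients supported in the ball of radius B + 1.\<close>
  define h where "h k = inverse (real (Suc k))" for k
  have h: "0 < h k" "h k \<le> 1" "h \<longlonglongrightarrow> 0" for k
    using LIMSEQ_inverse_real_of_nat by (auto simp: h_def[abs_def] inverse_le_1_iff)
  define s where "s k x = (f (x + h k *\<^sub>R axis i 1) - f x) / h k" for k x
  let ?K = "closure {x. f x \<noteq> 0}"
  have diff: "f differentiable_on UNIV" using f smooth_differentiable by (auto simp: test_functions_iff)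
  obtain M where M: "M > 0" "\<And>x. \<bar>partial_derivative i f x\<bar> \<le> M"
    using test_functions_bounded[OF test_functions_partial_derivative[OF f]] by metis
  obtain B where B: "B > 0" "\<And>x. x \<in> ?K \<Longrightarrow> norm x \<le> B"
    using f compact_imp_bounded bounded_pos unfolding test_functions_iff by metis
  have meas: "f \<in> borel_measurable borel" "partial_derivative i f \<in> borel_measurable borel"
    using f test_functions_partial_derivative[OF f] test_functions_borel by blast+
  note [measurable] = meas
  have zero: "f x = 0" if "norm x > B" for x
    using B(2)[of x] that closure_subset[of "{x. f x \<noteq> 0}"] by force
  have int_s: "(\<integral>x. s k x \<partial>lborel) = 0" for k
    unfolding s_def
    using lborel_integral_translate[OF meas(1), of "h k *\<^sub>R axis i 1"]
      lborel_integrable_translate[OF test_functions_integrable[OF f], of "h k *\<^sub>R axis i 1"]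
      test_functions_integrable[OF f]
    by simp
  have "(\<lambda>k. \<integral>x. s k x \<partial>lborel) \<longlonglongrightarrow> (\<integral>x. partial_derivative i f x \<partial>lborel)"
  proof (rule integral_dominated_convergence[where w = "\<lambda>x. M * indicator (cball 0 (B + 1)) x"])
    show "s k \<in> borel_measurable lborel" for k unfolding s_def by measurable
    show "integrable lborel (\<lambda>x. M * indicator (cball 0 (B + 1)) x)"
      by (intro integrable_mult_right integrable_real_indicator) (use emeasure_bounded_finite[OF bounded_cball] in \<open>auto simp: less_top\<close>)
    show "AE x in lborel. (\<lambda>k. s k x) \<longlonglongrightarrow> partial_derivative i f x"
    proof (rule AE_I2)
      fix x
      have "(\<lambda>t. (f (x + (0 + t) *\<^sub>R axis i 1) - f (x + 0 *\<^sub>R axis i 1)) / t) \<midarrow>0\<rightarrow> partial_derivative i f (x + 0 *\<^sub>R axis i 1)"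
        using partial_derivative_line[OF diff, of x i 0] unfolding DERIV_def by simp
      then have "(\<lambda>t. (f (x + t *\<^sub>R axis i 1) - f x) / t) \<midarrow>0\<rightarrow> partial_derivative i f x"
        by simp
      then show "(\<lambda>k. s k x) \<longlonglongrightarrow> partial_derivative i f x"
        unfolding s_def
      proof (rule filterlim_compose)
        have "eventually (\<lambda>k. h k \<noteq> 0) sequentially"
          using h(1) by (intro always_eventually allI) (simp add: less_imp_neq[symmetric])
        then show "filterlim h (at 0) sequentially"
          using h(3) by (simp add: filterlim_at)
      qed
    qed
    show "AE x in lborel. norm (s k x) \<le> M * indicator (cball 0 (B + 1)) x" for k
    proof (rule AE_I2)
      fix x
      show "norm (s k x) \<le> M * indicator (cball 0 (B + 1)) x"
      proof (cases "norm x \<le> B + 1")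
        case True
        have "\<exists>z. 0 < z \<and> z < h k \<and> f (x + h k *\<^sub>R axis i 1) - f (x + 0 *\<^sub>R axis i 1)
            = (h k - 0) * partial_derivative i f (x + z *\<^sub>R axis i 1)"
          by (rule MVT2[OF h(1) partial_derivative_line[OF diff]])
        then obtain z where "f (x + h k *\<^sub>R axis i 1) - f (x + 0 *\<^sub>R axis i 1)
            = (h k - 0) * partial_derivative i f (x + z *\<^sub>R axis i 1)" by metis
        then have "s k x = partial_derivative i f (x + z *\<^sub>R axis i 1)"
          using h(1)[of k] by (simp add: s_def)
        then show ?thesis using M(2) True by simp
      next
        case False
        have "norm (x + h k *\<^sub>R axis i 1) \<ge> norm x - norm (h k *\<^sub>R (axis i 1 :: real^'n))"
          by (metis norm_diff_ineq)
        then have "norm (x + h k *\<^sub>R axis i 1) > B"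
          using False h(1,2)[of k] by simp
        then show ?thesis using False by (simp add: s_def zero)
      qed
    qed
  qed measurable
  then show ?thesis using int_s by (simp add: LIMSEQ_const_iff)
qed

lemma integration_by_parts_test:
  assumes "f \<in> test_functions \<Omega>" "g \<in> test_functions \<Omega>"
  shows "(\<integral>x. f x * partial_derivative i g x \<partial>lborel) = - (\<integral>x. partial_derivative i f x * g x \<partial>lborel)"
proof -
  have "(\<integral>x. partial_derivative i (\<lambda>x. f x * g x) x \<partial>lborel) = 0"
    using integral_partial_derivative_test[OF test_functions_mult[OF assms(2)]] assms(1)
    by (auto simp: test_functions_iff)
  moreover have "partial_derivative i (\<lambda>x. f x * g x)
       = (\<lambda>x. f x * partial_derivative i g x + partial_derivative i f x * g x)"
    using assms by (intro partial_derivative_mult) (auto simp: test_functions_iff smooth_differentiable)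
  moreover have "integrable lborel (\<lambda>x. f x * partial_derivative i g x)"
    using assms test_functions_integrable[OF test_functions_mult[OF test_functions_partial_derivative[OF assms(2)], of f]]
    by (auto simp: test_functions_iff)
  moreover have "integrable lborel (\<lambda>x. partial_derivative i f x * g x)"
    using assms test_functions_integrable[OF test_functions_mult[OF assms(2), of "partial_derivative i f"]]
    by (auto simp: test_functions_iff smooth_partial_derivative)
  ultimately show ?thesis by simp
qed

text \<open>The derivatives move across one by one, the outermost first; this reverses the list of
  directions.\<close>
lemma integration_by_parts_test_iterated:
  assumes "f \<in> test_functions \<Omega>" "g \<in> test_functions \<Omega>"
  shows "(\<integral>x. f x * iterated_partial is g x \<partial>lborel)
       = (-1) ^ length is * (\<integral>x. iterated_partial (rev is) f x * g x \<partial>lborel)"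
  using assms(1)
proof (induction "is" arbitrary: f)
  case (Cons i "is")
  show ?case
    using integration_by_parts_test[OF Cons.prems test_functions_iterated_partial[OF assms(2)], of i "is"]
      Cons.IH[OF test_functions_partial_derivative[OF Cons.prems]]
    by (simp add: iterated_partial_append)
qed simp

section \<open>The fundamental lemma of the calculus of variations\<close>

text \<open>The open boxes form an intersection-stable generator of the Borel sets, so the integrals over all
  Borel sets vanish.\<close>
lemma AE_zero_if_box_integrals_zero:
  fixes g :: "'a::euclidean_space \<Rightarrow> real"
  assumes int: "integrable lborel g"
    and box: "\<And>a b. (\<integral>x\<in>box a b. g x \<partial>lborel) = 0"
    and total: "(\<integral>x. g x \<partial>lborel) = 0"
  shows "AE x in lborel. g x = 0"
proof -
  have sint: "set_integrable lborel A g" if "A \<in> sets borel" for A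
    unfolding set_integrable_def using integrable_mult_indicator[OF _ int, of A] that by simp
  have "(\<integral>x\<in>A. g x \<partial>lborel) = 0" if A: "A \<in> sets borel" for A
  proof -
    have stable: "Int_stable (range (\<lambda>(a, b). box a b :: 'a set))"
    proof (rule Int_stableI_image)
      fix i j :: "'a \<times> 'a"
      show "\<exists>k\<in>UNIV. (case i of (a, b) \<Rightarrow> box a b) \<inter> (case j of (a, b) \<Rightarrow> box a b) = (case k of (a, b) \<Rightarrow> box a b)"
        using box_Int_box[of "fst i" "snd i" "fst j" "snd j"] by (cases i; cases j) auto
    qed
    have sub: "range (\<lambda>(a, b). box a b :: 'a set) \<subseteq> Pow UNIV" by simp
    have "A \<in> sigma_sets UNIV (range (\<lambda>(a, b). box a b))"
      using A by (subst (asm) borel_eq_box) simp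
    then show ?thesis
    proof (induction rule: sigma_sets_induct_disjoint[OF stable sub,
          consumes 1, case_names basic empty compl union])
      case (basic A)
      then show ?case using box by auto
    next
      case empty
      show ?case by (simp add: set_lebesgue_integral_def)
    next
      case (compl A)
      then have A: "A \<in> sets borel" by (subst borel_eq_box) simp
      have "(\<integral>x\<in>UNIV. g x \<partial>lborel) = (\<integral>x\<in>A. g x \<partial>lborel) + (\<integral>x\<in>UNIV - A. g x \<partial>lborel)"
        using A by (subst set_integral_Un[symmetric]) (auto intro!: sint)
      then show ?case using compl total by (simp add: set_lebesgue_integral_def)
    next
      case (union A)
      then have A: "A i \<in> sets borel" for i by (subst borel_eq_box) auto
      have "(\<integral>x\<in>(\<Union>i. A i). g x \<partial>lborel) = (\<Sum>i. \<integral>x\<in>A i. g x \<partial>lborel)"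
        using union.hyps(1) A
        by (intro lebesgue_integral_countable_add) (auto simp: disjoint_family_on_def intro!: sint)
      then show ?case using union.IH by simp
    qed
  qed
  then have "AE x in lborel. g x = (\<lambda>x. 0) x"
    by (intro density_unique_real int) (auto simp: set_lebesgue_integral_def)
  then show ?thesis by simp
qed

text \<open>The bumps converge to indicators of boxes, so the integral of \<open>f\<close> over every open box with
  closure in \<open>V\<close> vanishes; countably many closed boxes cover \<open>V\<close>.\<close>
lemma AE_zero_if_test_integrals_zero:
  fixes f :: "real^'n \<Rightarrow> real"
  assumes [measurable]: "f \<in> borel_measurable borel" and "open V"
    and loc: "\<And>a b. cbox a b \<subseteq> V \<Longrightarrow> set_integrable lborel (cbox a b) f"
    and test: "\<And>\<phi>. \<phi> \<in> test_functions V \<Longrightarrow> (\<integral>x. f x * \<phi> x \<partial>lborel) = 0"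
  shows "AE x in lborel. x \<in> V \<longrightarrow> f x = 0"
proof -
  have box0: "(\<integral>x\<in>box a b. f x \<partial>lborel) = 0" if ab: "cbox a b \<subseteq> V" for a b
  proof -
    have [measurable]: "box_bump (real (Suc k)) a b \<in> borel_measurable borel" for k
      by (rule test_functions_borel[OF box_bump_test[of _ _ _ UNIV]]) auto
    have "(\<lambda>k. \<integral>x. f x * box_bump (real (Suc k)) a b x \<partial>lborel) \<longlonglongrightarrow> (\<integral>x. f x * indicator (box a b) x \<partial>lborel)"
    proof (rule integral_dominated_convergence[where w = "\<lambda>x. \<bar>f x\<bar> * indicator (cbox a b) x"])
      show "integrable lborel (\<lambda>x. \<bar>f x\<bar> * indicator (cbox a b) x)"
        using set_integrable_abs[OF loc[OF ab]] by (simp add: set_integrable_def mult.commute)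
      show "AE x in lborel. (\<lambda>k. f x * box_bump (real (Suc k)) a b x) \<longlonglongrightarrow> f x * indicator (box a b) x"
        by (intro AE_I2 tendsto_mult tendsto_const box_bump_tendsto)
      show "AE x in lborel. norm (f x * box_bump (real (Suc k)) a b x) \<le> \<bar>f x\<bar> * indicator (cbox a b) x" for k
      proof (rule AE_I2)
        fix x
        have "\<bar>box_bump (real (Suc k)) a b x\<bar> \<le> indicator (cbox a b) x"
          using box_bump_nz_iff[of "real (Suc k)" a b x] box_bump_nonneg[of "real (Suc k)" a b x]
            box_bump_le_1[of "real (Suc k)" a b x] subsetD[OF box_subset_cbox, of x a b]
          by (cases "x \<in> box a b") (auto simp: indicator_def)
        then show "norm (f x * box_bump (real (Suc k)) a b x) \<le> \<bar>f x\<bar> * indicator (cbox a b) x"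
          by (simp add: abs_mult mult_left_mono)
      qed
    qed measurable
    moreover have "(\<integral>x. f x * box_bump (real (Suc k)) a b x \<partial>lborel) = 0" for k
      by (intro test box_bump_test ab) simp
    ultimately show ?thesis
      by (simp add: LIMSEQ_const_iff set_lebesgue_integral_def mult.commute)
  qed
  have ae: "AE x in lborel. x \<in> cbox c d \<longrightarrow> f x = 0" if cd: "cbox c d \<subseteq> V" for c d
  proof -
    let ?g = "\<lambda>x. indicator (box c d) x * f x"
    have int: "integrable lborel ?g"
    proof -
      have "set_integrable lborel (box c d) f"
        by (rule set_integrable_subset[OF loc[OF cd]]) (auto simp: box_subset_cbox)
      then show ?thesis by (simp add: set_integrable_def)
    qed
    have "AE x in lborel. ?g x = 0"
    proof (rule AE_zero_if_box_integrals_zero[OF int])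
      fix a b
      obtain a' b' where ab: "box a b \<inter> box c d = box a' b'"
        using box_Int_box[of a b c d] by blast
      show "(\<integral>x\<in>box a b. ?g x \<partial>lborel) = 0"
      proof (cases "box a' b' = {}")
        case True
        have "indicator (box a b) x *\<^sub>R ?g x = 0" for x
          using ab True by (auto simp: indicator_def)
        then show ?thesis unfolding set_lebesgue_integral_def by (simp only: integral_zero)
      next
        case False
        have "cbox a' b' = closure (box a' b')" using False by (simp add: closure_box)
        also have "\<dots> \<subseteq> cbox c d"
          by (intro closure_minimal) (use ab box_subset_cbox[of c d] in auto)
        finally have "cbox a' b' \<subseteq> V" using cd by auto
        moreover have "(\<lambda>x. indicator (box a b) x *\<^sub>R ?g x) = (\<lambda>x. indicator (box a' b') x *\<^sub>R f x)"
          unfolding ab[symmetric] by (auto simp: indicator_def)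
        ultimately show ?thesis using box0[of a' b'] unfolding set_lebesgue_integral_def by simp
      qed
    next
      show "(\<integral>x. ?g x \<partial>lborel) = 0"
        using box0[OF cd] by (simp add: set_lebesgue_integral_def)
    qed
    moreover have "AE x in lborel. x \<notin> cbox c d - box c d"
      using AE_not_in[OF negligible_frontier_interval[of c d, unfolded negligible_iff_null_sets]]
      by (simp only: AE_completion_iff)
    ultimately show ?thesis by eventually_elim (auto simp: indicator_def)
  qed
  obtain D where D: "countable D" "D \<subseteq> Pow V" "\<And>X. X \<in> D \<Longrightarrow> \<exists>a b. X = cbox a b" "\<Union>D = V"
    by (rule open_countable_Union_open_cbox[OF \<open>open V\<close>], rule that)
  have "AE x in lborel. \<forall>X\<in>D. x \<in> X \<longrightarrow> f x = 0"
    unfolding AE_ball_countable[OF D(1)]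
  proof
    fix X assume X: "X \<in> D"
    then obtain a b where "X = cbox a b" using D(3) by metis
    then show "AE x in lborel. x \<in> X \<longrightarrow> f x = 0" using ae[of a b] X D(2) by auto
  qed
  then show ?thesis by eventually_elim (use D(4) in auto)
qed

section \<open>Borel representatives and uniqueness of weak derivatives\<close>

text \<open>Arguments along segments compose \<open>u\<close> with \<open>(x, s) \<mapsto> x + s w\<close> and use Fubini.  Lebesgue measurable
  functions do not survive such a composition, Borel functions do.\<close>
lemma lebesgue_on_borel_representative:
  fixes u :: "real^'n \<Rightarrow> real"
  assumes "open \<Omega>" "u \<in> borel_measurable (lebesgue_on \<Omega>)"
  obtains u' where "u' \<in> borel_measurable borel" "\<And>x. x \<notin> \<Omega> \<Longrightarrow> u' x = 0"
    "AE x in lborel. x \<in> \<Omega> \<longrightarrow> u x = u' x"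
proof -
  have [measurable]: "\<Omega> \<in> sets borel" using assms(1) by simp
  have "(\<lambda>x. if x \<in> \<Omega> then u x else 0) \<in> borel_measurable lebesgue"
    using assms by (subst borel_measurable_if) (auto simp: lborelD)
  then obtain g where g: "g \<in> borel_measurable borel"
    "AE x in lborel. (if x \<in> \<Omega> then u x else 0) = g x"
    using completion_ex_borel_measurable_real[of _ lborel] by auto
  note [measurable] = g(1)
  show thesis
  proof (rule that[of "\<lambda>x. indicator \<Omega> x * g x"])
    show "AE x in lborel. x \<in> \<Omega> \<longrightarrow> u x = indicator \<Omega> x * g x"
      using g(2) by eventually_elim auto
  qed auto
qed

lemma AE_lebesgue_on_iff:
  fixes \<Omega> :: "'a::euclidean_space set"
  assumes "\<Omega> \<in> sets lebesgue"
  shows "(AE x in lebesgue_on \<Omega>. P x) \<longleftrightarrow> (AE x in lborel. x \<in> \<Omega> \<longrightarrow> P x)"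
  using assms by (subst AE_restrict_space_iff) (auto simp: AE_completion_iff)

lemma integral_lebesgue_on_eq_lborel:
  fixes f g :: "'a::euclidean_space \<Rightarrow> real"
  assumes "\<Omega> \<in> sets lebesgue" "g \<in> borel_measurable borel" "\<And>x. x \<notin> \<Omega> \<Longrightarrow> g x = 0"
    "AE x in lborel. x \<in> \<Omega> \<longrightarrow> f x = g x" "f \<in> borel_measurable (lebesgue_on \<Omega>)"
  shows "(\<integral>x. f x \<partial>lebesgue_on \<Omega>) = (\<integral>x. g x \<partial>lborel)"
proof -
  have [measurable]: "g \<in> borel_measurable (lebesgue_on \<Omega>)"
    by (intro measurable_restrict_space1 measurable_completion) (use assms(2) in simp)
  have "(\<integral>x. f x \<partial>lebesgue_on \<Omega>) = (\<integral>x. g x \<partial>lebesgue_on \<Omega>)"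
    using assms by (intro integral_cong_AE) (auto simp: AE_lebesgue_on_iff)
  also have "\<dots> = (\<integral>x. (if x \<in> \<Omega> then g x else 0) \<partial>lebesgue)"
    using Lebesgue_Measure.integral_restrict_UNIV[OF assms(1), of g] by simp
  also have "(\<lambda>x. if x \<in> \<Omega> then g x else 0) = g" using assms(3) by auto
  also have "(\<integral>x. g x \<partial>lebesgue) = (\<integral>x. g x \<partial>lborel)"
    using assms(2) by (intro integral_completion) simp
  finally show ?thesis .
qed

lemma borel_lebesgue_on [measurable (raw)]:
  "f \<in> borel_measurable borel \<Longrightarrow> f \<in> borel_measurable (lebesgue_on \<Omega>)"
  by (intro measurable_restrict_space1 measurable_completion) simp

lemma set_integrable_lborel_representative:
  fixes u u' :: "'a::euclidean_space \<Rightarrow> real"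
  assumes "set_integrable lebesgue K u" "K \<subseteq> \<Omega>" "compact K" "u' \<in> borel_measurable borel"
    "AE x in lborel. x \<in> \<Omega> \<longrightarrow> u x = u' x"
  shows "set_integrable lborel K u'"
proof -
  have K: "K \<in> sets borel" using assms(3) by (simp add: borel_compact)
  have m: "(\<lambda>x. indicator K x *\<^sub>R u' x) \<in> borel_measurable borel"
    using assms(4) K by measurable
  have "integrable lebesgue (\<lambda>x. indicator K x *\<^sub>R u' x)"
  proof (rule integrable_cong_AE_imp[OF assms(1)[unfolded set_integrable_def]])
    show "(\<lambda>x. indicator K x *\<^sub>R u' x) \<in> borel_measurable lebesgue"
      using m by (intro measurable_completion) simp
    show "AE x in lebesgue. indicator K x *\<^sub>R u x = indicator K x *\<^sub>R u' x"
      unfolding AE_completion_iff using assms(5)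
      by eventually_elim (use assms(2) in \<open>auto simp: indicator_def\<close>)
  qed
  then show ?thesis unfolding set_integrable_def
    using m by (subst integrable_completion[symmetric]) auto
qed

text \<open>The constant \<open>weak_derivative\<close> is an arbitrary choice among all weak derivatives, so norms of the
  gradient of an explicit function can only be computed through uniqueness.\<close>
lemma weak_derivative_unique:
  fixes u :: "real^'n \<Rightarrow> real"
  assumes "open \<Omega>" "has_weak_derivative \<Omega> is u v" "has_weak_derivative \<Omega> is u w"
  shows "AE x in lebesgue_on \<Omega>. v x = w x"
proof -
  have \<Omega>: "\<Omega> \<in> sets lebesgue" using assms(1) by (simp add: lborelD)
  have meas: "v \<in> borel_measurable (lebesgue_on \<Omega>)" "w \<in> borel_measurable (lebesgue_on \<Omega>)"
    using assms(2,3) by (auto simp: has_weak_derivative_def locally_integrable_def)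
  obtain v' where v': "v' \<in> borel_measurable borel" "\<And>x. x \<notin> \<Omega> \<Longrightarrow> v' x = 0"
    "AE x in lborel. x \<in> \<Omega> \<longrightarrow> v x = v' x"
    using lebesgue_on_borel_representative[OF assms(1) meas(1)] by metis
  obtain w' where w': "w' \<in> borel_measurable borel" "\<And>x. x \<notin> \<Omega> \<Longrightarrow> w' x = 0"
    "AE x in lborel. x \<in> \<Omega> \<longrightarrow> w x = w' x"
    using lebesgue_on_borel_representative[OF assms(1) meas(2)] by metis
  have loc: "set_integrable lborel K v'" "set_integrable lborel K w'" if "compact K" "K \<subseteq> \<Omega>" for K
    using assms(2,3) that v'(1,3) w'(1,3)
    by (auto simp: has_weak_derivative_def locally_integrable_def
        intro!: set_integrable_lborel_representative[of K v \<Omega> v'] set_integrable_lborel_representative[of K w \<Omega> w'])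
  have "AE x in lborel. x \<in> \<Omega> \<longrightarrow> v' x - w' x = 0"
  proof (rule AE_zero_if_test_integrals_zero)
    show "(\<lambda>x. v' x - w' x) \<in> borel_measurable borel" using v' w' by measurable
    show "open \<Omega>" by fact
    show "set_integrable lborel (cbox a b) (\<lambda>x. v' x - w' x)" if "cbox a b \<subseteq> \<Omega>" for a b
      using loc[of "cbox a b"] that by (intro set_integral_diff) auto
    fix \<phi> assume \<phi>: "\<phi> \<in> test_functions \<Omega>"
    let ?K = "closure {x. \<phi> x \<noteq> 0}"
    note [measurable] = test_functions_borel[OF \<phi>] v'(1) w'(1)
    have eq: "(\<integral>x. f x * \<phi> x \<partial>lebesgue_on \<Omega>) = (\<integral>x. f' x * \<phi> x \<partial>lborel)"
      if "f \<in> borel_measurable (lebesgue_on \<Omega>)" "f' \<in> borel_measurable borel"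
        "\<And>x. x \<notin> \<Omega> \<Longrightarrow> f' x = 0" "AE x in lborel. x \<in> \<Omega> \<longrightarrow> f x = f' x" for f f'
      using that \<Omega> test_functions_borel[OF \<phi>] by (intro integral_lebesgue_on_eq_lborel) auto
    have int: "integrable lborel (\<lambda>x. f' x * \<phi> x)"
      if "f' \<in> borel_measurable borel" "\<And>K. compact K \<Longrightarrow> K \<subseteq> \<Omega> \<Longrightarrow> set_integrable lborel K f'" for f'
    proof -
      obtain M where M: "M > 0" "\<And>x. \<bar>\<phi> x\<bar> \<le> M" using test_functions_bounded[OF \<phi>] by metis
      have "set_integrable lborel ?K f'" using \<phi> by (intro that) (auto simp: test_functions_iff)
      then have "integrable lborel (\<lambda>x. M * (indicator ?K x *\<^sub>R f' x))"
        by (simp add: set_integrable_def)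
      then show ?thesis
      proof (rule Bochner_Integration.integrable_bound)
        show "(\<lambda>x. f' x * \<phi> x) \<in> borel_measurable lborel"
          using that(1) test_functions_borel[OF \<phi>] by measurable
        show "AE x in lborel. norm (f' x * \<phi> x) \<le> norm (M * (indicator ?K x *\<^sub>R f' x))"
        proof (rule AE_I2)
          fix x
          show "norm (f' x * \<phi> x) \<le> norm (M * (indicator ?K x *\<^sub>R f' x))"
          proof (cases "\<phi> x = 0")
            case False
            then have "x \<in> ?K" using closure_subset[of "{x. \<phi> x \<noteq> 0}"] by auto
            then show ?thesis using M(1) mult_right_mono[OF M(2)[of x], of "\<bar>f' x\<bar>"]
              by (simp add: abs_mult mult.commute)
          qed simp
        qed
      qed
    qed
    have "(\<integral>x. v x * \<phi> x \<partial>lebesgue_on \<Omega>) = (\<integral>x. w x * \<phi> x \<partial>lebesgue_on \<Omega>)"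
      using assms(2,3) \<phi> unfolding has_weak_derivative_def by simp
    then have "(\<integral>x. v' x * \<phi> x \<partial>lborel) = (\<integral>x. w' x * \<phi> x \<partial>lborel)"
      using eq[OF meas(1) v'] eq[OF meas(2) w'] by simp
    then show "(\<integral>x. (v' x - w' x) * \<phi> x \<partial>lborel) = 0"
      using int[OF v'(1)] int[OF w'(1)] loc by (simp add: left_diff_distrib)
  qed
  then have "AE x in lborel. x \<in> \<Omega> \<longrightarrow> v x = w x"
    using v'(3) w'(3) by eventually_elim auto
  then show ?thesis using \<Omega> by (simp add: AE_lebesgue_on_iff)
qed

lemma test_functions_locally_integrable:
  assumes "\<phi> \<in> test_functions \<Omega>"
  shows "locally_integrable \<Omega> \<phi>"
  unfolding locally_integrable_def
proof (intro conjI allI impI)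
  show "\<phi> \<in> borel_measurable (lebesgue_on \<Omega>)" using test_functions_borel[OF assms] by measurable
  fix K assume "compact K \<and> K \<subseteq> \<Omega>"
  then have "set_integrable lborel K \<phi>"
    unfolding set_integrable_def
    using test_functions_integrable[OF assms] by (intro integrable_mult_indicator) (auto simp: borel_compact)
  then show "set_integrable lebesgue K \<phi>"
    unfolding set_integrable_def by (subst integrable_completion) (auto dest: borel_measurable_integrable)
qed

lemma test_functions_has_weak_derivative:
  assumes "open \<Omega>" "u \<in> test_functions \<Omega>"
  shows "has_weak_derivative \<Omega> is u (iterated_partial (rev is) u)"
  unfolding has_weak_derivative_def
proof (intro conjI ballI)
  show "locally_integrable \<Omega> u" "locally_integrable \<Omega> (iterated_partial (rev is) u)"
    using assms(2) test_functions_iterated_partial by (blast intro: test_functions_locally_integrable)+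
  fix \<phi> assume \<phi>: "\<phi> \<in> test_functions \<Omega>"
  have \<Omega>: "\<Omega> \<in> sets lebesgue" using assms(1) by (simp add: lborelD)
  have "(\<integral>x. f x * g x \<partial>lebesgue_on \<Omega>) = (\<integral>x. f x * g x \<partial>lborel)"
    if "f \<in> test_functions \<Omega>" "g \<in> test_functions \<Omega>" for f g
    using test_functions_borel[OF that(1)] test_functions_borel[OF that(2)] \<Omega>
      test_functions_zero_outside[OF that(1)]
    by (intro integral_lebesgue_on_eq_lborel) auto
  then show "(\<integral>x. u x * iterated_partial is \<phi> x \<partial>lebesgue_on \<Omega>) =
        (-1) ^ length is * (\<integral>x. iterated_partial (rev is) u x * \<phi> x \<partial>lebesgue_on \<Omega>)"
    using integration_by_parts_test_iterated[OF assms(2) \<phi>, of "is"] assms(2) \<phi>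
    by (simp add: test_functions_iterated_partial)
qed

section \<open>Weakly differentiable functions along segments\<close>

lemma test_functions_translate:
  assumes "\<phi> \<in> test_functions V" "\<And>x. x \<in> V \<Longrightarrow> x + c \<in> \<Omega>"
  shows "(\<lambda>x. \<phi> (x - c)) \<in> test_functions \<Omega>"
proof -
  have eq: "{x. \<phi> (x - c) \<noteq> 0} = (\<lambda>x. c + x) ` {x. \<phi> x \<noteq> 0}"
    by (auto simp: image_iff) (metis add.commute diff_add_cancel)
  have "closure {x. \<phi> (x - c) \<noteq> 0} = (\<lambda>x. c + x) ` closure {x. \<phi> x \<noteq> 0}"
    unfolding eq by (rule closure_translation)
  moreover have "compact ((\<lambda>x. c + x) ` closure {x. \<phi> x \<noteq> 0})"
    using assms(1) by (intro compact_translation) (auto simp: test_functions_iff)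
  moreover have "smooth (\<lambda>x. \<phi> (x - c))"
    using smooth_affine[of \<phi> 1 "- c"] assms(1) by (simp add: test_functions_iff)
  ultimately show ?thesis
    using assms by (auto simp: test_functions_iff add.commute)
qed

lemma partial_derivative_translate:
  assumes "\<phi> \<in> test_functions V"
  shows "partial_derivative i (\<lambda>x. \<phi> (x - c)) = (\<lambda>x. partial_derivative i \<phi> (x - c))"
  using partial_derivative_affine[of \<phi> i 1 1 "- c"] assms
  by (simp add: test_functions_iff smooth_differentiable)

lemma test_function_segment:
  fixes \<phi> :: "real^'n \<Rightarrow> real"
  assumes "\<phi> \<in> test_functions V"
  shows "(\<integral>s. indicator {0..1} s * (\<Sum>i\<in>UNIV. w $ i * partial_derivative i \<phi> (x - s *\<^sub>R w)) \<partial>lborel)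
       = \<phi> x - \<phi> (x - w)"
proof -
  have diff: "\<phi> differentiable_on UNIV" using assms by (auto simp: test_functions_iff smooth_differentiable)
  let ?f = "\<lambda>s. (\<Sum>i\<in>UNIV. w $ i * partial_derivative i \<phi> (x - s *\<^sub>R w))"
  have "(\<integral>s. ?f s * indicator {0..1} s \<partial>lborel) = (- \<phi> (x - 1 *\<^sub>R w)) - (- \<phi> (x - 0 *\<^sub>R w))"
  proof (rule integral_FTC_Icc_real)
    fix s :: real
    have 1: "((\<lambda>s. x - s *\<^sub>R w) has_derivative (\<lambda>h. - (h *\<^sub>R w))) (at s)"
      by (auto intro!: derivative_eq_intros)
    have lin: "linear (frechet_derivative \<phi> (at (x - s *\<^sub>R w)))"
      using has_derivative_frechet[OF diff] has_derivative_linear by blast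
    have "((\<lambda>s. - \<phi> (x - s *\<^sub>R w)) has_derivative (\<lambda>h. - frechet_derivative \<phi> (at (x - s *\<^sub>R w)) (- (h *\<^sub>R w)))) (at s)"
      by (rule has_derivative_minus[OF has_derivative_compose[OF 1 has_derivative_frechet[OF diff]]])
    moreover have "(\<lambda>h. - frechet_derivative \<phi> (at (x - s *\<^sub>R w)) (- (h *\<^sub>R w)))
        = (*) (frechet_derivative \<phi> (at (x - s *\<^sub>R w)) w)"
      by (auto simp: linear_neg[OF lin] linear_cmul[OF lin] mult.commute)
    ultimately show "DERIV (\<lambda>s. - \<phi> (x - s *\<^sub>R w)) s :> ?f s"
      unfolding has_field_derivative_def frechet_derivative_eq_sum_partial[OF diff, symmetric] by simp
    have c: "continuous_on UNIV (partial_derivative i \<phi>)" for i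
      using test_functions_partial_derivative[OF assms] by (auto simp: test_functions_iff smooth_continuous)
    have "continuous_on UNIV ?f"
      by (intro continuous_intros continuous_on_compose2[OF c]) auto
    then show "isCont ?f s" by (simp add: continuous_on_eq_continuous_at)
  qed simp
  then show ?thesis by (simp add: mult.commute)
qed

text \<open>The integrability that Fubini's theorem asks for when an integrable function is integrated along
  all segments of direction \<open>w\<close>.\<close>
lemma integrable_translate_product:
  fixes g \<phi> :: "real^'n \<Rightarrow> real"
  assumes "integrable lborel g" "g \<in> borel_measurable borel" "\<phi> \<in> borel_measurable borel" "\<And>x. \<bar>\<phi> x\<bar> \<le> M"
  shows "integrable (lborel \<Otimes>\<^sub>M lborel) (\<lambda>(x, s). indicator {0..1} s * (g (x + s *\<^sub>R w) * \<phi> x))"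
proof (rule integrableI_bounded)
  note [measurable] = assms(2,3)
  show m: "(\<lambda>(x, s). indicator {0..1} s * (g (x + s *\<^sub>R w) * \<phi> x)) \<in> borel_measurable (lborel \<Otimes>\<^sub>M lborel)"
    by measurable
  have "M \<ge> 0" using assms(4)[of 0] by linarith
  have "(\<integral>\<^sup>+ z. ennreal (norm (case z of (x, s) \<Rightarrow> indicator {0..1} s * (g (x + s *\<^sub>R w) * \<phi> x))) \<partial>(lborel \<Otimes>\<^sub>M lborel))
     = (\<integral>\<^sup>+ s. \<integral>\<^sup>+ x. ennreal (norm (indicator {0..1} s * (g (x + s *\<^sub>R w) * \<phi> x))) \<partial>lborel \<partial>lborel)"
    using m by (subst lborel_pair.nn_integral_snd[symmetric]) auto
  also have "\<dots> \<le> (\<integral>\<^sup>+ s. \<integral>\<^sup>+ x. ennreal M * indicator {0..1::real} s * ennreal \<bar>g (x + s *\<^sub>R w)\<bar> \<partial>lborel \<partial>lborel)"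
  proof (intro nn_integral_mono)
    fix s :: real and x
    have "\<bar>g (x + s *\<^sub>R w) * \<phi> x\<bar> \<le> M * \<bar>g (x + s *\<^sub>R w)\<bar>"
      using mult_left_mono[OF assms(4)[of x], of "\<bar>g (x + s *\<^sub>R w)\<bar>"] by (simp add: abs_mult mult.commute)
    then show "ennreal (norm (indicator {0..1} s * (g (x + s *\<^sub>R w) * \<phi> x)))
        \<le> ennreal M * indicator {0..1::real} s * ennreal \<bar>g (x + s *\<^sub>R w)\<bar>"
      using \<open>M \<ge> 0\<close> by (auto simp: indicator_def ennreal_mult[symmetric] intro!: ennreal_leI)
  qed
  also have "\<dots> = (\<integral>\<^sup>+ s. ennreal M * indicator {0..1::real} s * (\<integral>\<^sup>+ x. ennreal \<bar>g x\<bar> \<partial>lborel) \<partial>lborel)"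
    by (intro nn_integral_cong) (simp add: nn_integral_cmult lborel_nn_integral_translate[of "\<lambda>x. ennreal \<bar>g x\<bar>"])
  also have "\<dots> = ennreal M * (\<integral>\<^sup>+ x. ennreal \<bar>g x\<bar> \<partial>lborel)"
    by (simp add: nn_integral_multc nn_integral_cmult)
  also have "\<dots> < \<infinity>"
    using assms(1) by (auto simp: integrable_iff_bounded ennreal_mult_less_top)
  finally show "(\<integral>\<^sup>+ z. ennreal (norm (case z of (x, s) \<Rightarrow> indicator {0..1} s * (g (x + s *\<^sub>R w) * \<phi> x))) \<partial>(lborel \<Otimes>\<^sub>M lborel)) < \<infinity>" .
qed

text \<open>Tested against \<open>\<phi>\<close>, the difference \<open>u (x + w) - u x\<close> becomes \<open>u\<close> tested against
  \<open>\<phi> (y - w) - \<phi> y\<close>.  This is an integral over \<open>s\<close> of derivatives of the translates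
  \<open>\<phi> (y - s w)\<close>, which are test functions on \<open>\<Omega>\<close> because the segments stay in \<open>\<Omega>\<close>.  Moving the
  derivative onto \<open>u\<close> and translating back yields the right-hand side, and the fundamental lemma
  removes \<open>\<phi>\<close>.\<close>
lemma weak_gradient_along_segment:
  fixes u :: "real^'n \<Rightarrow> real" and v :: "'n \<Rightarrow> real^'n \<Rightarrow> real"
  assumes u: "integrable lborel u" "u \<in> borel_measurable borel"
    and v: "\<And>i. integrable lborel (v i)" "\<And>i. v i \<in> borel_measurable borel"
    and weak: "\<And>i \<phi>. \<phi> \<in> test_functions \<Omega> \<Longrightarrow>
      (\<integral>x. u x * partial_derivative i \<phi> x \<partial>lborel) = - (\<integral>x. v i x * \<phi> x \<partial>lborel)"
    and V: "open V" "\<And>x s. x \<in> V \<Longrightarrow> s \<in> {0..1} \<Longrightarrow> x + s *\<^sub>R w \<in> \<Omega>"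
  shows "AE x in lborel. x \<in> V \<longrightarrow>
    u (x + w) - u x = (\<integral>s. indicator {0..1} s * (\<Sum>i\<in>UNIV. w $ i * v i (x + s *\<^sub>R w)) \<partial>lborel)"
proof -
  define G where "G x = (\<integral>s. indicator {0..1} s * (\<Sum>i\<in>UNIV. w $ i * v i (x + s *\<^sub>R w)) \<partial>lborel)" for x
  note [measurable] = u(2) v(2)
  have int2: "integrable (lborel \<Otimes>\<^sub>M lborel) (\<lambda>(x, s). indicator {0..1} s * ((\<Sum>i\<in>UNIV. w $ i * v i (x + s *\<^sub>R w)) * \<phi> x))"
    if \<phi>: "\<phi> \<in> borel_measurable borel" "\<And>x. \<bar>\<phi> x\<bar> \<le> M" for \<phi> M
  proof -
    have "integrable (lborel \<Otimes>\<^sub>M lborel) (\<lambda>z. \<Sum>i\<in>UNIV. w $ i * (case z of (x, s) \<Rightarrow> indicator {0..1} s * (v i (x + s *\<^sub>R w) * \<phi> x)))"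
      by (intro Bochner_Integration.integrable_sum integrable_mult_right integrable_translate_product[OF v \<phi>])
    then show ?thesis
      by (simp add: case_prod_beta' sum_distrib_left sum_distrib_right mult_ac)
  qed
  have Gint: "integrable lborel G"
    using lborel_pair.integrable_fst'[OF int2[of "\<lambda>x. 1" 1]] by (simp add: G_def[abs_def])
  have [measurable]: "G \<in> borel_measurable borel"
    using borel_measurable_integrable[OF Gint] by simp
  have "AE x in lborel. x \<in> V \<longrightarrow> u (x + w) - u x - G x = 0"
  proof (rule AE_zero_if_test_integrals_zero)
    show "(\<lambda>x. u (x + w) - u x - G x) \<in> borel_measurable borel" by measurable
    show "open V" by fact
    have Fint: "integrable lborel (\<lambda>x. u (x + w) - u x - G x)"
      by (intro Bochner_Integration.integrable_diff lborel_integrable_translate u Gint)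
    then show "set_integrable lborel (cbox a b) (\<lambda>x. u (x + w) - u x - G x)" for a b
      unfolding set_integrable_def by (intro integrable_mult_indicator) auto
    fix \<phi> assume \<phi>: "\<phi> \<in> test_functions V"
    note [measurable] = test_functions_borel[OF \<phi>] test_functions_borel[OF test_functions_partial_derivative[OF \<phi>]]
    obtain M where M: "M > 0" "\<And>x. \<bar>\<phi> x\<bar> \<le> M" using test_functions_bounded[OF \<phi>] by metis
    have intm: "integrable lborel (\<lambda>x. f x * \<psi> x)"
      if f: "integrable lborel f" and \<psi>: "\<psi> \<in> test_functions S" for f :: "real^'n \<Rightarrow> real" and \<psi> S
    proof -
      obtain M where M: "M > 0" "\<And>x. \<bar>\<psi> x\<bar> \<le> M" using test_functions_bounded[OF \<psi>] by metis
      show ?thesis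
      proof (rule Bochner_Integration.integrable_bound[where f = "\<lambda>x. M * f x"])
        show "integrable lborel (\<lambda>x. M * f x)" using f by simp
        show "(\<lambda>x. f x * \<psi> x) \<in> borel_measurable lborel"
          using borel_measurable_integrable[OF f] test_functions_borel[OF \<psi>] by measurable
        show "AE x in lborel. norm (f x * \<psi> x) \<le> norm (M * f x)"
          using M by (auto simp: abs_mult mult.commute intro!: AE_I2 mult_right_mono)
      qed
    qed
    have slice: "(\<integral>x. (\<Sum>i\<in>UNIV. w $ i * v i (x + s *\<^sub>R w)) * \<phi> x \<partial>lborel)
        = - (\<Sum>i\<in>UNIV. w $ i * (\<integral>x. u x * partial_derivative i \<phi> (x - s *\<^sub>R w) \<partial>lborel))"
      if s: "s \<in> {0..1}" for s
    proof -
      have t: "(\<lambda>x. \<phi> (x - s *\<^sub>R w)) \<in> test_functions \<Omega>"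
        using test_functions_translate[OF \<phi>] V(2) s by blast
      have i: "integrable lborel (\<lambda>x. v i x * \<phi> (x - s *\<^sub>R w))" for i
        by (rule intm[OF v(1) t])
      have i': "integrable lborel (\<lambda>x. v i (x + s *\<^sub>R w) * \<phi> x)" for i
        using lborel_integrable_translate[OF i, of i "s *\<^sub>R w"] by simp
      have "(\<integral>x. (\<Sum>i\<in>UNIV. w $ i * v i (x + s *\<^sub>R w)) * \<phi> x \<partial>lborel)
        = (\<integral>x. (\<Sum>i\<in>UNIV. w $ i * (v i (x + s *\<^sub>R w) * \<phi> x)) \<partial>lborel)"
        by (simp add: sum_distrib_right mult.assoc)
      also have "\<dots> = (\<Sum>i\<in>UNIV. w $ i * (\<integral>x. v i (x + s *\<^sub>R w) * \<phi> x \<partial>lborel))"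
        using i' by (subst Bochner_Integration.integral_sum) auto
      also have "\<dots> = (\<Sum>i\<in>UNIV. w $ i * (\<integral>x. v i x * \<phi> (x - s *\<^sub>R w) \<partial>lborel))"
        using lborel_integral_translate[of "\<lambda>x. v _ x * \<phi> (x - s *\<^sub>R w)" "s *\<^sub>R w"] by simp
      also have "\<dots> = (\<Sum>i\<in>UNIV. w $ i * (- (\<integral>x. u x * partial_derivative i \<phi> (x - s *\<^sub>R w) \<partial>lborel)))"
        using weak[OF t] partial_derivative_translate[OF \<phi>] by simp
      finally show ?thesis by (simp add: sum_negf)
    qed
    have intu: "integrable (lborel \<Otimes>\<^sub>M lborel) (\<lambda>(x, s). indicator {0..1} s * (u x * (\<Sum>i\<in>UNIV. w $ i * partial_derivative i \<phi> (x - s *\<^sub>R w))))"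
    proof -
      define \<psi> where "\<psi> x = (\<Sum>i\<in>UNIV. w $ i * partial_derivative i \<phi> x)" for x
      have "\<forall>i. \<exists>N. \<forall>x. \<bar>partial_derivative i \<phi> x\<bar> \<le> N"
        using test_functions_bounded[OF test_functions_partial_derivative[OF \<phi>]] by metis
      then obtain N where N: "\<And>i x. \<bar>partial_derivative i \<phi> x\<bar> \<le> N i" by metis
      have \<psi>: "\<bar>\<psi> x\<bar> \<le> (\<Sum>i\<in>UNIV. \<bar>w $ i\<bar> * N i)" for x
        unfolding \<psi>_def
        by (rule order_trans[OF sum_abs]) (auto simp: abs_mult intro!: sum_mono mult_left_mono N)
      have [measurable]: "\<psi> \<in> borel_measurable borel" unfolding \<psi>_def[abs_def] by measurable
      have "integrable (lborel \<Otimes>\<^sub>M lborel) (\<lambda>(x, s). indicator {0..1} s * (u (x + s *\<^sub>R 0) * 1))"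
        by (rule integrable_translate_product[OF u, of _ 1]) auto
      then have "integrable (lborel \<Otimes>\<^sub>M lborel) (\<lambda>z. (\<Sum>i\<in>UNIV. \<bar>w $ i\<bar> * N i) * (case z of (x, s) \<Rightarrow> indicator {0..1::real} s * u x))"
        by (intro integrable_mult_right) simp
      then have "integrable (lborel \<Otimes>\<^sub>M lborel) (\<lambda>z. case z of (x, s) \<Rightarrow> indicator {0..1} s * (u x * \<psi> (x - s *\<^sub>R w)))"
      proof (rule Bochner_Integration.integrable_bound)
        show "(\<lambda>z. case z of (x, s) \<Rightarrow> indicator {0..1} s * (u x * \<psi> (x - s *\<^sub>R w))) \<in> borel_measurable (lborel \<Otimes>\<^sub>M lborel)"
          by measurable
        show "AE z in lborel \<Otimes>\<^sub>M lborel. norm (case z of (x, s) \<Rightarrow> indicator {0..1} s * (u x * \<psi> (x - s *\<^sub>R w)))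
            \<le> norm ((\<Sum>i\<in>UNIV. \<bar>w $ i\<bar> * N i) * (case z of (x, s) \<Rightarrow> indicator {0..1::real} s * u x))"
        proof (rule AE_I2)
          fix z :: "(real^'n) \<times> real"
          obtain x s where z: "z = (x, s)" by fastforce
          have "\<bar>u x * \<psi> (x - s *\<^sub>R w)\<bar> \<le> \<bar>(\<Sum>i\<in>UNIV. \<bar>w $ i\<bar> * N i) * u x\<bar>"
            using mult_left_mono[OF order_trans[OF \<psi>[of "x - s *\<^sub>R w"] abs_ge_self], of "\<bar>u x\<bar>"]
            by (simp add: abs_mult mult.commute)
          then show "norm (case z of (x, s) \<Rightarrow> indicator {0..1} s * (u x * \<psi> (x - s *\<^sub>R w)))
            \<le> norm ((\<Sum>i\<in>UNIV. \<bar>w $ i\<bar> * N i) * (case z of (x, s) \<Rightarrow> indicator {0..1::real} s * u x))"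
            by (auto simp: z indicator_def)
        qed
      qed
      then show ?thesis by (simp add: \<psi>_def)
    qed
    have "(\<integral>x. G x * \<phi> x \<partial>lborel) = (\<integral>x. (\<integral>s. indicator {0..1} s * ((\<Sum>i\<in>UNIV. w $ i * v i (x + s *\<^sub>R w)) * \<phi> x) \<partial>lborel) \<partial>lborel)"
      unfolding G_def by (intro Bochner_Integration.integral_cong refl)
         (simp add: integral_mult_left_zero[symmetric] mult.assoc)
    also have "\<dots> = (\<integral>s. (\<integral>x. indicator {0..1} s * ((\<Sum>i\<in>UNIV. w $ i * v i (x + s *\<^sub>R w)) * \<phi> x) \<partial>lborel) \<partial>lborel)"
      using lborel_pair.Fubini_integral[OF int2[OF _ M(2)]] by simp
    also have "\<dots> = (\<integral>s. (\<integral>x. - (indicator {0..1} s * (u x * (\<Sum>i\<in>UNIV. w $ i * partial_derivative i \<phi> (x - s *\<^sub>R w)))) \<partial>lborel) \<partial>lborel)"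
    proof (rule Bochner_Integration.integral_cong[OF refl])
      fix s :: real
      show "(\<integral>x. indicator {0..1} s * ((\<Sum>i\<in>UNIV. w $ i * v i (x + s *\<^sub>R w)) * \<phi> x) \<partial>lborel)
        = (\<integral>x. - (indicator {0..1} s * (u x * (\<Sum>i\<in>UNIV. w $ i * partial_derivative i \<phi> (x - s *\<^sub>R w)))) \<partial>lborel)"
      proof (cases "s \<in> {0..1}")
        case True
        have t: "(\<lambda>x. partial_derivative i \<phi> (x - s *\<^sub>R w)) \<in> test_functions \<Omega>" for i
          using test_functions_translate[OF test_functions_partial_derivative[OF \<phi>]] V(2) True by blast
        have i: "integrable lborel (\<lambda>x. u x * partial_derivative i \<phi> (x - s *\<^sub>R w))" for i
          by (rule intm[OF u(1) t])
        have "(\<integral>x. u x * (\<Sum>i\<in>UNIV. w $ i * partial_derivative i \<phi> (x - s *\<^sub>R w)) \<partial>lborel)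
          = (\<integral>x. (\<Sum>i\<in>UNIV. w $ i * (u x * partial_derivative i \<phi> (x - s *\<^sub>R w))) \<partial>lborel)"
          by (simp add: sum_distrib_left mult_ac)
        also have "\<dots> = (\<Sum>i\<in>UNIV. w $ i * (\<integral>x. u x * partial_derivative i \<phi> (x - s *\<^sub>R w) \<partial>lborel))"
          using i by (subst Bochner_Integration.integral_sum) auto
        finally show ?thesis using slice[OF True] True by simp
      qed simp
    qed
    also have "\<dots> = - (\<integral>s. (\<integral>x. (indicator {0..1} s * (u x * (\<Sum>i\<in>UNIV. w $ i * partial_derivative i \<phi> (x - s *\<^sub>R w)))) \<partial>lborel) \<partial>lborel)"
      by simp
    also have "\<dots> = - (\<integral>x. (\<integral>s. (indicator {0..1} s * (u x * (\<Sum>i\<in>UNIV. w $ i * partial_derivative i \<phi> (x - s *\<^sub>R w)))) \<partial>lborel) \<partial>lborel)"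
      using lborel_pair.Fubini_integral[OF intu] by simp
    also have "\<dots> = - (\<integral>x. u x * (\<phi> x - \<phi> (x - w)) \<partial>lborel)"
      using test_function_segment[OF \<phi>, of w]
      by (simp add: mult.left_commute[of "indicator _ _" "u _"])
    also have "\<dots> = (\<integral>x. u x * \<phi> (x - w) \<partial>lborel) - (\<integral>x. u x * \<phi> x \<partial>lborel)"
      using intm[OF u(1) \<phi>] intm[OF u(1) test_functions_translate[OF \<phi>, of w UNIV]]
      by (simp add: right_diff_distrib)
    also have "(\<integral>x. u x * \<phi> (x - w) \<partial>lborel) = (\<integral>x. u (x + w) * \<phi> x \<partial>lborel)"
      using lborel_integral_translate[of "\<lambda>x. u x * \<phi> (x - w)" w] by simp
    finally show "(\<integral>x. (u (x + w) - u x - G x) * \<phi> x \<partial>lborel) = 0"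
      using intm[OF u(1) \<phi>] intm[OF lborel_integrable_translate[OF u(1)] \<phi>, of w] intm[OF Gint \<phi>]
      by (simp add: left_diff_distrib)
  qed
  then show ?thesis by eventually_elim (auto simp: G_def)
qed

section \<open>Segments inside a Lipschitz domain\<close>

text \<open>Near the boundary \<open>\<Omega>\<close> lies above a Lipschitz graph.  A direction \<open>w\<close> close to a multiple of the
  vertical \<open>v\<close> rises faster than the graph can, so moving along \<open>w\<close> never leaves the region above
  it.\<close>
lemma lipschitz_domain_local_directions:
  fixes \<Omega> :: "(real^'n) set"
  assumes "bounded_lipschitz_domain \<Omega>" "p \<in> closure \<Omega>"
  obtains U a r where "open U" "p \<in> U" "r > 0"
    "\<And>x w s. x \<in> U \<inter> \<Omega> \<Longrightarrow> w \<in> ball a r \<Longrightarrow> s \<in> {0..1} \<Longrightarrow> x + s *\<^sub>R w \<in> \<Omega>"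
proof -
  have "open \<Omega>" and lip: "lipschitz_boundary \<Omega>"
    using assms(1) by (auto simp: bounded_lipschitz_domain_def)
  show thesis
  proof (cases "p \<in> \<Omega>")
    case True
    then obtain r where r: "r > 0" "ball p r \<subseteq> \<Omega>"
      using \<open>open \<Omega>\<close> open_contains_ball by blast
    show thesis
    proof (rule that[of "ball p (r / 2)" "r / 2" 0])
      fix x w :: "real^'n" and s :: real
      assume *: "x \<in> ball p (r / 2) \<inter> \<Omega>" "w \<in> ball 0 (r / 2)" "s \<in> {0..1}"
      have "norm (s *\<^sub>R w) \<le> 1 * norm w"
        using * unfolding norm_scaleR by (intro mult_right_mono) auto
      moreover have "norm (p - (x + s *\<^sub>R w)) \<le> norm (p - x) + norm (s *\<^sub>R w)"
        using norm_triangle_ineq4[of "p - x" "s *\<^sub>R w"] by (simp add: algebra_simps)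
      ultimately have "x + s *\<^sub>R w \<in> ball p r"
        using * by (auto simp: dist_norm)
      then show "x + s *\<^sub>R w \<in> \<Omega>" using r by blast
    qed (use r in auto)
  next
    case False
    then have "p \<in> frontier \<Omega>"
      using assms(2) \<open>open \<Omega>\<close> by (simp add: frontier_def interior_open)
    then obtain r v \<gamma> L where r: "r > 0" and v: "norm v = 1"
      and L: "L-lipschitz_on {y. y \<bullet> v = 0} \<gamma>"
      and \<Omega>: "\<Omega> \<inter> ball p r = {x \<in> ball p r. x \<bullet> v > \<gamma> (x - (x \<bullet> v) *\<^sub>R v)}"
      using lip unfolding lipschitz_boundary_def by blast
    have L0: "L \<ge> 0" using L by (rule lipschitz_on_nonneg)
    \<comment> \<open>A vertical step of length c with an error below \<open>\<eta>\<close>: it rises by at least \<open>c - \<eta> = L \<eta>\<close>, whereas its horizontal part, shorter than \<open>\<eta>\<close>, lets the graph rise by at most \<open>L \<eta>\<close>.\<close>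
    define c where "c = r / 4"
    define \<eta> where "\<eta> = c / (1 + L)"
    have c: "c > 0" using r by (simp add: c_def)
    have \<eta>1: "\<eta> * (1 + L) = c" using L0 by (simp add: \<eta>_def)
    have \<eta>: "\<eta> > 0" "c = \<eta> + L * \<eta>"
    proof -
      show "\<eta> > 0" using c L0 by (simp add: \<eta>_def)
      show "c = \<eta> + L * \<eta>" using \<eta>1 by (simp add: algebra_simps)
    qed
    moreover have "L * \<eta> \<ge> 0" using L0 \<eta>(1) by simp
    ultimately have \<eta>c: "\<eta> \<le> c" by linarith
    have vv: "v \<bullet> v = 1" using v by (simp add: norm_eq_1)
    show thesis
    proof (rule that[of "ball p (r / 2)" \<eta> "c *\<^sub>R v"])
      fix x w :: "real^'n" and s :: real
      assume *: "x \<in> ball p (r / 2) \<inter> \<Omega>" "w \<in> ball (c *\<^sub>R v) \<eta>" "s \<in> {0..1}"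
      define e where "e = w - c *\<^sub>R v"
      have w: "w = c *\<^sub>R v + e" and e: "norm e < \<eta>"
        using * by (auto simp: e_def dist_norm norm_minus_commute)
      have "norm w < 2 * c"
        using norm_triangle_ineq[of "c *\<^sub>R v" e] e \<eta>c c v by (simp add: w)
      moreover have "norm (s *\<^sub>R w) \<le> 1 * norm w"
        using * unfolding norm_scaleR by (intro mult_right_mono) auto
      moreover have "norm (p - (x + s *\<^sub>R w)) \<le> norm (p - x) + norm (s *\<^sub>R w)"
        using norm_triangle_ineq4[of "p - x" "s *\<^sub>R w"] by (simp add: algebra_simps)
      ultimately have inball: "x + s *\<^sub>R w \<in> ball p r"
        using * by (auto simp: dist_norm c_def)
      have "x \<in> \<Omega> \<inter> ball p r" using * r by auto
      then have xv: "x \<bullet> v > \<gamma> (x - (x \<bullet> v) *\<^sub>R v)" unfolding \<Omega> by simp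
      define P where "P z = z - (z \<bullet> v) *\<^sub>R v" for z
      have Pv: "P z \<bullet> v = 0" for z by (simp add: P_def inner_diff_left vv)
      have "P (x + s *\<^sub>R w) - P x = s *\<^sub>R P e"
        by (simp add: P_def w algebra_simps inner_add_left vv)
      moreover have Pe: "norm (P e) \<le> norm e"
      proof -
        have "(norm (P e))\<^sup>2 = (norm e)\<^sup>2 - (e \<bullet> v)\<^sup>2"
          unfolding power2_norm_eq_inner
          by (simp add: P_def inner_diff_left inner_diff_right vv inner_commute power2_eq_square)
        then have "(norm (P e))\<^sup>2 \<le> (norm e)\<^sup>2" by simp
        then show ?thesis by (rule power2_le_imp_le) simp
      qed
      ultimately have "norm (P (x + s *\<^sub>R w) - P x) \<le> s * \<eta>"
        using * e by (simp add: mult_left_mono)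
      then have "dist (\<gamma> (P (x + s *\<^sub>R w))) (\<gamma> (P x)) \<le> L * (s * \<eta>)"
        using lipschitz_onD[OF L, of "P (x + s *\<^sub>R w)" "P x"] Pv L0
        by (simp add: dist_norm) (meson mult_left_mono order_trans)
      then have "\<gamma> (P (x + s *\<^sub>R w)) \<le> \<gamma> (P x) + L * (s * \<eta>)"
        by (simp add: dist_real_def)
      also have "\<dots> < x \<bullet> v + L * (s * \<eta>)" using xv by (simp add: P_def)
      also have "\<dots> \<le> (x + s *\<^sub>R w) \<bullet> v"
      proof -
        have "\<bar>e \<bullet> v\<bar> \<le> norm e * norm v" by (rule Cauchy_Schwarz_ineq2)
        then have "w \<bullet> v \<ge> L * \<eta>"
          using e \<eta> v by (simp add: w inner_add_left vv)
        then have "s * (w \<bullet> v) \<ge> s * (L * \<eta>)" using * by (intro mult_left_mono) auto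
        then show ?thesis by (simp add: inner_add_left mult.left_commute)
      qed
      finally show "x + s *\<^sub>R w \<in> \<Omega>" using inball \<Omega> unfolding P_def by blast
    qed (use r \<eta> in auto)
  qed
qed

lemma lipschitz_domain_directions:
  fixes \<Omega> :: "(real^'n) set"
  assumes "bounded_lipschitz_domain \<Omega>"
  obtains P :: "((real^'n) set \<times> (real^'n) \<times> real) set" where "finite P" "\<Omega> \<subseteq> (\<Union>(U, a, r)\<in>P. U)"
    "\<And>U a r. (U, a, r) \<in> P \<Longrightarrow> open U \<and> r > 0 \<and>
       (\<forall>x\<in>U \<inter> \<Omega>. \<forall>w\<in>ball a r. \<forall>s\<in>{0..1}. x + s *\<^sub>R w \<in> \<Omega>)"
proof -
  let ?Q = "\<lambda>p (U, a, r). open U \<and> p \<in> U \<and> r > 0 \<and>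
     (\<forall>x\<in>U \<inter> \<Omega>. \<forall>w\<in>ball a r. \<forall>s\<in>{0..1}. x + s *\<^sub>R w \<in> \<Omega>)"
  have "\<forall>p\<in>closure \<Omega>. \<exists>z. ?Q p z"
  proof
    fix p assume "p \<in> closure \<Omega>"
    from lipschitz_domain_local_directions[OF assms this] obtain U a r where
      "open U" "p \<in> U" "r > 0"
      "\<And>x w s. x \<in> U \<inter> \<Omega> \<Longrightarrow> w \<in> ball a r \<Longrightarrow> s \<in> {0..1} \<Longrightarrow> x + s *\<^sub>R w \<in> \<Omega>" by metis
    then have "?Q p (U, a, r)" by auto
    then show "\<exists>z. ?Q p z" ..
  qed
  from bchoice[OF this] obtain Z where "\<forall>p\<in>closure \<Omega>. ?Q p (Z p)" ..
  then have Z: "?Q p (Z p)" if "p \<in> closure \<Omega>" for p using that by (rule bspec)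
  have "compact (closure \<Omega>)"
    using assms by (simp add: bounded_lipschitz_domain_def compact_closure)
  then obtain C where C: "C \<subseteq> closure \<Omega>" "finite C" "closure \<Omega> \<subseteq> (\<Union>p\<in>C. fst (Z p))"
  proof (rule compactE_image)
    show "open (fst (Z p))" if "p \<in> closure \<Omega>" for p using Z[OF that] by (auto split: prod.splits)
    show "closure \<Omega> \<subseteq> (\<Union>p\<in>closure \<Omega>. fst (Z p))" using Z by (fastforce split: prod.splits)
  qed
  show thesis
  proof (rule that[of "Z ` C"])
    show "finite (Z ` C)" using C by simp
    show "\<Omega> \<subseteq> (\<Union>(U, a, r)\<in>Z ` C. U)" using C(3) closure_subset[of \<Omega>] by (force simp: split_beta)
    show "open U \<and> r > 0 \<and> (\<forall>x\<in>U \<inter> \<Omega>. \<forall>w\<in>ball a r. \<forall>s\<in>{0..1}. x + s *\<^sub>R w \<in> \<Omega>)"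
      if "(U, a, r) \<in> Z ` C" for U a r
      using that Z C(1) by fastforce
  qed
qed

section \<open>Crossing two levels along a segment\<close>

text \<open>Between the last time \<open>p\<close> at which \<open>|g|\<close> is at least \<open>\<beta>\<close> and the first time \<open>q\<close> after \<open>p\<close> at
  which it is at most \<open>\<alpha>\<close>, the value of \<open>|g|\<close> stays strictly between the levels, so the whole
  variation \<open>\<beta> - \<alpha>\<close> is paid by \<open>d\<close> inside the slice.\<close>
lemma absolutely_continuous_level_crossing:
  fixes g d :: "real \<Rightarrow> real"
  assumes d: "set_integrable lborel {0..1} d" "d \<in> borel_measurable borel" "g \<in> borel_measurable borel"
    and ae: "AE s in lborel. s \<in> {0..1} \<longrightarrow> g s = g 0 + (\<integral>r\<in>{0..s}. d r \<partial>lborel)"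
    and g1: "g 1 = g 0 + (\<integral>r\<in>{0..1}. d r \<partial>lborel)"
    and lev: "\<beta> \<le> \<bar>g 0\<bar>" "\<bar>g 1\<bar> \<le> \<alpha>" "\<alpha> < \<beta>"
  shows "ennreal (\<beta> - \<alpha>) \<le> (\<integral>\<^sup>+s\<in>{0..1}. ennreal \<bar>d s\<bar> * indicator {y. \<alpha> < \<bar>y\<bar> \<and> \<bar>y\<bar> < \<beta>} (g s) \<partial>lborel)"
proof -
  \<comment> \<open>The continuous representative of g; it agrees with g at both end points and almost everywhere.\<close>
  define G where "G s = g 0 + (\<integral>r\<in>{0..s}. d r \<partial>lborel)" for s
  have dint: "set_integrable lborel {a..b} d" if "0 \<le> a" "b \<le> 1" for a b
    using d(1) that by (rule_tac set_integrable_subset) auto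
  have G_eq: "G s = g 0 + integral {0..s} d" if "s \<le> 1" for s
    using set_borel_integral_eq_integral(2)[OF dint[of 0 s]] that by (simp add: G_def)
  have "continuous_on {0..1} (\<lambda>s. g 0 + integral {0..s} d)"
    using set_borel_integral_eq_integral(1)[OF d(1)]
    by (intro continuous_intros indefinite_integral_continuous_1)
  then have cont: "continuous_on {0..1} G"
    using G_eq by (auto cong: continuous_on_cong_simp)
  then have cont': "continuous_on {0..1} (\<lambda>s. \<bar>G s\<bar>)" by (intro continuous_intros)
  have G0: "G 0 = g 0" and G1: "G 1 = g 1" using G_eq[of 0] g1 by (auto simp: G_def)
  define S where "S = {s\<in>{0..1}. \<beta> \<le> \<bar>G s\<bar>}"
  have "compact S" unfolding S_def
    using continuous_closed_preimage[OF cont' closed_atLeastAtMost, of "{\<beta>..}"]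
    by (auto simp: compact_eq_bounded_closed vimage_def Int_def conj_commute intro: bounded_subset[of "{0..1}"])
  moreover have "0 \<in> S" using lev(1) G0 by (auto simp: S_def)
  then have "S \<noteq> {}" by blast
  ultimately obtain p where p: "p \<in> S" "\<And>s. s \<in> S \<Longrightarrow> s \<le> p" using compact_attains_sup by metis
  define T where "T = {s\<in>{p..1}. \<bar>G s\<bar> \<le> \<alpha>}"
  have pI: "0 \<le> p" "p \<le> 1" using p(1) by (auto simp: S_def)
  have "compact T" unfolding T_def
    using continuous_closed_preimage[OF continuous_on_subset[OF cont'] closed_atLeastAtMost, of p 1 "{..\<alpha>}"] pI
    by (auto simp: compact_eq_bounded_closed vimage_def Int_def conj_commute intro: bounded_subset[of "{0..1}"])
  moreover have "1 \<in> T" using lev(2) G1 pI by (auto simp: T_def)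
  then have "T \<noteq> {}" by blast
  ultimately obtain q where q: "q \<in> T" "\<And>s. s \<in> T \<Longrightarrow> q \<le> s" using compact_attains_inf by metis
  have qI: "p \<le> q" "q \<le> 1" using q(1) by (auto simp: T_def)
  have between: "\<alpha> < \<bar>G s\<bar> \<and> \<bar>G s\<bar> < \<beta>" if "s \<in> {p<..<q}" for s
    using that p(2)[of s] q(2)[of s] pI qI by (force simp: S_def T_def)
  have "\<beta> - \<alpha> \<le> \<bar>G p\<bar> - \<bar>G q\<bar>" using p(1) q(1) by (auto simp: S_def T_def)
  also have "\<dots> \<le> \<bar>G q - G p\<bar>" by linarith
  also have "G q - G p = integral {p..q} d"
    using Henstock_Kurzweil_Integration.integral_combine[of 0 p q d] pI qI
      set_borel_integral_eq_integral(1)[OF dint[of 0 q]] by (simp add: G_eq)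
  also have "\<dots> = (\<integral>r\<in>{p..q}. d r \<partial>lborel)"
    using set_borel_integral_eq_integral(2)[OF dint[of p q]] pI qI by simp
  finally have "ennreal (\<beta> - \<alpha>) \<le> ennreal \<bar>\<integral>r\<in>{p..q}. d r \<partial>lborel\<bar>" by (rule ennreal_leI)
  also have "\<dots> \<le> (\<integral>\<^sup>+r. ennreal (norm (indicator {p..q} r *\<^sub>R d r)) \<partial>lborel)"
    using integral_norm_bound_ennreal[OF dint[of p q, unfolded set_integrable_def]] pI qI
    by (simp add: set_lebesgue_integral_def)
  also have "\<dots> \<le> (\<integral>\<^sup>+s\<in>{0..1}. ennreal \<bar>d s\<bar> * indicator {y. \<alpha> < \<bar>y\<bar> \<and> \<bar>y\<bar> < \<beta>} (g s) \<partial>lborel)"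
  proof (rule nn_integral_mono_AE)
    show "AE r in lborel. ennreal (norm (indicator {p..q} r *\<^sub>R d r))
        \<le> ennreal \<bar>d r\<bar> * indicator {y. \<alpha> < \<bar>y\<bar> \<and> \<bar>y\<bar> < \<beta>} (g r) * indicator {0..1} r"
      using ae AE_lborel_singleton[of p] AE_lborel_singleton[of q]
    proof eventually_elim
      case (elim r)
      show ?case
      proof (cases "r \<in> {p<..<q}")
        case True
        then have "g r = G r" using elim pI qI by (simp add: G_def)
        then show ?thesis using True between[OF True] pI qI by (simp add: indicator_def)
      next
        case False
        then have "r \<notin> {p..q}" using elim by auto
        then show ?thesis by simp
      qed
    qed
  qed
  finally show ?thesis .
qed

text \<open>Applied to \<open>s w\<close> for every \<open>s\<close>, the formula for the increments of \<open>u\<close> says, after Fubini, that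
  for almost every \<open>x\<close> the function \<open>s \<mapsto> u (x + s w)\<close> is almost everywhere equal to an absolutely
  continuous function with the expected derivative.\<close>
lemma level_crossing_along_direction:
  fixes u :: "real^'n \<Rightarrow> real" and v :: "'n \<Rightarrow> real^'n \<Rightarrow> real"
  assumes u: "u \<in> borel_measurable borel"
    and v: "\<And>i. integrable lborel (v i)" "\<And>i. v i \<in> borel_measurable borel"
    and V: "open V"
    and seg: "\<And>s. s \<in> {0..1} \<Longrightarrow> AE x in lborel. x \<in> V \<longrightarrow>
      u (x + s *\<^sub>R w) - u x
        = (\<integral>r. indicator {0..1} r * (\<Sum>i\<in>UNIV. (s *\<^sub>R w) $ i * v i (x + r *\<^sub>R (s *\<^sub>R w))) \<partial>lborel)"
    and "\<alpha> < \<beta>" "norm w \<le> R"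
  shows "AE x in lborel. x \<in> V \<and> \<beta> \<le> \<bar>u x\<bar> \<and> \<bar>u (x + w)\<bar> \<le> \<alpha> \<longrightarrow>
    ennreal (\<beta> - \<alpha>) \<le> (\<integral>\<^sup>+s\<in>{0..1}. ennreal (R * (\<Sum>i\<in>UNIV. \<bar>v i (x + s *\<^sub>R w)\<bar>)) *
      indicator {y. \<alpha> < \<bar>u y\<bar> \<and> \<bar>u y\<bar> < \<beta>} (x + s *\<^sub>R w) \<partial>lborel)"
proof -
  define D where "D x r = (\<Sum>i\<in>UNIV. w $ i * v i (x + r *\<^sub>R w))" for x r
  note [measurable] = u v(2)
  have [measurable]: "V \<in> sets borel" using V by simp
  have Dm [measurable]: "(\<lambda>(x, r). D x r) \<in> borel_measurable (borel \<Otimes>\<^sub>M borel)"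
    unfolding D_def by measurable
  have id: "AE x in lborel. x \<in> V \<longrightarrow> u (x + s *\<^sub>R w) - u x = (\<integral>r\<in>{0..s}. D x r \<partial>lborel)"
    if s: "s \<in> {0..1}" for s
  proof (cases "s = 0")
    case True
    have "(\<integral>r\<in>{0..0}. D x r \<partial>lborel) = 0" for x
      unfolding set_lebesgue_integral_def
      by (rule integral_eq_zero_AE) (use AE_lborel_singleton[of "0::real"] in eventually_elim, simp)
    then show ?thesis using True by simp
  next
    case False
    then have s0: "s > 0" using s by simp
    have "(\<integral>r\<in>{0..s}. D x r \<partial>lborel)
       = (\<integral>r. indicator {0..1} r * (\<Sum>i\<in>UNIV. (s *\<^sub>R w) $ i * v i (x + r *\<^sub>R (s *\<^sub>R w))) \<partial>lborel)" for x
    proof -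
      have "(\<integral>r\<in>{0..s}. D x r \<partial>lborel) = \<bar>s\<bar> *\<^sub>R (\<integral>r. indicator {0..s} (0 + s * r) *\<^sub>R D x (0 + s * r) \<partial>lborel)"
        unfolding set_lebesgue_integral_def by (rule lborel_integral_real_affine) (use s0 in simp)
      also have "\<dots> = (\<integral>r. s * (indicator {0..s} (s * r) * D x (s * r)) \<partial>lborel)"
        using s0 by simp
      also have "\<dots> = (\<integral>r. indicator {0..1} r * (\<Sum>i\<in>UNIV. (s *\<^sub>R w) $ i * v i (x + r *\<^sub>R (s *\<^sub>R w))) \<partial>lborel)"
      proof (rule Bochner_Integration.integral_cong[OF refl])
        fix r :: real
        have "indicator {0..s} (s * r) = (indicator {0..1} r :: real)"
          using s0 by (auto simp: indicator_def zero_le_mult_iff)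
        then show "s * (indicator {0..s} (s * r) * D x (s * r))
            = indicator {0..1} r * (\<Sum>i\<in>UNIV. (s *\<^sub>R w) $ i * v i (x + r *\<^sub>R (s *\<^sub>R w)))"
          by (simp add: D_def sum_distrib_left mult_ac)
      qed
      finally show ?thesis .
    qed
    then show ?thesis using seg[OF s] by simp
  qed
  have "AE x in lborel. AE s in lborel. s \<in> {0..1} \<longrightarrow> x \<in> V \<longrightarrow> u (x + s *\<^sub>R w) - u x = (\<integral>r\<in>{0..s}. D x r \<partial>lborel)"
  proof (subst lborel_pair.AE_commute)
    have "(\<lambda>z. \<integral>r. (if 0 \<le> r \<and> r \<le> snd z then D (fst z) r else 0) \<partial>lborel)
        \<in> borel_measurable (lborel \<Otimes>\<^sub>M lborel :: ((real^'n) \<times> real) measure)"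
      by measurable
    also have "(\<lambda>z. \<integral>r. (if 0 \<le> r \<and> r \<le> snd z then D (fst z) r else 0) \<partial>lborel)
        = (\<lambda>z. \<integral>r\<in>{0..snd z}. D (fst z) r \<partial>lborel)"
      by (auto simp: set_lebesgue_integral_def indicator_def intro!: Bochner_Integration.integral_cong)
    finally have [measurable]: "(\<lambda>z. \<integral>r\<in>{0..snd z}. D (fst z) r \<partial>lborel)
        \<in> borel_measurable (lborel \<Otimes>\<^sub>M lborel :: ((real^'n) \<times> real) measure)" .
    show "{z \<in> space (lborel \<Otimes>\<^sub>M lborel). snd z \<in> {0..1} \<longrightarrow> fst z \<in> V \<longrightarrow>
        u (fst z + snd z *\<^sub>R w) - u (fst z) = (\<integral>r\<in>{0..snd z}. D (fst z) r \<partial>lborel)} \<in> sets (lborel \<Otimes>\<^sub>M lborel)"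
      by measurable
    show "AE s in lborel. AE x in lborel. s \<in> {0..1} \<longrightarrow> x \<in> V \<longrightarrow> u (x + s *\<^sub>R w) - u x = (\<integral>r\<in>{0..s}. D x r \<partial>lborel)"
    proof (rule AE_I2)
      fix s :: real
      show "AE x in lborel. s \<in> {0..1} \<longrightarrow> x \<in> V \<longrightarrow> u (x + s *\<^sub>R w) - u x = (\<integral>r\<in>{0..s}. D x r \<partial>lborel)"
        using id[of s] by (cases "s \<in> {0..1}") auto
    qed
  qed
  moreover have "AE x in lborel. set_integrable lborel {0..1} (D x)"
  proof -
    have "integrable (lborel \<Otimes>\<^sub>M lborel) (\<lambda>(x, s). indicator {0..1} s * (v i (x + s *\<^sub>R w) * 1))" for i
      by (rule integrable_translate_product[OF v, of _ 1]) auto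
    then have "AE x in lborel. integrable lborel (\<lambda>s. indicator {0..1} s * v i (x + s *\<^sub>R w))" for i
      using lborel_pair.AE_integrable_fst'[of "\<lambda>(x, s). indicator {0..1} s * (v i (x + s *\<^sub>R w) * 1)"] by simp
    then have "AE x in lborel. \<forall>i. integrable lborel (\<lambda>s. indicator {0..1} s * v i (x + s *\<^sub>R w))"
      by (simp add: AE_all_countable)
    then show ?thesis
    proof eventually_elim
      case (elim x)
      then have "integrable lborel (\<lambda>s. \<Sum>i\<in>UNIV. w $ i * (indicator {0..1} s * v i (x + s *\<^sub>R w)))"
        by (intro Bochner_Integration.integrable_sum integrable_mult_right) simp
      then show ?case by (simp add: set_integrable_def D_def sum_distrib_left mult_ac)
    qed
  qed
  moreover have "AE x in lborel. x \<in> V \<longrightarrow> u (x + 1 *\<^sub>R w) - u x = (\<integral>r\<in>{0..1}. D x r \<partial>lborel)"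
    by (rule id) simp
  ultimately show ?thesis
  proof eventually_elim
    case (elim x)
    show ?case
    proof
      assume *: "x \<in> V \<and> \<beta> \<le> \<bar>u x\<bar> \<and> \<bar>u (x + w)\<bar> \<le> \<alpha>"
      have "ennreal (\<beta> - \<alpha>) \<le> (\<integral>\<^sup>+s\<in>{0..1}. ennreal \<bar>D x s\<bar> *
          indicator {y. \<alpha> < \<bar>y\<bar> \<and> \<bar>y\<bar> < \<beta>} (u (x + s *\<^sub>R w)) \<partial>lborel)"
      proof (rule absolutely_continuous_level_crossing)
        show "D x \<in> borel_measurable borel" "(\<lambda>s. u (x + s *\<^sub>R w)) \<in> borel_measurable borel"
          unfolding D_def by measurable
        show "AE s in lborel. s \<in> {0..1} \<longrightarrow> u (x + s *\<^sub>R w) = u (x + 0 *\<^sub>R w) + (\<integral>r\<in>{0..s}. D x r \<partial>lborel)"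
          using elim(1) by eventually_elim (use * in auto)
        show "u (x + 1 *\<^sub>R w) = u (x + 0 *\<^sub>R w) + (\<integral>r\<in>{0..1}. D x r \<partial>lborel)"
          using elim(3) * by auto
      qed (use elim * assms in auto)
      also have "\<dots> \<le> (\<integral>\<^sup>+s\<in>{0..1}. ennreal (R * (\<Sum>i\<in>UNIV. \<bar>v i (x + s *\<^sub>R w)\<bar>)) *
          indicator {y. \<alpha> < \<bar>u y\<bar> \<and> \<bar>u y\<bar> < \<beta>} (x + s *\<^sub>R w) \<partial>lborel)"
      proof (rule nn_integral_mono)
        fix s
        have "\<bar>D x s\<bar> \<le> (\<Sum>i\<in>UNIV. \<bar>w $ i\<bar> * \<bar>v i (x + s *\<^sub>R w)\<bar>)"
          unfolding D_def by (rule order_trans[OF sum_abs]) (simp add: abs_mult)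
        also have "\<dots> \<le> (\<Sum>i\<in>UNIV. R * \<bar>v i (x + s *\<^sub>R w)\<bar>)"
          using assms(7) component_le_norm_cart[of w] by (intro sum_mono mult_right_mono) (auto intro: order_trans)
        finally have "\<bar>D x s\<bar> \<le> R * (\<Sum>i\<in>UNIV. \<bar>v i (x + s *\<^sub>R w)\<bar>)" by (simp add: sum_distrib_left)
        then show "ennreal \<bar>D x s\<bar> * indicator {y. \<alpha> < \<bar>y\<bar> \<and> \<bar>y\<bar> < \<beta>} (u (x + s *\<^sub>R w)) * indicator {0..1} s
          \<le> ennreal (R * (\<Sum>i\<in>UNIV. \<bar>v i (x + s *\<^sub>R w)\<bar>)) *
            indicator {y. \<alpha> < \<bar>u y\<bar> \<and> \<bar>u y\<bar> < \<beta>} (x + s *\<^sub>R w) * indicator {0..1} s"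
          by (auto simp: indicator_def intro!: ennreal_leI)
      qed
      finally show "ennreal (\<beta> - \<alpha>) \<le> (\<integral>\<^sup>+s\<in>{0..1}. ennreal (R * (\<Sum>i\<in>UNIV. \<bar>v i (x + s *\<^sub>R w)\<bar>)) *
          indicator {y. \<alpha> < \<bar>u y\<bar> \<and> \<bar>u y\<bar> < \<beta>} (x + s *\<^sub>R w) \<partial>lborel)" .
    qed
  qed
qed

section \<open>The weak-type estimate between two levels\<close>

lemma nn_integral_lborel_affine:
  fixes f :: "real^'n \<Rightarrow> ennreal"
  assumes [measurable]: "f \<in> borel_measurable borel" and "c \<noteq> 0"
  shows "(\<integral>\<^sup>+x. f x \<partial>lborel) = ennreal (\<bar>c\<bar> ^ CARD('n)) * (\<integral>\<^sup>+x. f (t + c *\<^sub>R x) \<partial>lborel)"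
proof -
  have "(\<integral>\<^sup>+x. f x \<partial>lborel) = (\<integral>\<^sup>+x. f x \<partial>density (distr lborel borel (\<lambda>x. t + c *\<^sub>R x)) (\<lambda>x. ennreal (\<bar>c\<bar> ^ DIM(real^'n))))"
    by (rule arg_cong[where f = "\<lambda>M. integral\<^sup>N M f", OF lborel_affine[OF assms(2)]])
  also have "\<dots> = (\<integral>\<^sup>+x. ennreal (\<bar>c\<bar> ^ DIM(real^'n)) * f (t + c *\<^sub>R x) \<partial>lborel)"
    by (subst nn_integral_density) (auto simp: nn_integral_distr)
  finally show ?thesis by (simp add: nn_integral_cmult)
qed

text \<open>With \<open>\<tau>\<close> the \<open>n\<close>-th root of \<open>e\<close>, the integrand is at most \<open>b\<close> for \<open>s \<le> \<tau>\<close> and at most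
  \<open>(\<tau> / s)\<^sup>2\<close> beyond, because \<open>n \<ge> 2\<close>; both parts integrate to a multiple of \<open>\<tau>\<close>.\<close>
lemma kernel_integral_bound:
  assumes n: "2 \<le> n" and e: "0 < e" and b: "0 \<le> b"
  shows "(\<integral>\<^sup>+s\<in>{0..1}. ennreal (if s = 0 then b else min b (e / s ^ n)) \<partial>lborel) \<le> ennreal ((b + 1) * root n e)"
proof -
  define \<tau> where "\<tau> = root n e"
  have \<tau>: "\<tau> > 0" "\<tau> ^ n = e" using n e by (auto simp: \<tau>_def)
  have "(\<integral>\<^sup>+s\<in>{0..1}. ennreal (if s = 0 then b else min b (e / s ^ n)) \<partial>lborel)
     \<le> (\<integral>\<^sup>+s. ennreal b * indicator {0..\<tau>} s + ennreal (\<tau>\<^sup>2 / s\<^sup>2) * indicator {\<tau>..} s \<partial>lborel)"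
  proof (rule nn_integral_mono)
    fix s :: real
    show "ennreal (if s = 0 then b else min b (e / s ^ n)) * indicator {0..1} s
       \<le> ennreal b * indicator {0..\<tau>} s + ennreal (\<tau>\<^sup>2 / s\<^sup>2) * indicator {\<tau>..} s"
    proof (cases "s \<in> {0..\<tau>}")
      case True
      have "ennreal (if s = 0 then b else min b (e / s ^ n)) * indicator {0..1} s \<le> ennreal b"
        using b by (auto simp: indicator_def intro!: ennreal_leI)
      also have "\<dots> \<le> ennreal b * indicator {0..\<tau>} s + ennreal (\<tau>\<^sup>2 / s\<^sup>2) * indicator {\<tau>..} s"
        using True by simp
      finally show ?thesis .
    next
      case False
      show ?thesis
      proof (cases "s \<in> {0..1}")
        case True
        with False have s: "s > \<tau>" "s > 0" using \<tau> by auto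
        have "e / s ^ n = (\<tau> / s) ^ n" using \<tau> by (simp add: power_divide)
        also have "\<dots> \<le> (\<tau> / s) ^ 2" using s \<tau> n by (intro power_decreasing) auto
        finally have "min b (e / s ^ n) \<le> \<tau>\<^sup>2 / s\<^sup>2" by (simp add: power_divide)
        then show ?thesis using s True False by (auto intro!: ennreal_leI)
      qed simp
    qed
  qed
  also have "\<dots> = ennreal b * emeasure lborel {0..\<tau>} + (\<integral>\<^sup>+s. ennreal (\<tau>\<^sup>2 / s\<^sup>2) * indicator {\<tau>..} s \<partial>lborel)"
    by (subst nn_integral_add) (auto simp: nn_integral_cmult)
  also have "(\<integral>\<^sup>+s. ennreal (\<tau>\<^sup>2 / s\<^sup>2) * indicator {\<tau>..} s \<partial>lborel) = ennreal (0 - (- (\<tau>\<^sup>2 / \<tau>)))"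
  proof (rule nn_integral_FTC_atLeast[where F = "\<lambda>s. - (\<tau>\<^sup>2 / s)"])
    show "((\<lambda>s. - (\<tau>\<^sup>2 / s)) has_real_derivative \<tau>\<^sup>2 / s\<^sup>2) (at s)" if "\<tau> \<le> s" for s
      using that \<tau> by (auto intro!: derivative_eq_intros simp: power2_eq_square)
    show "((\<lambda>s. - (\<tau>\<^sup>2 / s)) \<longlongrightarrow> 0) at_top"
      using tendsto_minus[OF tendsto_divide_0[OF tendsto_const
            filterlim_at_top_imp_at_infinity[OF filterlim_ident]], of "\<tau>\<^sup>2"] by simp
  qed (auto simp: field_simps)
  also have "ennreal b * emeasure lborel {0..\<tau>} + ennreal (0 - (- (\<tau>\<^sup>2 / \<tau>))) = ennreal ((b + 1) * \<tau>)"
    using \<tau> b by (simp add: ennreal_mult[symmetric] ennreal_plus[symmetric] power2_eq_square algebra_simps del: ennreal_plus)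
  finally show ?thesis unfolding \<tau>_def .
qed

text \<open>The directions in \<open>B\<close> that lead from \<open>E\<close> to \<open>y\<close> in time \<open>s\<close> form a subset of \<open>B\<close> and of a copy
  of \<open>E\<close> dilated by \<open>1/s\<close>.\<close>
lemma overlap_bound:
  fixes E B :: "(real^'n) set"
  assumes [measurable]: "E \<in> sets borel" "B \<in> sets borel" and fin: "emeasure lborel E = ennreal e" "emeasure lborel B = ennreal b"
    "0 \<le> e" "0 \<le> b" and s: "0 \<le> s"
  shows "(\<integral>\<^sup>+w. indicator B w * indicator E (y - s *\<^sub>R w) \<partial>lborel) \<le> ennreal (if s = 0 then b else min b (e / s ^ CARD('n)))"
proof -
  have "(\<integral>\<^sup>+w. indicator B w * indicator E (y - s *\<^sub>R w) \<partial>lborel) \<le> (\<integral>\<^sup>+w. indicator B w \<partial>lborel)"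
    by (intro nn_integral_mono) (auto simp: indicator_def)
  then have 1: "(\<integral>\<^sup>+w. indicator B w * indicator E (y - s *\<^sub>R w) \<partial>lborel) \<le> ennreal b"
    using fin by simp
  show ?thesis
  proof (cases "s = 0")
    case False
    have "(\<integral>\<^sup>+w. indicator B w * indicator E (y - s *\<^sub>R w) \<partial>lborel) \<le> (\<integral>\<^sup>+w. indicator E (y + (-s) *\<^sub>R w) \<partial>lborel)"
      by (intro nn_integral_mono) (auto simp: indicator_def)
    moreover have "ennreal (s ^ CARD('n)) * (\<integral>\<^sup>+w. indicator E (y + (-s) *\<^sub>R w) \<partial>lborel) = ennreal e"
      using nn_integral_lborel_affine[of "indicator E" "-s" y] False s fin by simp
    then have "(\<integral>\<^sup>+w. indicator E (y + (-s) *\<^sub>R w) \<partial>lborel) = ennreal (e / s ^ CARD('n))"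
    proof -
      assume a: "ennreal (s ^ CARD('n)) * (\<integral>\<^sup>+w. indicator E (y + (-s) *\<^sub>R w) \<partial>lborel) = ennreal e"
      have p: "s ^ CARD('n) > 0" using False s by simp
      have "(\<integral>\<^sup>+w. indicator E (y + (-s) *\<^sub>R w) \<partial>lborel)
          = ennreal (1 / s ^ CARD('n)) * (ennreal (s ^ CARD('n)) * (\<integral>\<^sup>+w. indicator E (y + (-s) *\<^sub>R w) \<partial>lborel))"
        unfolding mult.assoc[symmetric] using p False by (simp add: ennreal_mult[symmetric])
      also have "\<dots> = ennreal (e / s ^ CARD('n))"
        unfolding a using p fin by (simp add: ennreal_mult[symmetric])
      finally show ?thesis .
    qed
    ultimately show ?thesis using 1 False by (simp add: min_def)
  qed (use 1 in simp)
qed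

text \<open>Let \<open>E\<close> be the part of the patch where \<open>|u| \<ge> \<beta>\<close>.  From each \<open>x\<close> in \<open>E\<close>, at least half of the
  directions \<open>w\<close> lead to a point with \<open>|u| \<le> \<alpha>\<close>, and along these the gradient inside the slice
  integrates to at least \<open>\<beta> - \<alpha>\<close>.  Integrating over \<open>x\<close>, \<open>w\<close> and the time \<open>s\<close>, and substituting
  \<open>y = x + s w\<close>, leaves the gradient at \<open>y\<close> multiplied by the measure of the directions that reach
  \<open>y\<close> from \<open>E\<close>.  By \<open>overlap_bound\<close> and \<open>kernel_integral_bound\<close> this measure integrates
  over \<open>s\<close> to a multiple of the \<open>n\<close>-th root of \<open>|E|\<close>.\<close>
lemma level_set_estimate_patch:
  fixes u :: "real^'n \<Rightarrow> real" and v :: "'n \<Rightarrow> real^'n \<Rightarrow> real"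
  assumes n: "2 \<le> CARD('n)"
    and u: "u \<in> borel_measurable borel"
    and v: "\<And>i. v i \<in> borel_measurable borel"
    and patch: "W \<in> sets borel" "r > 0" "\<And>x w. x \<in> W \<Longrightarrow> w \<in> ball a r \<Longrightarrow> x + w \<in> \<Omega>"
    and dir: "\<And>w. w \<in> ball a r \<Longrightarrow> AE x in lborel. x \<in> W \<and> \<beta> \<le> \<bar>u x\<bar> \<and> \<bar>u (x + w)\<bar> \<le> \<alpha> \<longrightarrow>
      ennreal (\<beta> - \<alpha>) \<le> (\<integral>\<^sup>+s\<in>{0..1}. ennreal ((norm a + r) * (\<Sum>i\<in>UNIV. \<bar>v i (x + s *\<^sub>R w)\<bar>)) *
        indicator {y. \<alpha> < \<bar>u y\<bar> \<and> \<bar>u y\<bar> < \<beta>} (x + s *\<^sub>R w) \<partial>lborel)"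
    and \<Omega>: "\<Omega> \<in> sets borel"
    and small: "emeasure lborel {x\<in>\<Omega>. \<bar>u x\<bar> > \<alpha>} \<le> ennreal (measure lborel (ball a r) / 2)"
    and lev: "\<alpha> < \<beta>"
    and e: "emeasure lborel {x\<in>W. \<beta> \<le> \<bar>u x\<bar>} = ennreal e" "0 \<le> e"
  shows "ennreal (\<beta> - \<alpha>) * ennreal e
    \<le> ennreal (2 * (norm a + r) * (measure lborel (ball a r) + 1) / measure lborel (ball a r) * root CARD('n) e) *
      (\<integral>\<^sup>+x. ennreal (\<Sum>i\<in>UNIV. \<bar>v i x\<bar>) * indicator {y. \<alpha> < \<bar>u y\<bar> \<and> \<bar>u y\<bar> < \<beta>} x \<partial>lborel)"
proof (cases "e = 0")
  case True
  then show ?thesis by simp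
next
  case False
  then have e0: "e > 0" using e by simp
  let ?B = "ball a r"
  define b where "b = measure lborel ?B"
  have b: "b > 0" unfolding b_def using patch(2) by (rule content_ball_pos)
  have bB: "emeasure lborel ?B = ennreal b"
    unfolding b_def using emeasure_bounded_finite[OF bounded_ball, of a r]
    by (intro emeasure_eq_ennreal_measure) auto
  define E where "E = {x\<in>W. \<beta> \<le> \<bar>u x\<bar>}"
  define L where "L = {y. \<bar>u y\<bar> \<le> \<alpha>}"
  define S where "S = {y. \<alpha> < \<bar>u y\<bar> \<and> \<bar>u y\<bar> < \<beta>}"
  define R where "R = norm a + r"
  define g where "g x = ennreal (\<Sum>i\<in>UNIV. \<bar>v i x\<bar>) * indicator S x" for x
  have R0: "R > 0" using patch(2) by (simp add: R_def add_nonneg_pos)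
  note [measurable] = u v patch(1) \<Omega>
  have [measurable]: "?B \<in> sets borel" by simp
  have [measurable]: "E \<in> sets borel" "L \<in> sets borel" "S \<in> sets borel" "g \<in> borel_measurable borel"
    unfolding E_def L_def S_def g_def by measurable
  \<comment> \<open>The set where u exceeds \<open>\<alpha>\<close> is too small to contain the end points of more than half of the directions.\<close>
  have half: "ennreal (b / 2) \<le> (\<integral>\<^sup>+w. indicator ?B w * indicator L (x + w) \<partial>lborel)" if x: "x \<in> E" for x
  proof -
    have "(\<integral>\<^sup>+w. indicator {x\<in>\<Omega>. \<bar>u x\<bar> > \<alpha>} (x + w) \<partial>lborel) = emeasure lborel {x\<in>\<Omega>. \<bar>u x\<bar> > \<alpha>}"
      using lborel_nn_integral_translate[of "indicator {x\<in>\<Omega>. \<bar>u x\<bar> > \<alpha>}" x] by (simp add: add.commute)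
    then have "(\<integral>\<^sup>+w. indicator {x\<in>\<Omega>. \<bar>u x\<bar> > \<alpha>} (x + w) \<partial>lborel) \<le> ennreal (b / 2)"
      using small by (simp add: b_def)
    moreover have "ennreal b \<le> (\<integral>\<^sup>+w. indicator ?B w * indicator L (x + w) \<partial>lborel)
        + (\<integral>\<^sup>+w. indicator {x\<in>\<Omega>. \<bar>u x\<bar> > \<alpha>} (x + w) \<partial>lborel)"
    proof -
      have "ennreal b = (\<integral>\<^sup>+w. indicator ?B w \<partial>lborel)" using bB by simp
      also have "\<dots> \<le> (\<integral>\<^sup>+w. indicator ?B w * indicator L (x + w) + indicator {x\<in>\<Omega>. \<bar>u x\<bar> > \<alpha>} (x + w) \<partial>lborel)"
        using patch(3)[of x] x by (intro nn_integral_mono) (auto simp: indicator_def L_def E_def)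
      also have "\<dots> = (\<integral>\<^sup>+w. indicator ?B w * indicator L (x + w) \<partial>lborel)
        + (\<integral>\<^sup>+w. indicator {x\<in>\<Omega>. \<bar>u x\<bar> > \<alpha>} (x + w) \<partial>lborel)"
        by (rule nn_integral_add; measurable)
      finally show ?thesis .
    qed
    ultimately have "ennreal b \<le> (\<integral>\<^sup>+w. indicator ?B w * indicator L (x + w) \<partial>lborel) + ennreal (b / 2)"
      by (meson add_left_mono order_trans)
    then have "ennreal b - ennreal (b / 2) \<le> (\<integral>\<^sup>+w. indicator ?B w * indicator L (x + w) \<partial>lborel)"
      by (simp add: ennreal_minus_le_iff add.commute)
    then show ?thesis using b by (simp add: ennreal_minus)
  qed
  have "ennreal (\<beta> - \<alpha>) * (ennreal (b / 2) * ennreal e)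
     = ennreal (\<beta> - \<alpha>) * (\<integral>\<^sup>+x. ennreal (b / 2) * indicator E x \<partial>lborel)"
    using e by (simp add: nn_integral_cmult E_def)
  also have "\<dots> \<le> ennreal (\<beta> - \<alpha>) * (\<integral>\<^sup>+x. (\<integral>\<^sup>+w. indicator ?B w * indicator L (x + w) \<partial>lborel) * indicator E x \<partial>lborel)"
    using half by (intro mult_left_mono nn_integral_mono) (auto simp: indicator_def)
  also have "\<dots> = (\<integral>\<^sup>+x. (\<integral>\<^sup>+w. ennreal (\<beta> - \<alpha>) * (indicator ?B w * indicator L (x + w) * indicator E x) \<partial>lborel) \<partial>lborel)"
    by (simp add: nn_integral_cmult nn_integral_multc)
  also have "\<dots> = (\<integral>\<^sup>+w. (\<integral>\<^sup>+x. ennreal (\<beta> - \<alpha>) * (indicator ?B w * indicator L (x + w) * indicator E x) \<partial>lborel) \<partial>lborel)"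
    by (rule lborel_pair.Fubini'[symmetric]; measurable)
  also have "\<dots> \<le> (\<integral>\<^sup>+w. (\<integral>\<^sup>+x. indicator ?B w * indicator E x * (\<integral>\<^sup>+s\<in>{0..1}. ennreal R * g (x + s *\<^sub>R w) \<partial>lborel) \<partial>lborel) \<partial>lborel)"
  proof (rule nn_integral_mono)
    fix w
    show "(\<integral>\<^sup>+x. ennreal (\<beta> - \<alpha>) * (indicator ?B w * indicator L (x + w) * indicator E x) \<partial>lborel)
      \<le> (\<integral>\<^sup>+x. indicator ?B w * indicator E x * (\<integral>\<^sup>+s\<in>{0..1}. ennreal R * g (x + s *\<^sub>R w) \<partial>lborel) \<partial>lborel)"
    proof (cases "w \<in> ?B")
      case True
      show ?thesis
      proof (rule nn_integral_mono_AE)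
        show "AE x in lborel. ennreal (\<beta> - \<alpha>) * (indicator ?B w * indicator L (x + w) * indicator E x)
          \<le> indicator ?B w * indicator E x * (\<integral>\<^sup>+s\<in>{0..1}. ennreal R * g (x + s *\<^sub>R w) \<partial>lborel)"
          using dir[OF True]
        proof eventually_elim
          case (elim x)
          have "(\<integral>\<^sup>+s\<in>{0..1}. ennreal R * g (x + s *\<^sub>R w) \<partial>lborel)
            = (\<integral>\<^sup>+s\<in>{0..1}. ennreal ((norm a + r) * (\<Sum>i\<in>UNIV. \<bar>v i (x + s *\<^sub>R w)\<bar>)) *
              indicator {y. \<alpha> < \<bar>u y\<bar> \<and> \<bar>u y\<bar> < \<beta>} (x + s *\<^sub>R w) \<partial>lborel)"
            using R0 by (intro nn_integral_cong) (simp add: g_def R_def[symmetric] S_def ennreal_mult sum_nonneg mult.assoc)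
          then show ?case using elim True
            by (cases "x \<in> E \<and> x + w \<in> L") (auto simp: E_def L_def)
        qed
      qed
    qed simp
  qed
  also have "\<dots> = (\<integral>\<^sup>+w. (\<integral>\<^sup>+x. (\<integral>\<^sup>+s. ennreal R * (indicator {0..1} s * (indicator ?B w * indicator E x * g (x + s *\<^sub>R w))) \<partial>lborel) \<partial>lborel) \<partial>lborel)"
    by (intro nn_integral_cong) (simp add: nn_integral_cmult[symmetric] mult_ac)
  also have "\<dots> = (\<integral>\<^sup>+w. (\<integral>\<^sup>+s. (\<integral>\<^sup>+x. ennreal R * (indicator {0..1} s * (indicator ?B w * indicator E x * g (x + s *\<^sub>R w))) \<partial>lborel) \<partial>lborel) \<partial>lborel)"
    by (intro nn_integral_cong lborel_pair.Fubini'; measurable)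
  also have "\<dots> = (\<integral>\<^sup>+s. (\<integral>\<^sup>+w. (\<integral>\<^sup>+x. ennreal R * (indicator {0..1} s * (indicator ?B w * indicator E x * g (x + s *\<^sub>R w))) \<partial>lborel) \<partial>lborel) \<partial>lborel)"
    by (rule lborel_pair.Fubini'; measurable)
  also have "\<dots> = (\<integral>\<^sup>+s. (\<integral>\<^sup>+w. (\<integral>\<^sup>+y. ennreal R * (indicator {0..1} s * (indicator ?B w * indicator E (y - s *\<^sub>R w) * g y)) \<partial>lborel) \<partial>lborel) \<partial>lborel)"
  proof (rule nn_integral_cong, rule nn_integral_cong)
    fix s :: real and w :: "real^'n"
    show "(\<integral>\<^sup>+x. ennreal R * (indicator {0..1} s * (indicator ?B w * indicator E x * g (x + s *\<^sub>R w))) \<partial>lborel)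
      = (\<integral>\<^sup>+y. ennreal R * (indicator {0..1} s * (indicator ?B w * indicator E (y - s *\<^sub>R w) * g y)) \<partial>lborel)"
      using lborel_nn_integral_translate[of "\<lambda>y. ennreal R * (indicator {0..1} s * (indicator ?B w * indicator E (y - s *\<^sub>R w) * g y))" "s *\<^sub>R w"]
      by simp
  qed
  also have "\<dots> = (\<integral>\<^sup>+s. (\<integral>\<^sup>+y. (\<integral>\<^sup>+w. ennreal R * (indicator {0..1} s * (indicator ?B w * indicator E (y - s *\<^sub>R w) * g y)) \<partial>lborel) \<partial>lborel) \<partial>lborel)"
    by (intro nn_integral_cong lborel_pair.Fubini'; measurable)
  also have "\<dots> = (\<integral>\<^sup>+s. (\<integral>\<^sup>+y. ennreal R * indicator {0..1} s * g y * (\<integral>\<^sup>+w. indicator ?B w * indicator E (y - s *\<^sub>R w) \<partial>lborel) \<partial>lborel) \<partial>lborel)"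
    by (intro nn_integral_cong) (simp add: nn_integral_cmult[symmetric] mult_ac)
  also have "\<dots> \<le> (\<integral>\<^sup>+s. (\<integral>\<^sup>+y. ennreal R * indicator {0..1} s * g y * ennreal (if s = 0 then b else min b (e / s ^ CARD('n))) \<partial>lborel) \<partial>lborel)"
  proof (intro nn_integral_mono)
    fix s :: real and y :: "real^'n"
    show "ennreal R * indicator {0..1} s * g y * (\<integral>\<^sup>+w. indicator ?B w * indicator E (y - s *\<^sub>R w) \<partial>lborel)
      \<le> ennreal R * indicator {0..1} s * g y * ennreal (if s = 0 then b else min b (e / s ^ CARD('n)))"
    proof (cases "s \<in> {0..1}")
      case True
      then show ?thesis using e b bB by (intro mult_left_mono overlap_bound) (auto simp: E_def[symmetric])
    qed simp
  qed
  also have "\<dots> = ennreal R * (\<integral>\<^sup>+y. g y \<partial>lborel) * (\<integral>\<^sup>+s\<in>{0..1}. ennreal (if s = 0 then b else min b (e / s ^ CARD('n))) \<partial>lborel)"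
    by (simp add: nn_integral_cmult nn_integral_multc mult_ac)
  also have "\<dots> \<le> ennreal R * (\<integral>\<^sup>+y. g y \<partial>lborel) * ennreal ((b + 1) * root CARD('n) e)"
    using kernel_integral_bound[OF n e0, of b] b by (intro mult_left_mono) auto
  finally have main: "ennreal (\<beta> - \<alpha>) * (ennreal (b / 2) * ennreal e)
    \<le> ennreal R * (\<integral>\<^sup>+y. g y \<partial>lborel) * ennreal ((b + 1) * root CARD('n) e)" .
  have "ennreal (\<beta> - \<alpha>) * ennreal e = ennreal (2 / b) * (ennreal (\<beta> - \<alpha>) * (ennreal (b / 2) * ennreal e))"
    using b lev e0 by (simp add: ennreal_mult[symmetric])
  also have "\<dots> \<le> ennreal (2 / b) * (ennreal R * (\<integral>\<^sup>+y. g y \<partial>lborel) * ennreal ((b + 1) * root CARD('n) e))"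
    by (intro mult_left_mono main) simp
  also have "\<dots> = ennreal (2 / b * R * ((b + 1) * root CARD('n) e)) * (\<integral>\<^sup>+y. g y \<partial>lborel)"
  proof -
    have "ennreal (2 / b * R * ((b + 1) * root CARD('n) e))
        = ennreal (2 / b) * ennreal R * ennreal ((b + 1) * root CARD('n) e)"
      using b R0 e0 by (subst ennreal_mult, simp, simp, subst ennreal_mult) auto
    then show ?thesis by (simp only: mult_ac)
  qed
  also have "2 / b * R * ((b + 1) * root CARD('n) e) = 2 * R * (b + 1) / b * root CARD('n) e"
    by simp
  finally show ?thesis unfolding R_def b_def g_def S_def .
qed

text \<open>Functions on the whole space, tested only inside \<open>\<Omega>\<close>: nothing is asked of \<open>u\<close> across the
  boundary, so the extension by zero of a Sobolev function on \<open>\<Omega>\<close> and of its weak gradient is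
  covered.\<close>
definition integrable_weak_gradient ::
    "(real^'n) set \<Rightarrow> (real^'n \<Rightarrow> real) \<Rightarrow> ('n \<Rightarrow> real^'n \<Rightarrow> real) \<Rightarrow> bool" where
  "integrable_weak_gradient \<Omega> u v \<longleftrightarrow>
     integrable lborel u \<and> u \<in> borel_measurable borel \<and>
     (\<forall>i. integrable lborel (v i) \<and> v i \<in> borel_measurable borel) \<and>
     (\<forall>i. \<forall>\<phi>\<in>test_functions \<Omega>.
        (\<integral>x. u x * partial_derivative i \<phi> x \<partial>lborel) = - (\<integral>x. v i x * \<phi> x \<partial>lborel))"

text \<open>A relative isoperimetric inequality in disguise: dividing by the measure of \<open>{|u| \<ge> \<beta>}\<close> bounds
  the height of a slice by the gradient inside it.  The threshold \<open>\<epsilon>\<close> is half the volume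
  of the smallest ball of directions, so that in every patch most directions lead to low values.\<close>
lemma level_set_estimate:
  fixes \<Omega> :: "(real^'n) set"
  assumes n: "2 \<le> CARD('n)" and \<Omega>: "bounded_lipschitz_domain \<Omega>"
  obtains C \<epsilon> where "0 \<le> C" "0 < \<epsilon>"
    "\<forall>u v \<alpha> \<beta>. integrable_weak_gradient \<Omega> u v \<longrightarrow> \<alpha> < \<beta> \<longrightarrow>
      emeasure lborel {x\<in>\<Omega>. \<bar>u x\<bar> > \<alpha>} \<le> ennreal \<epsilon> \<longrightarrow>
      ennreal (\<beta> - \<alpha>) * emeasure lborel {x\<in>\<Omega>. \<beta> \<le> \<bar>u x\<bar>}
       \<le> ennreal (C * root CARD('n) (measure lborel {x\<in>\<Omega>. \<beta> \<le> \<bar>u x\<bar>})) *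
         (\<integral>\<^sup>+x. ennreal (\<Sum>i\<in>UNIV. \<bar>v i x\<bar>) * indicator {y. \<alpha> < \<bar>u y\<bar> \<and> \<bar>u y\<bar> < \<beta>} x \<partial>lborel)"
proof -
  have "open \<Omega>" "bounded \<Omega>" "\<Omega> \<noteq> {}" using \<Omega> by (auto simp: bounded_lipschitz_domain_def)
  obtain P :: "((real^'n) set \<times> (real^'n) \<times> real) set" where P: "finite P" "\<Omega> \<subseteq> (\<Union>(U, a, r)\<in>P. U)"
    "\<And>U a r. (U, a, r) \<in> P \<Longrightarrow> open U \<and> r > 0 \<and>
       (\<forall>x\<in>U \<inter> \<Omega>. \<forall>w\<in>ball a r. \<forall>s\<in>{0..1}. x + s *\<^sub>R w \<in> \<Omega>)"
    by (rule lipschitz_domain_directions[OF \<Omega>], rule that)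
  define c where "c = (\<lambda>(U :: (real^'n) set, a :: real^'n, r :: real).
    2 * (norm a + r) * (measure lborel (ball a r) + 1) / measure lborel (ball a r))"
  define C where "C = (\<Sum>p\<in>P. c p)"
  define \<epsilon> where "\<epsilon> = Min ((\<lambda>(U, a, r). measure lborel (ball a r) / 2) ` P)"
  have c0: "c p \<ge> 0" if "p \<in> P" for p
    using P(3)[of "fst p" "fst (snd p)" "snd (snd p)"] that by (auto simp: c_def split_beta)
  have "P \<noteq> {}" using P(2) \<open>\<Omega> \<noteq> {}\<close> by auto
  show thesis
  proof (rule that; (intro allI impI)?)
    show "0 \<le> C" unfolding C_def by (intro sum_nonneg c0)
    show "0 < \<epsilon>" unfolding \<epsilon>_def
      using P(1,3) \<open>P \<noteq> {}\<close> by (subst Min_gr_iff) (auto intro!: content_ball_pos)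
    fix u :: "real^'n \<Rightarrow> real" and v :: "'n \<Rightarrow> real^'n \<Rightarrow> real" and \<alpha> \<beta> :: real
    assume grad: "integrable_weak_gradient \<Omega> u v"
      and lev: "\<alpha> < \<beta>" and small: "emeasure lborel {x\<in>\<Omega>. \<bar>u x\<bar> > \<alpha>} \<le> ennreal \<epsilon>"
    have u: "integrable lborel u" "u \<in> borel_measurable borel"
      and v: "\<And>i. integrable lborel (v i)" "\<And>i. v i \<in> borel_measurable borel"
      and weak: "\<And>i \<phi>. \<phi> \<in> test_functions \<Omega> \<Longrightarrow>
        (\<integral>x. u x * partial_derivative i \<phi> x \<partial>lborel) = - (\<integral>x. v i x * \<phi> x \<partial>lborel)"
      using grad by (auto simp: integrable_weak_gradient_def)
    note [measurable] = u(2) v(2)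
    have \<Omega>b [measurable]: "\<Omega> \<in> sets borel" using \<open>open \<Omega>\<close> by simp
    let ?I = "\<integral>\<^sup>+x. ennreal (\<Sum>i\<in>UNIV. \<bar>v i x\<bar>) * indicator {y. \<alpha> < \<bar>u y\<bar> \<and> \<bar>u y\<bar> < \<beta>} x \<partial>lborel"
    define E where "E W = {x\<in>W. \<beta> \<le> \<bar>u x\<bar>}" for W
    have Eb: "E W \<in> sets borel" if "W \<in> sets borel" for W
      using that unfolding E_def by measurable
    have fin: "emeasure lborel (E W) < \<infinity>" if "W \<subseteq> \<Omega>" for W
      by (rule emeasure_bounded_finite) (use that \<open>bounded \<Omega>\<close> in \<open>auto simp: E_def intro: bounded_subset\<close>)
    have em: "emeasure lborel (E W) = ennreal (measure lborel (E W))" if "W \<subseteq> \<Omega>" for W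
      using fin[OF that] by (intro emeasure_eq_ennreal_measure) auto
    have Pb: "fst p \<inter> \<Omega> \<in> sets borel" if "p \<in> P" for p
      using P(3)[of "fst p" "fst (snd p)" "snd (snd p)"] that \<open>open \<Omega>\<close> by (simp add: open_Int)
    have patch: "ennreal (\<beta> - \<alpha>) * emeasure lborel (E (fst p \<inter> \<Omega>))
       \<le> ennreal (c p * root CARD('n) (measure lborel (E \<Omega>))) * ?I" if p: "p \<in> P" for p
    proof -
      obtain U a r where Uar: "p = (U, a, r)" by (cases p) auto
      have U: "open U" "r > 0" and seg: "\<And>x w s. x \<in> U \<inter> \<Omega> \<Longrightarrow> w \<in> ball a r \<Longrightarrow> s \<in> {0..1} \<Longrightarrow> x + s *\<^sub>R w \<in> \<Omega>"
        using P(3)[of U a r] p by (auto simp: Uar)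
      have "open (U \<inter> \<Omega>)" using U \<open>open \<Omega>\<close> by auto
      have "ennreal (\<beta> - \<alpha>) * ennreal (measure lborel (E (U \<inter> \<Omega>)))
        \<le> ennreal (2 * (norm a + r) * (measure lborel (ball a r) + 1) / measure lborel (ball a r)
            * root CARD('n) (measure lborel (E (U \<inter> \<Omega>)))) * ?I"
      proof (rule level_set_estimate_patch[where W = "U \<inter> \<Omega>" and \<Omega> = \<Omega>])
        show "U \<inter> \<Omega> \<in> sets borel" using \<open>open (U \<inter> \<Omega>)\<close> by simp
        show "x + w \<in> \<Omega>" if "x \<in> U \<inter> \<Omega>" "w \<in> ball a r" for x w
          using seg[OF that, of 1] by simp
        have "\<epsilon> \<le> measure lborel (ball a r) / 2"
          unfolding \<epsilon>_def using P(1) p by (intro Min_le) (auto simp: Uar image_iff intro!: bexI[of _ p])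
        then show "emeasure lborel {x\<in>\<Omega>. \<bar>u x\<bar> > \<alpha>} \<le> ennreal (measure lborel (ball a r) / 2)"
          using small by (meson ennreal_leI order_trans)
        show "emeasure lborel {x\<in>U \<inter> \<Omega>. \<beta> \<le> \<bar>u x\<bar>} = ennreal (measure lborel (E (U \<inter> \<Omega>)))"
          using em[of "U \<inter> \<Omega>"] by (simp add: E_def)
        fix w assume w: "w \<in> ball a r"
        show "AE x in lborel. x \<in> U \<inter> \<Omega> \<and> \<beta> \<le> \<bar>u x\<bar> \<and> \<bar>u (x + w)\<bar> \<le> \<alpha> \<longrightarrow>
          ennreal (\<beta> - \<alpha>) \<le> (\<integral>\<^sup>+s\<in>{0..1}. ennreal ((norm a + r) * (\<Sum>i\<in>UNIV. \<bar>v i (x + s *\<^sub>R w)\<bar>)) *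
            indicator {y. \<alpha> < \<bar>u y\<bar> \<and> \<bar>u y\<bar> < \<beta>} (x + s *\<^sub>R w) \<partial>lborel)"
        proof (rule level_crossing_along_direction[OF u(2) v \<open>open (U \<inter> \<Omega>)\<close> _ lev])
          have "norm w - norm a \<le> norm (w - a)" by (rule norm_triangle_ineq2)
          then show "norm w \<le> norm a + r" using w by (simp add: dist_norm norm_minus_commute)
          fix s :: real assume s: "s \<in> {0..1}"
          show "AE x in lborel. x \<in> U \<inter> \<Omega> \<longrightarrow> u (x + s *\<^sub>R w) - u x
            = (\<integral>r. indicator {0..1} r * (\<Sum>i\<in>UNIV. (s *\<^sub>R w) $ i * v i (x + r *\<^sub>R (s *\<^sub>R w))) \<partial>lborel)"
          proof (rule weak_gradient_along_segment[OF u v weak \<open>open (U \<inter> \<Omega>)\<close>])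
            fix x t assume "x \<in> U \<inter> \<Omega>" "t \<in> {0..1::real}"
            then show "x + t *\<^sub>R (s *\<^sub>R w) \<in> \<Omega>"
              using seg[OF _ w, of x "t * s"] s by (auto simp: mult_le_one)
          qed
        qed
      qed (use n u v \<Omega>b U lev in auto)
      also have "\<dots> \<le> ennreal (c p * root CARD('n) (measure lborel (E \<Omega>))) * ?I"
      proof -
        have "measure lborel (E (U \<inter> \<Omega>)) \<le> measure lborel (E \<Omega>)"
        proof (rule measure_mono_fmeasurable)
          show "E (U \<inter> \<Omega>) \<subseteq> E \<Omega>" by (auto simp: E_def)
          show "E (U \<inter> \<Omega>) \<in> sets lborel" using Eb[of "U \<inter> \<Omega>"] \<open>open (U \<inter> \<Omega>)\<close> by simp
          show "E \<Omega> \<in> fmeasurable lborel" using fin[of \<Omega>] Eb[OF \<Omega>b] by (simp add: fmeasurable_def)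
        qed
        then have "root CARD('n) (measure lborel (E (U \<inter> \<Omega>))) \<le> root CARD('n) (measure lborel (E \<Omega>))"
          by simp
        then have "c p * root CARD('n) (measure lborel (E (U \<inter> \<Omega>))) \<le> c p * root CARD('n) (measure lborel (E \<Omega>))"
          using c0[OF p] by (rule mult_left_mono)
        then show ?thesis
          unfolding c_def Uar prod.case by (intro mult_right_mono ennreal_leI) auto
      qed
      finally show ?thesis using em[of "U \<inter> \<Omega>"] by (simp add: Uar)
    qed
    have "ennreal (\<beta> - \<alpha>) * emeasure lborel (E \<Omega>) \<le> ennreal (\<beta> - \<alpha>) * emeasure lborel (\<Union>p\<in>P. E (fst p \<inter> \<Omega>))"
    proof (intro mult_left_mono emeasure_mono)
      show "E \<Omega> \<subseteq> (\<Union>p\<in>P. E (fst p \<inter> \<Omega>))"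
      proof
        fix x assume x: "x \<in> E \<Omega>"
        then have "x \<in> \<Omega>" by (simp add: E_def)
        then obtain p where p: "p \<in> P" "x \<in> fst p" using P(2) by (auto split: prod.splits)
        then show "x \<in> (\<Union>p\<in>P. E (fst p \<inter> \<Omega>))" using x by (intro UN_I[of p]) (auto simp: E_def)
      qed
      show "(\<Union>p\<in>P. E (fst p \<inter> \<Omega>)) \<in> sets lborel"
        using P(1) Pb by (auto intro!: sets.finite_UN Eb)
    qed simp
    also have "\<dots> \<le> ennreal (\<beta> - \<alpha>) * (\<Sum>p\<in>P. emeasure lborel (E (fst p \<inter> \<Omega>)))"
      using P(1) Pb by (intro mult_left_mono emeasure_subadditive_finite) (auto intro!: Eb)
    also have "\<dots> = (\<Sum>p\<in>P. ennreal (\<beta> - \<alpha>) * emeasure lborel (E (fst p \<inter> \<Omega>)))"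
      by (simp add: sum_distrib_left)
    also have "\<dots> \<le> (\<Sum>p\<in>P. ennreal (c p * root CARD('n) (measure lborel (E \<Omega>))) * ?I)"
      by (intro sum_mono patch)
    also have "\<dots> = ennreal (C * root CARD('n) (measure lborel (E \<Omega>))) * ?I"
    proof -
      have "(\<Sum>p\<in>P. ennreal (c p * root CARD('n) (measure lborel (E \<Omega>))))
          = ennreal (\<Sum>p\<in>P. c p * root CARD('n) (measure lborel (E \<Omega>)))"
        by (intro sum_ennreal mult_nonneg_nonneg c0) auto
      then show ?thesis unfolding C_def sum_distrib_right[symmetric] by simp
    qed
    finally show "ennreal (\<beta> - \<alpha>) * emeasure lborel {x\<in>\<Omega>. \<beta> \<le> \<bar>u x\<bar>}
       \<le> ennreal (C * root CARD('n) (measure lborel {x\<in>\<Omega>. \<beta> \<le> \<bar>u x\<bar>})) * ?I"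
      by (simp add: E_def)
  qed
qed

section \<open>Rearrangement-invariant norms on a bounded set of positive measure\<close>

locale bounded_measurable_set =
  fixes \<Omega> :: "(real^'n) set"
  assumes \<Omega>_lebesgue: "\<Omega> \<in> sets lebesgue" and \<Omega>_bounded: "bounded \<Omega>" and \<Omega>_pos: "0 < measure lebesgue \<Omega>"
begin

abbreviation "M \<equiv> lebesgue_on \<Omega>"
abbreviation "V \<equiv> measure lebesgue \<Omega>"

definition t :: "nat \<Rightarrow> real" where "t k = V / 2 ^ k"

lemma t_pos: "0 < t k" using \<Omega>_pos by (simp add: t_def)
lemma t_0: "t 0 = V" by (simp add: t_def)
lemma t_le_V: "t k \<le> V" using \<Omega>_pos by (simp add: t_def divide_le_eq)
lemma t_Suc: "t k = 2 * t (Suc k)" by (simp add: t_def)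

lemma emeasure_\<Omega>_finite: "emeasure lebesgue \<Omega> < \<infinity>"
  using bounded_set_imp_lmeasurable[OF \<Omega>_bounded \<Omega>_lebesgue] unfolding fmeasurable_def by blast

lemma emeasure_M: "S \<subseteq> \<Omega> \<Longrightarrow> emeasure M S = emeasure lebesgue S"
  using \<Omega>_lebesgue by (simp add: emeasure_restrict_space)

lemma emeasure_M_\<Omega>: "emeasure M \<Omega> = ennreal V"
  unfolding emeasure_M[OF subset_refl] using emeasure_\<Omega>_finite
  by (intro emeasure_eq_ennreal_measure) simp

lemma space_M [simp]: "space M = \<Omega>" by (simp add: space_restrict_space)

lemma finite_measure_M: "finite_measure M"
  by (rule finite_measureI) (simp add: emeasure_M_\<Omega>)

sublocale M: finite_measure M by (rule finite_measure_M)

lemma emeasure_M_le: "emeasure M S \<le> ennreal V"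
  using emeasure_space[of M S] by (simp add: emeasure_M_\<Omega>)

text \<open>The measure of \<open>S \<inter> cball 0 r\<close> grows continuously with \<open>r\<close>, no faster than the volume of the
  ball, so the intermediate value theorem applies.\<close>
lemma exists_subset_measure:
  assumes S: "S \<in> sets M" and s: "0 \<le> s" "ennreal s \<le> emeasure M S"
  obtains E where "E \<in> sets M" "E \<subseteq> S" "emeasure M E = ennreal s"
proof -
  have S': "S \<subseteq> \<Omega>" "S \<in> sets lebesgue"
    using S \<Omega>_lebesgue by (auto simp: sets_restrict_space_iff)
  obtain R where R: "R > 0" "\<And>x. x \<in> \<Omega> \<Longrightarrow> norm x \<le> R"
    using \<Omega>_bounded bounded_pos by metis
  define f where "f r = measure lebesgue (S \<inter> cball 0 r)" for r
  define g where "g r = measure lebesgue (cball (0::real^'n) r)" for r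
  have Slm: "S \<inter> cball 0 r \<in> lmeasurable" for r
    using S'(2) by (intro bounded_set_imp_lmeasurable) (auto intro: bounded_Int)
  have step: "f r' - f r \<le> g r' - g r \<and> f r \<le> f r'" if "r \<le> r'" for r r'
  proof
    have d: "measure lebesgue (A - B) = measure lebesgue A - measure lebesgue B"
      if "A \<in> lmeasurable" "B \<in> lmeasurable" "B \<subseteq> A" for A B :: "(real^'n) set"
      using that by (simp add: measurable_measure_Diff fmeasurableD)
    have "f r' - f r = measure lebesgue ((S \<inter> cball 0 r') - (S \<inter> cball 0 r))"
      unfolding f_def using that by (intro d[symmetric] Slm) auto
    also have "\<dots> \<le> measure lebesgue (cball (0::real^'n) r' - cball 0 r)"
      using Slm by (intro measure_mono_fmeasurable) (auto intro!: fmeasurable.Diff fmeasurableD)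
    also have "\<dots> = g r' - g r"
      unfolding g_def using that by (intro d) (auto intro: subset_cball)
    finally show "f r' - f r \<le> g r' - g r" .
    show "f r \<le> f r'" unfolding f_def
      using that Slm by (intro measure_mono_fmeasurable) (auto intro: fmeasurableD)
  qed
  have gc: "continuous_on {0..R} g"
  proof -
    have "continuous_on {0..R} (\<lambda>r. unit_ball_vol (real DIM(real^'n)) * r ^ DIM(real^'n))"
      by (intro continuous_intros)
    moreover have "g r = unit_ball_vol (real DIM(real^'n)) * r ^ DIM(real^'n)" if "r \<in> {0..R}" for r
      unfolding g_def using content_cball[of r "0::real^'n"] that by simp
    ultimately show ?thesis by (metis (no_types, lifting) continuous_on_cong)
  qed
  have "continuous_on {0..R} f"
    unfolding continuous_on_iff
  proof (intro ballI allI impI)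
    fix x \<epsilon> :: real assume x: "x \<in> {0..R}" and "0 < \<epsilon>"
    then obtain d where d: "d > 0" "\<And>y. y \<in> {0..R} \<Longrightarrow> dist y x < d \<Longrightarrow> dist (g y) (g x) < \<epsilon>"
      using gc unfolding continuous_on_iff by metis
    have "dist (f y) (f x) \<le> dist (g y) (g x)" for y
      using step[of x y] step[of y x] by (cases "x \<le> y") (auto simp: dist_real_def)
    then show "\<exists>d>0. \<forall>y\<in>{0..R}. dist y x < d \<longrightarrow> dist (f y) (f x) < \<epsilon>"
      using d by (meson le_less_trans)
  qed
  moreover have "f 0 = 0"
  proof -
    have "measure lebesgue (S \<inter> cball 0 0) \<le> measure lebesgue {0::real^'n}"
      using Slm[of 0] by (intro measure_mono_fmeasurable) (auto intro: fmeasurableD lmeasurable_compact)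
    then show ?thesis by (simp add: f_def measure_le_0_iff)
  qed
  moreover have fR: "ennreal (f R) = emeasure M S"
  proof -
    have "S \<inter> cball 0 R = S" using R(2) S' by auto
    then show ?thesis using Slm[of R] S'
      by (simp add: f_def emeasure_M emeasure_eq_measure2)
  qed
  moreover have "s \<le> f R" using s(2) unfolding fR[symmetric] by (simp add: f_def)
  ultimately obtain r where "0 \<le> r" "f r = s"
    using IVT'[of f 0 s R] s(1) R(1) by auto
  show thesis
  proof (rule that[of "S \<inter> cball 0 r"])
    show "S \<inter> cball 0 r \<in> sets M"
      using S' Slm[of r] \<Omega>_lebesgue by (auto simp: sets_restrict_space_iff fmeasurableD)
    show "emeasure M (S \<inter> cball 0 r) = ennreal s"
      using S' Slm[of r] \<open>f r = s\<close> by (subst emeasure_M) (auto simp: f_def emeasure_eq_measure2)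
  qed auto
qed

lemma t_tendsto_0: "t \<longlonglongrightarrow> 0"
  unfolding t_def[abs_def] using LIMSEQ_divide_realpow_zero[of 2 V] by simp

section \<open>Distribution functions\<close>

lemma superlevel_sets:
  fixes f :: "real^'n \<Rightarrow> ennreal"
  assumes [measurable]: "f \<in> borel_measurable M"
  shows "{x \<in> \<Omega>. f x > l} \<in> sets M"
proof -
  have "{x \<in> space M. f x > l} \<in> sets M" by measurable
  then show ?thesis by simp
qed

lemma distribution_function_antimono:
  assumes [measurable]: "f \<in> borel_measurable M" and "l \<le> l'"
  shows "distribution_function \<Omega> f l' \<le> distribution_function \<Omega> f l"
  unfolding distribution_function_def
  using superlevel_sets[OF assms(1)] assms(2) by (intro emeasure_mono) auto

text \<open>Right-continuity of the distribution function: the infimum that defines the rearrangement is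
  attained.  Thus rearrangement and distribution function determine each other.\<close>
lemma decreasing_rearrangement_le_iff:
  assumes [measurable]: "f \<in> borel_measurable M"
  shows "decreasing_rearrangement \<Omega> f s \<le> l \<longleftrightarrow> distribution_function \<Omega> f l \<le> s"
proof
  assume "distribution_function \<Omega> f l \<le> s"
  then show "decreasing_rearrangement \<Omega> f s \<le> l"
    unfolding decreasing_rearrangement_def by (intro Inf_lower) simp
next
  assume le: "decreasing_rearrangement \<Omega> f s \<le> l"
  let ?A = "{l. distribution_function \<Omega> f l \<le> s}"
  have "\<infinity> \<in> ?A" by (simp add: distribution_function_def)
  then obtain L :: "nat \<Rightarrow> ennreal" where L: "decseq L" "range L \<subseteq> ?A" "Inf ?A = (INF i. L i)"
    using ennreal_Inf_countable_INF[of ?A] by blast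
  note sets = superlevel_sets[OF assms]
  have "{x \<in> \<Omega>. f x > l} \<subseteq> (\<Union>i. {x \<in> \<Omega>. f x > L i})"
    using le L(3) unfolding decreasing_rearrangement_def
    by (auto simp: INF_less_iff[symmetric] dest: le_less_trans)
  then have "emeasure M {x \<in> \<Omega>. f x > l} \<le> emeasure M (\<Union>i. {x \<in> \<Omega>. f x > L i})"
    by (rule emeasure_mono) (use sets in auto)
  also have "\<dots> = (SUP i. emeasure M {x \<in> \<Omega>. f x > L i})"
  proof (rule SUP_emeasure_incseq[symmetric])
    show "incseq (\<lambda>i. {x \<in> \<Omega>. f x > L i})"
      using L(1) by (auto simp: incseq_def decseq_def dest: le_less_trans)
  qed (use sets in auto)
  also have "\<dots> \<le> s" using L(2) by (intro SUP_least) (auto simp: distribution_function_def)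
  finally show "distribution_function \<Omega> f l \<le> s" by (simp add: distribution_function_def)
qed

lemma distribution_function_eqI:
  assumes f: "f \<in> borel_measurable M" and g: "g \<in> borel_measurable M"
    and eq: "decreasing_rearrangement \<Omega> f = decreasing_rearrangement \<Omega> g"
  shows "distribution_function \<Omega> f = distribution_function \<Omega> g"
proof
  fix l
  have "distribution_function \<Omega> f l \<le> s \<longleftrightarrow> distribution_function \<Omega> g l \<le> s" for s
    using decreasing_rearrangement_le_iff[OF f, of s l] decreasing_rearrangement_le_iff[OF g, of s l] eq by simp
  then show "distribution_function \<Omega> f l = distribution_function \<Omega> g l"
    by (meson order_antisym order_refl)
qed

lemma distribution_function_indicator:
  "E \<subseteq> \<Omega> \<Longrightarrow> distribution_function \<Omega> (indicator E) l = (if l < 1 then emeasure M E else 0)"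
proof -
  assume E: "E \<subseteq> \<Omega>"
  have "{x \<in> \<Omega>. indicator E x > l} = (if l < 1 then E else {})"
    using E by (auto simp: indicator_def)
  then show ?thesis by (auto simp: distribution_function_def)
qed

section \<open>Fundamental functions\<close>

lemma sets_M_subset: "E \<in> sets M \<Longrightarrow> E \<subseteq> \<Omega>"
  using sets.sets_into_space[of E M] by simp

end

locale ri_norm_on = bounded_measurable_set \<Omega> + ri_norm \<Omega> \<rho> for \<Omega> :: "(real^'n) set" and \<rho>
begin

abbreviation "ff \<equiv> fundamental_function \<Omega> \<rho>"

lemma rho_indicator_eq:
  assumes "E \<in> sets M" "F \<in> sets M" "emeasure M E = emeasure M F"
  shows "\<rho> (indicator E) = \<rho> (indicator F)"
proof (rule P6)
  have "distribution_function \<Omega> (indicator E) = distribution_function \<Omega> (indicator F)"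
    using assms by (auto simp: distribution_function_indicator sets_M_subset)
  then show "decreasing_rearrangement \<Omega> (indicator E) = decreasing_rearrangement \<Omega> (indicator F)"
    by (simp add: decreasing_rearrangement_def fun_eq_iff)
qed (use assms in auto)

lemma fundamental_function_eq:
  assumes "E \<in> sets M" "emeasure M E = min (ennreal s) (ennreal V)"
  shows "ff s = \<rho> (indicator E)"
  unfolding fundamental_function_def emeasure_M_\<Omega>
proof (rule the_equality)
  show "\<exists>F\<in>sets M. emeasure M F = min (ennreal s) (ennreal V) \<and> \<rho> (indicator E) = \<rho> (indicator F)"
    using assms by blast
  show "c = \<rho> (indicator E)"
    if "\<exists>F\<in>sets M. emeasure M F = min (ennreal s) (ennreal V) \<and> c = \<rho> (indicator F)" for c
    using that assms rho_indicator_eq by metis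
qed

lemma fundamental_function_eq':
  "E \<in> sets M \<Longrightarrow> emeasure M E = ennreal s \<Longrightarrow> ff s = \<rho> (indicator E)"
  using emeasure_M_le[of E] by (intro fundamental_function_eq) (auto simp: min_def)

lemma obtain_set:
  assumes "0 \<le> s"
  obtains E where "E \<in> sets M" "emeasure M E = min (ennreal s) (ennreal V)" "ff s = \<rho> (indicator E)"
proof -
  have "\<Omega> \<in> sets M" using sets.top[of M] by simp
  moreover have "ennreal (min s V) \<le> emeasure M \<Omega>" unfolding emeasure_M_\<Omega> by (intro ennreal_leI) simp
  ultimately obtain E where "E \<in> sets M" "emeasure M E = ennreal (min s V)"
    using exists_subset_measure[of \<Omega> "min s V"] assms \<Omega>_pos by auto
  then show thesis using that[of E] fundamental_function_eq[of E s] assms \<Omega>_pos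
    by (simp add: min_def split: if_splits)
qed

lemma rho_zero: "\<rho> (\<lambda>x. 0) = 0"
  using P1_homogeneous[of "\<lambda>x. 0" 0] by simp

lemma rho_cong_AE:
  assumes "f \<in> borel_measurable M" "g \<in> borel_measurable M" "AE x in M. f x = g x"
  shows "\<rho> f = \<rho> g"
  using assms by (intro antisym P2) (auto elim: eventually_mono)

text \<open>A set of measure at most \<open>s\<close> need not lie in a set of measure \<open>s\<close> already at hand, but by
  rearrangement invariance it may be exchanged for one that does.\<close>
lemma rho_indicator_le:
  assumes "E \<in> sets M" "emeasure M E \<le> ennreal s" "0 \<le> s"
  shows "\<rho> (indicator E) \<le> ff s"
proof -
  obtain F where F: "F \<in> sets M" "emeasure M F = min (ennreal s) (ennreal V)" "ff s = \<rho> (indicator F)"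
    using obtain_set[OF assms(3)] by blast
  have "emeasure M E \<le> emeasure M F" using assms emeasure_M_le[of E] F by simp
  moreover have "emeasure M E = ennreal (measure M E)" by (simp add: M.emeasure_eq_measure)
  ultimately obtain G where G: "G \<in> sets M" "G \<subseteq> F" "emeasure M G = ennreal (measure M E)"
    using exists_subset_measure[OF F(1), of "measure M E"] by auto
  have "\<rho> (indicator E) = \<rho> (indicator G)"
    using assms G by (intro rho_indicator_eq) (auto simp: M.emeasure_eq_measure)
  also have "\<dots> \<le> \<rho> (indicator F)"
    using G F by (intro P2) (auto simp: indicator_def)
  finally show ?thesis by (simp add: F)
qed

lemma ff_mono: "0 \<le> s \<Longrightarrow> s \<le> s' \<Longrightarrow> ff s \<le> ff s'"
proof -
  assume s: "0 \<le> s" "s \<le> s'"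
  obtain F where F: "F \<in> sets M" "emeasure M F = min (ennreal s) (ennreal V)" "ff s = \<rho> (indicator F)"
    using obtain_set[OF s(1)] by blast
  have "emeasure M F \<le> ennreal s'" using F s by (simp add: ennreal_leI min.coboundedI1)
  then show ?thesis using rho_indicator_le[OF F(1), of s'] F s by simp
qed

lemma ff_0: "ff 0 = 0"
proof -
  have "(indicator {} :: (real^'n) \<Rightarrow> ennreal) = (\<lambda>x. 0)" by auto
  then show ?thesis using fundamental_function_eq'[of "{}" 0] rho_zero by simp
qed

lemma ff_finite: "0 \<le> s \<Longrightarrow> ff s < \<infinity>"
proof -
  assume "0 \<le> s"
  then obtain E where E: "E \<in> sets M" "ff s = \<rho> (indicator E)"
    using obtain_set[of s] by blast
  have "emeasure M E < \<infinity>" using emeasure_M_le[of E] by (rule le_less_trans) simp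
  then show ?thesis using P4[OF E(1)] E(2) by simp
qed

lemma ff_pos: "0 < s \<Longrightarrow> 0 < ff s"
proof (rule ccontr)
  assume s: "0 < s" "\<not> 0 < ff s"
  obtain F where F: "F \<in> sets M" "emeasure M F = min (ennreal s) (ennreal V)" "ff s = \<rho> (indicator F)"
    using obtain_set[of s] s by auto
  then have "AE x in M. (indicator F x :: ennreal) = 0"
    using P1_definite[of "indicator F"] s by simp
  then have "AE x in M. x \<notin> F" by eventually_elim (auto simp: indicator_def split: if_splits)
  then have "emeasure M F = 0" using AE_iff_null_sets[OF F(1)] by auto
  then show False using F s \<Omega>_pos by (simp add: min_def split: if_splits)
qed

lemma ff_double: "0 \<le> s \<Longrightarrow> ff (2 * s) \<le> 2 * ff s"
proof -
  assume s: "0 \<le> s"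
  obtain F where F: "F \<in> sets M" "emeasure M F = min (ennreal (2 * s)) (ennreal V)" "ff (2 * s) = \<rho> (indicator F)"
    using obtain_set[of "2 * s"] s by auto
  define a where "a = min (2 * s) V"
  have a: "emeasure M F = ennreal a" "0 \<le> a" "a \<le> 2 * s"
    using F s \<Omega>_pos by (auto simp: a_def min_def split: if_splits)
  obtain G where G: "G \<in> sets M" "G \<subseteq> F" "emeasure M G = ennreal (a / 2)"
    using exists_subset_measure[OF F(1), of "a / 2"] a by (auto simp: ennreal_leI)
  have D: "emeasure M (F - G) = ennreal (a / 2)"
  proof -
    have "emeasure M (F - G) = emeasure M F - emeasure M G"
      using G F by (intro emeasure_Diff) auto
    also have "\<dots> = ennreal (a / 2)" unfolding a(1) G(3) using a(2) by (simp add: ennreal_minus)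
    finally show ?thesis .
  qed
  have "\<rho> (indicator F) = \<rho> (\<lambda>x. indicator G x + indicator (F - G) x)"
    using G(2) by (intro arg_cong[where f = \<rho>] ext) (auto simp: indicator_def)
  also have "\<dots> \<le> \<rho> (indicator G) + \<rho> (indicator (F - G))"
    using G F by (intro P1_triangle) auto
  also have "\<dots> \<le> ff s + ff s"
    using G F D a s by (intro add_mono rho_indicator_le) (auto intro!: ennreal_leI)
  finally show ?thesis unfolding F(3) mult_2[of "ff s"] .
qed

text \<open>The dyadic form of the fact that \<open>\<phi>(s)/s\<close> is almost decreasing.\<close>
lemma ff_dyadic_le: "i \<le> k \<Longrightarrow> ff (t i) \<le> 2 ^ (k - i) * ff (t k)"
proof (induction "k - i" arbitrary: i)
  case 0
  then show ?case by simp
next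
  case (Suc d)
  then have "ff (t i) \<le> 2 * ff (t (Suc i))"
    using ff_double[of "t (Suc i)"] t_pos[of "Suc i"] t_Suc[of i] by simp
  also have "\<dots> \<le> 2 * (2 ^ (k - Suc i) * ff (t k))"
    using Suc by (intro mult_left_mono) auto
  also have "\<dots> = 2 ^ (k - i) * ff (t k)"
  proof -
    have "k - i = Suc (k - Suc i)" using Suc by simp
    then show ?thesis by (simp add: mult.assoc)
  qed
  finally show ?case .
qed

text \<open>The Fatou property P3 carries the triangle inequality over to infinite sums.\<close>
lemma rho_countable_subadditive:
  assumes [measurable]: "\<And>j::nat. f j \<in> borel_measurable M"
  shows "\<rho> (\<lambda>x. \<Sum>j. f j x) \<le> (\<Sum>j. \<rho> (f j))"
proof -
  have fin: "\<rho> (\<lambda>x. \<Sum>j<k. f j x) \<le> (\<Sum>j<k. \<rho> (f j))" for k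
  proof (induction k)
    case 0
    then show ?case by (simp add: rho_zero)
  next
    case (Suc k)
    have "\<rho> (\<lambda>x. (\<Sum>j<k. f j x) + f k x) \<le> \<rho> (\<lambda>x. \<Sum>j<k. f j x) + \<rho> (f k)"
      by (rule P1_triangle) measurable
    also have "\<dots> \<le> (\<Sum>j<k. \<rho> (f j)) + \<rho> (f k)" using Suc by (intro add_right_mono)
    finally show ?case by simp
  qed
  have "(\<lambda>k. \<rho> (\<lambda>x. \<Sum>j<k. f j x)) \<longlonglongrightarrow> \<rho> (\<lambda>x. \<Sum>j. f j x)"
  proof (rule P3[THEN conjunct2])
    show "AE x in M. incseq (\<lambda>k. \<Sum>j<k. f j x) \<and> (\<lambda>k. \<Sum>j<k. f j x) \<longlonglongrightarrow> (\<Sum>j. f j x)"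
      by (intro AE_I2 conjI summable_LIMSEQ summableI) (auto simp: incseq_def intro!: sum_mono2)
  qed measurable
  then show ?thesis
  proof (rule LIMSEQ_le_const2)
    have "(\<Sum>j<k. \<rho> (f j)) \<le> (\<Sum>j. \<rho> (f j))" for k by (intro sum_le_suminf summableI) auto
    then show "\<exists>N. \<forall>k\<ge>N. \<rho> (\<lambda>x. \<Sum>j<k. f j x) \<le> (\<Sum>j. \<rho> (f j))"
      using fin by (meson order_trans)
  qed
qed

end

context bounded_measurable_set
begin

lemma equivalent_functions_dyadicI:
  assumes r1: "ri_norm \<Omega> \<rho>1" and r2: "ri_norm \<Omega> \<rho>2" and C: "0 < C"
    and le: "\<And>k. fundamental_function \<Omega> \<rho>1 (t k) \<le> ennreal C * fundamental_function \<Omega> \<rho>2 (t k)"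
    and s: "0 \<le> s"
  shows "fundamental_function \<Omega> \<rho>1 s \<le> ennreal (2 * C) * fundamental_function \<Omega> \<rho>2 s"
proof -
  interpret r1: ri_norm_on \<Omega> \<rho>1 by (rule ri_norm_on.intro[OF bounded_measurable_set_axioms r1])
  interpret r2: ri_norm_on \<Omega> \<rho>2 by (rule ri_norm_on.intro[OF bounded_measurable_set_axioms r2])
  show ?thesis
  proof (cases "s = 0")
    case True
    then show ?thesis by (simp add: r1.ff_0)
  next
    case False
    then have s0: "0 < s" using s by simp
    have C2: "ennreal (2 * C) = 2 * ennreal C" using C by (simp add: ennreal_mult)
    show ?thesis
    proof (cases "V \<le> s")
      case True
      have "fundamental_function \<Omega> \<rho>1 s = fundamental_function \<Omega> \<rho>1 (t 0)"
        using True s0 by (simp add: fundamental_function_def emeasure_M_\<Omega> t_0 min_absorb2 ennreal_leI)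
      also have "\<dots> \<le> ennreal C * fundamental_function \<Omega> \<rho>2 (t 0)" by (rule le)
      also have "\<dots> \<le> ennreal (2 * C) * fundamental_function \<Omega> \<rho>2 s"
        using True C t_pos[of 0] by (intro mult_mono r2.ff_mono ennreal_leI) (auto simp: t_0)
      finally show ?thesis .
    next
      case False
      have "eventually (\<lambda>k. t k < s) sequentially" using t_tendsto_0 s0 by (rule order_tendstoD)
      then have ex: "\<exists>k. t k < s" by (auto simp: eventually_sequentially)
      define k where "k = (LEAST k. t k < s)"
      have k: "t k < s" unfolding k_def using ex by (rule LeastI_ex)
      have "k \<noteq> 0"
      proof
        assume "k = 0"
        then show False using k False by (simp add: t_0)
      qed
      then obtain j where j: "k = Suc j" by (cases k) auto
      have "\<not> t j < s" using not_less_Least[of j "\<lambda>k. t k < s"] j by (auto simp: k_def[symmetric])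
      then have "fundamental_function \<Omega> \<rho>1 s \<le> fundamental_function \<Omega> \<rho>1 (t j)"
        using s by (intro r1.ff_mono) auto
      also have "\<dots> \<le> ennreal C * fundamental_function \<Omega> \<rho>2 (t j)" by (rule le)
      also have "\<dots> \<le> ennreal C * (2 * fundamental_function \<Omega> \<rho>2 (t k))"
        using r2.ff_double[of "t k"] t_pos[of k] t_Suc[of j] j by (intro mult_left_mono) auto
      also have "\<dots> \<le> ennreal C * (2 * fundamental_function \<Omega> \<rho>2 s)"
        using k t_pos[of k] by (intro mult_left_mono r2.ff_mono) auto
      finally show ?thesis unfolding C2 by (simp only: mult_ac)
    qed
  qed
qed

section \<open>The K-functional as a function of the distribution function\<close>

text \<open>Peetre's \<open>K\<close>-functional between \<open>L\<^sup>1\<close> and \<open>L\<^sup>\<infinity>\<close>, which is the integral of the decreasing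
  rearrangement over \<open>[0, s]\<close>.  This layer-cake form makes rearrangement invariance and monotone
  convergence immediate; the triangle inequality needs the variational form below.\<close>
definition K_functional :: "((real^'n) \<Rightarrow> ennreal) \<Rightarrow> real \<Rightarrow> ennreal" where
  "K_functional f s = (\<integral>\<^sup>+l\<in>{0..}. min (distribution_function \<Omega> f (ennreal l)) (ennreal s) \<partial>lborel)"

lemma distribution_function_eq_nn_integral:
  assumes [measurable]: "f \<in> borel_measurable M"
  shows "distribution_function \<Omega> f l = (\<integral>\<^sup>+x. (if l < f x then 1 else 0) \<partial>M)"
proof -
  have "distribution_function \<Omega> f l = (\<integral>\<^sup>+x. indicator {x \<in> \<Omega>. f x > l} x \<partial>M)"
    using superlevel_sets[OF assms] by (simp add: distribution_function_def)
  also have "\<dots> = (\<integral>\<^sup>+x. (if l < f x then 1 else 0) \<partial>M)"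
    by (intro nn_integral_cong) (auto simp: indicator_def)
  finally show ?thesis .
qed

lemma distribution_function_measurable [measurable (raw)]:
  assumes [measurable]: "f \<in> borel_measurable M"
  shows "(\<lambda>l. distribution_function \<Omega> f (ennreal l)) \<in> borel_measurable lborel"
  unfolding distribution_function_eq_nn_integral[OF assms] by measurable

lemma emeasure_lborel_half_line: "emeasure lborel {0::real..} = \<infinity>"
proof -
  have "of_nat k \<le> emeasure lborel {0::real..}" for k
  proof -
    have "ennreal (real k) = emeasure lborel {0..real k}" by simp
    also have "\<dots> \<le> emeasure lborel {0::real..}" by (intro emeasure_mono) auto
    finally show ?thesis by (simp add: ennreal_of_nat_eq_real_of_nat)
  qed
  then have "(SUP k. of_nat k) \<le> emeasure lborel {0::real..}" by (intro SUP_least)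
  then show ?thesis by (simp add: ennreal_SUP_of_nat_eq_top top_unique)
qed

lemma nn_integral_below: "(\<integral>\<^sup>+l. (if 0 \<le> l \<and> ennreal l < y then 1 else 0) \<partial>lborel) = y"
proof (cases y)
  case (real r)
  have "(\<integral>\<^sup>+l. (if 0 \<le> l \<and> ennreal l < y then 1 else 0) \<partial>lborel) = (\<integral>\<^sup>+l. indicator {0..<r} l \<partial>lborel)"
    using real by (intro nn_integral_cong) (auto simp: indicator_def ennreal_less_iff)
  then show ?thesis using real by simp
next
  case top
  have "(\<integral>\<^sup>+l. (if 0 \<le> l \<and> ennreal l < y then 1 else 0) \<partial>lborel) = (\<integral>\<^sup>+l. indicator {0::real..} l \<partial>lborel)"
    using top by (intro nn_integral_cong) (auto simp: indicator_def ennreal_less_top)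
  then show ?thesis using top by (simp add: emeasure_lborel_half_line)
qed

lemma layer_cake:
  assumes [measurable]: "f \<in> borel_measurable M"
  shows "(\<integral>\<^sup>+x. f x \<partial>M) = (\<integral>\<^sup>+l\<in>{0..}. distribution_function \<Omega> f (ennreal l) \<partial>lborel)"
proof -
  interpret pair_sigma_finite M lborel ..
  have "(\<integral>\<^sup>+l\<in>{0..}. distribution_function \<Omega> f (ennreal l) \<partial>lborel)
     = (\<integral>\<^sup>+l. (\<integral>\<^sup>+x. (if 0 \<le> l \<and> ennreal l < f x then 1 else 0) \<partial>M) \<partial>lborel)"
    unfolding distribution_function_eq_nn_integral[OF assms]
    by (intro nn_integral_cong) (auto simp: indicator_def)
  also have "\<dots> = (\<integral>\<^sup>+x. (\<integral>\<^sup>+l. (if 0 \<le> l \<and> ennreal l < f x then 1 else 0) \<partial>lborel) \<partial>M)"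
    by (rule Fubini') measurable
  also have "\<dots> = (\<integral>\<^sup>+x. f x \<partial>M)" by (simp add: nn_integral_below)
  finally show ?thesis by simp
qed

lemma layer_cake_shift:
  assumes [measurable]: "f \<in> borel_measurable M" and c: "0 \<le> c"
  shows "(\<integral>\<^sup>+x. f x - ennreal c \<partial>M) = (\<integral>\<^sup>+l\<in>{c..}. distribution_function \<Omega> f (ennreal l) \<partial>lborel)"
proof -
  have eq: "distribution_function \<Omega> (\<lambda>x. f x - ennreal c) (ennreal l) = distribution_function \<Omega> f (ennreal (c + l))"
    if "0 \<le> l" for l
  proof -
    have "ennreal l < y - ennreal c \<longleftrightarrow> ennreal (c + l) < y" for y
      using that c by (cases y)
        (auto simp: ennreal_minus ennreal_less_iff ennreal_less_top top_unique less_diff_eq add.commute simp del: ennreal_plus)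
    then show ?thesis by (simp add: distribution_function_def)
  qed
  have "(\<integral>\<^sup>+x. f x - ennreal c \<partial>M) = (\<integral>\<^sup>+l\<in>{0..}. distribution_function \<Omega> (\<lambda>x. f x - ennreal c) (ennreal l) \<partial>lborel)"
    by (rule layer_cake) measurable
  also have "\<dots> = (\<integral>\<^sup>+l. distribution_function \<Omega> f (ennreal (c + 1 * l)) * indicator {c..} (c + 1 * l) \<partial>lborel)"
    using eq by (intro nn_integral_cong) (auto simp: indicator_def)
  also have "\<dots> = (\<integral>\<^sup>+l\<in>{c..}. distribution_function \<Omega> f (ennreal l) \<partial>lborel)"
    using nn_integral_real_affine[of "\<lambda>l. distribution_function \<Omega> f (ennreal l) * indicator {c..} l" 1 c]
      distribution_function_measurable[OF assms(1)] by simp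
  finally show ?thesis .
qed

text \<open>One half of the variational formula: the \<open>K\<close>-functional is the minimum over \<open>c\<close> of \<open>c s\<close> plus the
  integral of the excess of \<open>f\<close> over \<open>c\<close>.  Below height \<open>c\<close> the integrand is bounded by \<open>s\<close>, above
  it by the distribution function.\<close>
lemma K_functional_le:
  assumes [measurable]: "f \<in> borel_measurable M" and c: "0 \<le> c"
  shows "K_functional f s \<le> ennreal c * ennreal s + (\<integral>\<^sup>+x. f x - ennreal c \<partial>M)"
proof -
  have "K_functional f s \<le> (\<integral>\<^sup>+l. ennreal s * indicator {0..c} l + distribution_function \<Omega> f (ennreal l) * indicator {c..} l \<partial>lborel)"
    unfolding K_functional_def by (intro nn_integral_mono) (auto simp: indicator_def min_le_iff_disj)
  also have "\<dots> = (\<integral>\<^sup>+l. ennreal s * indicator {0..c} l \<partial>lborel) + (\<integral>\<^sup>+x. f x - ennreal c \<partial>M)"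
    unfolding layer_cake_shift[OF assms] by (rule nn_integral_add; measurable)
  also have "(\<integral>\<^sup>+l. ennreal s * indicator {0..c} l \<partial>lborel) = ennreal c * ennreal s"
    using c by (simp add: nn_integral_cmult mult.commute)
  finally show ?thesis .
qed

text \<open>The minimum is attained at the height \<open>c\<close> where the distribution function drops to \<open>s\<close>, since
  there both bounds are equalities.\<close>
lemma K_functional_attained:
  assumes [measurable]: "f \<in> borel_measurable M" and s: "0 < s" and fin: "K_functional f s < \<infinity>"
  obtains c where "0 \<le> c" "ennreal c * ennreal s + (\<integral>\<^sup>+x. f x - ennreal c \<partial>M) \<le> K_functional f s"
proof -
  let ?d = "\<lambda>l. distribution_function \<Omega> f (ennreal l)"
  define A where "A = {l. 0 \<le> l \<and> ?d l \<le> ennreal s}"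
  have "A \<noteq> {}"
  proof
    assume "A = {}"
    then have "min (?d l) (ennreal s) = ennreal s" if "0 \<le> l" for l
      using that by (auto simp: A_def min_def)
    then have "K_functional f s = (\<integral>\<^sup>+l. ennreal s * indicator {0::real..} l \<partial>lborel)"
      unfolding K_functional_def by (intro nn_integral_cong) (auto simp: indicator_def)
    also have "\<dots> = \<infinity>" using s by (simp add: nn_integral_cmult ennreal_mult_eq_top_iff emeasure_lborel_half_line)
    finally show False using fin by simp
  qed
  have bdd: "bdd_below A" by (auto simp: A_def bdd_below_def)
  define c where "c = Inf A"
  have c0: "0 \<le> c" unfolding c_def by (rule cInf_greatest[OF \<open>A \<noteq> {}\<close>]) (simp add: A_def)
  have below: "ennreal s < ?d l" if "0 \<le> l" "l < c" for l
    using cInf_lower[OF _ bdd, of l] that by (force simp: c_def A_def not_le[symmetric])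
  have above: "?d l \<le> ennreal s" if cl: "c < l" for l
  proof -
    obtain l' where "l' \<in> A" "l' < l" using cInf_lessD[OF \<open>A \<noteq> {}\<close>, of l] cl by (auto simp: c_def)
    then show ?thesis
      using distribution_function_antimono[OF assms(1), of "ennreal l'" "ennreal l"]
      by (auto simp: A_def ennreal_leI intro: order_trans)
  qed
  have "ennreal c * ennreal s + (\<integral>\<^sup>+x. f x - ennreal c \<partial>M)
     = (\<integral>\<^sup>+l. ennreal s * indicator {0..c} l \<partial>lborel) + (\<integral>\<^sup>+l\<in>{c..}. ?d l \<partial>lborel)"
    using c0 by (simp add: layer_cake_shift nn_integral_cmult mult.commute)
  also have "\<dots> = (\<integral>\<^sup>+l. ennreal s * indicator {0..c} l + ?d l * indicator {c..} l \<partial>lborel)"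
    by (rule nn_integral_add[symmetric]; measurable)
  also have "\<dots> \<le> K_functional f s"
    unfolding K_functional_def
  proof (rule nn_integral_mono_AE)
    show "AE l in lborel. ennreal s * indicator {0..c} l + ?d l * indicator {c..} l \<le> min (?d l) (ennreal s) * indicator {0..} l"
      using AE_lborel_singleton[of c]
    proof eventually_elim
      case (elim l)
      then consider "l < 0" | "0 \<le> l" "l < c" | "c < l" by linarith
      then show ?case
      proof cases
        case 2
        then show ?thesis using min_absorb2[OF less_imp_le[OF below[OF 2]]] by simp
      next
        case 3
        then show ?thesis using above[OF 3] c0 by simp
      qed (use c0 in auto)
    qed
  qed
  finally show thesis using that c0 by blast
qed

lemma K_functional_mono:
  assumes [measurable]: "f \<in> borel_measurable M" "g \<in> borel_measurable M" and le: "AE x in M. f x \<le> g x"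
  shows "K_functional f s \<le> K_functional g s"
proof -
  have "distribution_function \<Omega> f l \<le> distribution_function \<Omega> g l" for l
    unfolding distribution_function_eq_nn_integral[OF assms(1)] distribution_function_eq_nn_integral[OF assms(2)]
    by (rule nn_integral_mono_AE) (use le in eventually_elim, auto)
  then show ?thesis unfolding K_functional_def by (intro nn_integral_mono mult_right_mono min.mono) auto
qed

text \<open>The excess of \<open>f + g\<close> over \<open>c + d\<close> is at most the excess of \<open>f\<close> over \<open>c\<close> plus that of \<open>g\<close> over
  \<open>d\<close>; take \<open>c\<close> and \<open>d\<close> optimal for \<open>f\<close> and for \<open>g\<close>.\<close>
lemma K_functional_triangle:
  assumes [measurable]: "f \<in> borel_measurable M" "g \<in> borel_measurable M" and s: "0 < s"
  shows "K_functional (\<lambda>x. f x + g x) s \<le> K_functional f s + K_functional g s"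
proof (cases "K_functional f s < \<infinity> \<and> K_functional g s < \<infinity>")
  case True
  obtain c where c: "0 \<le> c" "ennreal c * ennreal s + (\<integral>\<^sup>+x. f x - ennreal c \<partial>M) \<le> K_functional f s"
    using K_functional_attained[OF assms(1) s] True by blast
  obtain d where d: "0 \<le> d" "ennreal d * ennreal s + (\<integral>\<^sup>+x. g x - ennreal d \<partial>M) \<le> K_functional g s"
    using K_functional_attained[OF assms(2) s] True by blast
  have sub: "y + z - ennreal (c + d) \<le> (y - ennreal c) + (z - ennreal d)" for y z
  proof -
    have real: "ennreal (p + q) \<le> ennreal p + ennreal q" for p q :: real
    proof -
      have "ennreal (p + q) \<le> ennreal (max 0 p + max 0 q)" by (intro ennreal_leI) auto
      also have "\<dots> = ennreal p + ennreal q" by (simp add: ennreal_max_0)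
      finally show ?thesis .
    qed
    show ?thesis
    proof (cases "y = top \<or> z = top")
      case True
      then show ?thesis by auto
    next
      case False
      then obtain p q where "y = ennreal p" "0 \<le> p" "z = ennreal q" "0 \<le> q"
        by (metis ennreal_cases)
      then show ?thesis
        using real[of "p - c" "q - d"] c(1) d(1)
        by (simp add: ennreal_minus ennreal_plus[symmetric] add_diff_add del: ennreal_plus)
    qed
  qed
  have "K_functional (\<lambda>x. f x + g x) s \<le> ennreal (c + d) * ennreal s + (\<integral>\<^sup>+x. f x + g x - ennreal (c + d) \<partial>M)"
    using c d by (intro K_functional_le) auto
  also have "\<dots> \<le> ennreal (c + d) * ennreal s + (\<integral>\<^sup>+x. (f x - ennreal c) + (g x - ennreal d) \<partial>M)"
    by (intro add_left_mono nn_integral_mono sub)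
  also have "\<dots> = (ennreal c * ennreal s + (\<integral>\<^sup>+x. f x - ennreal c \<partial>M)) + (ennreal d * ennreal s + (\<integral>\<^sup>+x. g x - ennreal d \<partial>M))"
    using c d by (subst nn_integral_add) (auto simp: distrib_right add_ac)
  also have "\<dots> \<le> K_functional f s + K_functional g s" by (intro add_mono c d)
  finally show ?thesis .
next
  case False
  then have top: "K_functional f s + K_functional g s = top" by (auto simp: not_less top_unique)
  show ?thesis unfolding top by simp
qed

lemma K_functional_cmult:
  assumes [measurable]: "f \<in> borel_measurable M" and c: "0 \<le> c"
  shows "K_functional (\<lambda>x. ennreal c * f x) s = ennreal c * K_functional f s"
proof (cases "c = 0")
  case True
  then show ?thesis by (simp add: K_functional_def distribution_function_def)
next
  case False
  then have c0: "c > 0" using c by simp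
  have eq: "distribution_function \<Omega> (\<lambda>x. ennreal c * f x) (ennreal (c * l)) = distribution_function \<Omega> f (ennreal l)"
    if "0 \<le> l" for l
  proof -
    have "ennreal (c * l) < ennreal c * y \<longleftrightarrow> ennreal l < y" for y
      using that c0 by (cases y) (auto simp: ennreal_mult[symmetric] ennreal_less_iff ennreal_mult_top ennreal_less_top)
    then show ?thesis by (simp add: distribution_function_def)
  qed
  have m [measurable]: "(\<lambda>x. ennreal c * f x) \<in> borel_measurable M" by measurable
  have "K_functional (\<lambda>x. ennreal c * f x) s = ennreal \<bar>c\<bar> *
     (\<integral>\<^sup>+l. min (distribution_function \<Omega> (\<lambda>x. ennreal c * f x) (ennreal (0 + c * l))) (ennreal s) * indicator {0..} (0 + c * l) \<partial>lborel)"
    unfolding K_functional_def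
    by (rule nn_integral_real_affine) (use c0 distribution_function_measurable[OF m] in auto)
  also have "\<dots> = ennreal c * K_functional f s"
  proof -
    have "min (distribution_function \<Omega> (\<lambda>x. ennreal c * f x) (ennreal (0 + c * l))) (ennreal s) * indicator {0..} (0 + c * l)
        = min (distribution_function \<Omega> f (ennreal l)) (ennreal s) * indicator {0..} l" for l
      using eq[of l] c0 by (cases "0 \<le> l") (auto simp: zero_le_mult_iff)
    then show ?thesis unfolding K_functional_def using c0 by simp
  qed
  finally show ?thesis .
qed

lemma K_functional_SUP:
  assumes meas [measurable]: "\<And>k::nat. F k \<in> borel_measurable M" "f \<in> borel_measurable M"
    and lim: "AE x in M. incseq (\<lambda>k. F k x) \<and> (\<lambda>k. F k x) \<longlonglongrightarrow> f x"
  shows "incseq (\<lambda>k. K_functional (F k) s)" "K_functional f s = (SUP k. K_functional (F k) s)"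
proof -
  let ?d = "\<lambda>k l. distribution_function \<Omega> (F k) (ennreal l)"
  have mono: "AE x in M. F k x \<le> F k' x" if "k \<le> k'" for k k'
    using lim by eventually_elim (use that in \<open>auto simp: incseq_def\<close>)
  have dmono: "?d k l \<le> ?d k' l" if "k \<le> k'" for k k' l
    unfolding distribution_function_eq_nn_integral[OF meas(1)]
    by (rule nn_integral_mono_AE) (use mono[OF that] in eventually_elim, auto)
  have dSUP: "distribution_function \<Omega> f l = (SUP k. distribution_function \<Omega> (F k) l)" for l
  proof -
    have "distribution_function \<Omega> f l = (\<integral>\<^sup>+x. (SUP k. if l < F k x then 1 else 0) \<partial>M)"
      unfolding distribution_function_eq_nn_integral[OF meas(2)]
    proof (rule nn_integral_cong_AE)
      show "AE x in M. (if l < f x then 1 else 0 :: ennreal) = (SUP k. if l < F k x then 1 else 0)"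
        using lim
      proof eventually_elim
        case (elim x)
        then have "f x = (SUP k. F k x)" using LIMSEQ_SUP[of "\<lambda>k. F k x"] LIMSEQ_unique by blast
        then have *: "l < f x \<longleftrightarrow> (\<exists>k. l < F k x)" by (simp add: less_SUP_iff)
        show ?case
        proof (cases "l < f x")
          case True
          then obtain k where "l < F k x" using * by blast
          then have "1 \<le> (SUP k. if l < F k x then 1 else 0 :: ennreal)" by (intro SUP_upper2[of k]) auto
          moreover have "(SUP k. if l < F k x then 1 else 0 :: ennreal) \<le> 1" by (intro SUP_least) auto
          ultimately show ?thesis using True by simp
        next
          case False
          then show ?thesis using * by simp
        qed
      qed
    qed
    also have "\<dots> = (SUP k. \<integral>\<^sup>+x. (if l < F k x then 1 else 0) \<partial>M)"
    proof (rule nn_integral_monotone_convergence_SUP_AE)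
      show "AE x in M. (if l < F k x then 1 else 0 :: ennreal) \<le> (if l < F (Suc k) x then 1 else 0)" for k
        using mono[of k "Suc k", simplified] by eventually_elim auto
    qed measurable
    finally show ?thesis unfolding distribution_function_eq_nn_integral[OF meas(1)] .
  qed
  show "incseq (\<lambda>k. K_functional (F k) s)"
    unfolding incseq_def K_functional_def by (intro allI impI nn_integral_mono mult_right_mono min.mono dmono) auto
  have "K_functional f s = (\<integral>\<^sup>+l. (SUP k. min (?d k l) (ennreal s) * indicator {0..} l) \<partial>lborel)"
    unfolding K_functional_def dSUP
    by (intro nn_integral_cong) (simp add: inf_min[symmetric] SUP_inf indicator_def)
  also have "\<dots> = (SUP k. K_functional (F k) s)"
    unfolding K_functional_def
    by (rule nn_integral_monotone_convergence_SUP)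
       (use distribution_function_measurable[OF meas(1)] in
         \<open>auto simp: incseq_def le_fun_def intro!: mult_right_mono min.mono dmono\<close>)
  finally show "K_functional f s = (SUP k. K_functional (F k) s)" .
qed

lemma K_functional_indicator:
  assumes "E \<in> sets M"
  shows "K_functional (indicator E) s = min (emeasure M E) (ennreal s)"
proof -
  have "K_functional (indicator E) s = (\<integral>\<^sup>+l. min (emeasure M E) (ennreal s) * indicator {0..<1::real} l \<partial>lborel)"
    unfolding K_functional_def using assms
    by (intro nn_integral_cong)
       (auto simp: distribution_function_indicator[OF sets_M_subset] indicator_def)
  then show ?thesis by (simp add: nn_integral_cmult)
qed

lemma K_functional_V:
  assumes [measurable]: "f \<in> borel_measurable M"
  shows "K_functional f V = (\<integral>\<^sup>+x. f x \<partial>M)"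
  unfolding layer_cake[OF assms] K_functional_def
  by (intro nn_integral_cong) (simp add: min_def distribution_function_def emeasure_M_le)

text \<open>The Hardy-Littlewood inequality for the indicator of \<open>E\<close>.\<close>
lemma set_integral_le_K_functional:
  assumes [measurable]: "f \<in> borel_measurable M" "E \<in> sets M" and E: "emeasure M E \<le> ennreal s"
  shows "(\<integral>\<^sup>+x\<in>E. f x \<partial>M) \<le> K_functional f s"
proof -
  have m: "(\<lambda>x. f x * indicator E x) \<in> borel_measurable M" by measurable
  have "distribution_function \<Omega> (\<lambda>x. f x * indicator E x) l \<le> min (distribution_function \<Omega> f l) (ennreal s)" for l
  proof -
    have "distribution_function \<Omega> (\<lambda>x. f x * indicator E x) l \<le> distribution_function \<Omega> f l"
      unfolding distribution_function_def using superlevel_sets[OF assms(1)] by (intro emeasure_mono) (auto simp: indicator_def split: if_splits)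
    moreover have "distribution_function \<Omega> (\<lambda>x. f x * indicator E x) l \<le> emeasure M E"
      unfolding distribution_function_def by (intro emeasure_mono) (auto simp: indicator_def split: if_splits)
    ultimately show ?thesis using E by auto
  qed
  then show ?thesis
    unfolding layer_cake[OF m] K_functional_def by (intro nn_integral_mono mult_right_mono) auto
qed

lemma K_functional_cong_distribution:
  "distribution_function \<Omega> f = distribution_function \<Omega> g \<Longrightarrow> K_functional f s = K_functional g s"
  by (simp add: K_functional_def)

section \<open>Dyadic Lorentz norms\<close>

text \<open>The Lorentz norm with fundamental function \<open>s \<mapsto> \<Sum>j. w j * min s (t j)\<close>.  A positive combination
  of such truncations is concave, and the properties of an r.i. norm pass from the single
  \<open>K\<close>-functionals to the sum.\<close>
definition dyadic_norm :: "(nat \<Rightarrow> ennreal) \<Rightarrow> ((real^'n) \<Rightarrow> ennreal) \<Rightarrow> ennreal" where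
  "dyadic_norm w f = (\<Sum>j. w j * K_functional f (t j))"

lemma integral_le_dyadic_norm:
  assumes "f \<in> borel_measurable M"
  shows "w 0 * (\<integral>\<^sup>+x. f x \<partial>M) \<le> dyadic_norm w f"
proof -
  have "w 0 * (\<integral>\<^sup>+x. f x \<partial>M) = (\<Sum>j<1. w j * K_functional f (t j))"
    by (simp add: t_0 K_functional_V[OF assms])
  also have "\<dots> \<le> dyadic_norm w f"
    unfolding dyadic_norm_def by (intro sum_le_suminf summableI) auto
  finally show ?thesis .
qed

lemma ri_norm_dyadic_norm:
  assumes w0: "0 < w 0" and fin: "(\<Sum>j. w j * ennreal (t j)) < \<infinity>"
  shows "ri_norm \<Omega> (dyadic_norm w)"
proof
  fix f g :: "real^'n \<Rightarrow> ennreal"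
  assume [measurable]: "f \<in> borel_measurable M" "g \<in> borel_measurable M"
  show "dyadic_norm w (\<lambda>x. f x + g x) \<le> dyadic_norm w f + dyadic_norm w g"
    unfolding dyadic_norm_def suminf_add[OF summableI summableI] distrib_left[symmetric]
    by (intro suminf_le summableI mult_left_mono K_functional_triangle t_pos) auto
next
  fix f :: "real^'n \<Rightarrow> ennreal" and c :: real
  assume [measurable]: "f \<in> borel_measurable M" and "0 \<le> c"
  then show "dyadic_norm w (\<lambda>x. ennreal c * f x) = ennreal c * dyadic_norm w f"
    by (simp add: dyadic_norm_def K_functional_cmult mult.left_commute)
next
  fix f :: "real^'n \<Rightarrow> ennreal"
  assume [measurable]: "f \<in> borel_measurable M" and "dyadic_norm w f = 0"
  then have "w 0 * (\<integral>\<^sup>+x. f x \<partial>M) = 0"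
    using integral_le_dyadic_norm[of f w] by simp
  then have "(\<integral>\<^sup>+x. f x \<partial>M) = 0" using w0 by auto
  then show "AE x in M. f x = 0" by (simp add: nn_integral_0_iff_AE)
next
  fix f g :: "real^'n \<Rightarrow> ennreal"
  assume "f \<in> borel_measurable M" "g \<in> borel_measurable M" "AE x in M. f x \<le> g x"
  then show "dyadic_norm w f \<le> dyadic_norm w g"
    unfolding dyadic_norm_def by (intro suminf_le summableI mult_left_mono K_functional_mono) auto
next
  fix F :: "nat \<Rightarrow> real^'n \<Rightarrow> ennreal" and f
  assume F: "\<And>k. F k \<in> borel_measurable M" "f \<in> borel_measurable M"
    "AE x in M. incseq (\<lambda>k. F k x) \<and> (\<lambda>k. F k x) \<longlonglongrightarrow> f x"
  have inc: "incseq (\<lambda>k. w j * K_functional (F k) (t j))" for j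
    using K_functional_SUP(1)[OF F, of "t j"] by (auto simp: incseq_def intro!: mult_left_mono)
  have "dyadic_norm w f = (\<Sum>j. SUP k. w j * K_functional (F k) (t j))"
    unfolding dyadic_norm_def K_functional_SUP(2)[OF F] by (simp add: SUP_mult_left_ennreal)
  also have "\<dots> = (SUP k. dyadic_norm w (F k))"
    unfolding dyadic_norm_def by (rule ennreal_suminf_SUP_eq[OF inc])
  finally have S: "dyadic_norm w f = (SUP k. dyadic_norm w (F k))" .
  have "incseq (\<lambda>k. dyadic_norm w (F k))"
    using inc unfolding dyadic_norm_def incseq_def by (auto intro!: suminf_le summableI)
  then show "incseq (\<lambda>k. dyadic_norm w (F k)) \<and> (\<lambda>k. dyadic_norm w (F k)) \<longlonglongrightarrow> dyadic_norm w f"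
    unfolding S by (simp add: LIMSEQ_SUP)
next
  fix E assume "E \<in> sets M"
  then have "dyadic_norm w (indicator E) \<le> (\<Sum>j. w j * ennreal (t j))"
    unfolding dyadic_norm_def by (intro suminf_le summableI mult_left_mono) (auto simp: K_functional_indicator)
  then show "dyadic_norm w (indicator E) < \<infinity>" using fin by (rule le_less_trans)
next
  fix E assume E [measurable]: "E \<in> sets M"
  have wfin: "w 0 \<noteq> \<infinity>"
  proof
    assume "w 0 = \<infinity>"
    then have "w 0 * ennreal (t 0) = \<infinity>" using t_pos[of 0] by (simp add: ennreal_top_mult)
    moreover have "(\<Sum>j<1. w j * ennreal (t j)) \<le> (\<Sum>j. w j * ennreal (t j))"
      by (intro sum_le_suminf summableI) auto
    ultimately show False using fin by (simp add: top_unique)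
  qed
  define c where "c = enn2real (w 0)"
  have c: "w 0 = ennreal c" "c > 0"
    using w0 wfin by (auto simp: c_def enn2real_positive_iff less_top)
  show "\<exists>C>0. \<forall>f\<in>borel_measurable M. (\<integral>\<^sup>+x\<in>E. f x \<partial>M) \<le> ennreal C * dyadic_norm w f"
  proof (intro exI[of _ "1 / c"] conjI ballI)
    fix f :: "real^'n \<Rightarrow> ennreal" assume [measurable]: "f \<in> borel_measurable M"
    have "(\<integral>\<^sup>+x\<in>E. f x \<partial>M) \<le> (\<integral>\<^sup>+x. f x \<partial>M)"
      by (intro nn_integral_mono) (auto simp: indicator_def)
    also have "\<dots> = ennreal (1 / c) * (w 0 * (\<integral>\<^sup>+x. f x \<partial>M))"
      unfolding mult.assoc[symmetric] c(1) using c(2) by (simp add: ennreal_mult[symmetric])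
    also have "\<dots> \<le> ennreal (1 / c) * dyadic_norm w f"
      by (intro mult_left_mono integral_le_dyadic_norm) auto
    finally show "(\<integral>\<^sup>+x\<in>E. f x \<partial>M) \<le> ennreal (1 / c) * dyadic_norm w f" .
  qed (use c in simp)
next
  fix f g :: "real^'n \<Rightarrow> ennreal"
  assume "f \<in> borel_measurable M" "g \<in> borel_measurable M"
    "decreasing_rearrangement \<Omega> f = decreasing_rearrangement \<Omega> g"
  then have "K_functional f s = K_functional g s" for s
    by (intro K_functional_cong_distribution distribution_function_eqI)
  then show "dyadic_norm w f = dyadic_norm w g"
    unfolding dyadic_norm_def by simp
qed

end

section \<open>The first-order domain norm\<close>

lemma telescoping_ennreal:
  fixes L :: "nat \<Rightarrow> ennreal"
  assumes "incseq L" "L 0 = 0"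
  shows "(\<Sum>j<k. L (Suc j) - L j) = L k"
proof (induction k)
  case (Suc k)
  then show ?case using assms(1) by (simp add: add_diff_inverse_ennreal incseq_SucD)
qed (simp add: assms(2))

lemma ennreal_two_power: "ennreal (2 ^ i) = 2 ^ i"
  by (induction i) (auto simp: ennreal_mult)

context bounded_measurable_set
begin

text \<open>
  Halving a volume multiplies lengths by \<open>q\<close>.  Hence \<open>t i powr (1/n - 1)\<close> is a constant multiple
  of \<open>(2 * q) ^ i\<close>, and \<open>t i powr (-1/n)\<close> one of \<open>(1 / q) ^ i\<close>.\<close>
definition q :: real where "q = 1 / root CARD('n) 2"

lemma q_pos: "0 < q" by (simp add: q_def)

lemma q_less_1: "q < 1"
  by (simp add: q_def real_root_gt_1_iff)

lemma root_dyadic: "root CARD('n) (1 / 2 ^ k) = q ^ k"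
  by (simp add: q_def real_root_divide real_root_power power_one_over)

lemma two_q_ge_1: "1 \<le> 2 * q"
proof -
  have "root CARD('n) 2 \<le> 2"
    using real_root_decreasing[of 1 "CARD('n)" 2] by (simp add: Suc_leI)
  then show ?thesis by (simp add: q_def)
qed

text \<open>Turns the factor produced by the isoperimetric estimate, which is decreasing in \<open>e\<close>, into a
  geometric sequence.\<close>
lemma root_over_id_le:
  assumes "t (Suc j) \<le> e"
  shows "root CARD('n) e / e \<le> root CARD('n) (t 1) / t 1 * (2 * q) ^ j"
proof -
  define N where "N = CARD('n)"
  have N: "N = Suc (N - 1)" "0 < N" by (simp_all add: N_def)
  have eq: "t (Suc j) = t 1 * (1 / 2 ^ j)" by (simp add: t_def)
  have root_eq: "root N (t (Suc j)) = root N (t 1) * q ^ j"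
    unfolding eq real_root_mult N_def root_dyadic ..
  define a where "a = root N (t (Suc j))"
  define b where "b = root N e"
  have e: "0 < e" using assms t_pos[of "Suc j"] by linarith
  have a: "0 < a" "a ^ N = t (Suc j)" using t_pos[of "Suc j"] N by (auto simp: a_def)
  have b: "a \<le> b" "b ^ N = e" using assms e N by (auto simp: a_def b_def)
  have "b * a ^ N \<le> a * b ^ N"
  proof -
    have "a ^ (N - 1) \<le> b ^ (N - 1)" using a b by (intro power_mono) auto
    then have "(a * b) * a ^ (N - 1) \<le> (a * b) * b ^ (N - 1)" using a b by (intro mult_left_mono) auto
    then show ?thesis
      unfolding power_minus_mult[OF N(2), of a, symmetric] power_minus_mult[OF N(2), of b, symmetric]
      by (simp add: mult_ac)
  qed
  then have "b / e \<le> a / t (Suc j)"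
    using e t_pos[of "Suc j"] a(2) b(2) by (simp add: divide_simps mult.commute)
  also have "\<dots> = root N (t 1) * q ^ j / (t 1 * (1 / 2 ^ j))"
    unfolding a_def root_eq unfolding eq ..
  also have "\<dots> = root N (t 1) / t 1 * (2 * q) ^ j"
    by (simp add: power_mult_distrib)
  finally show ?thesis by (simp add: N_def b_def)
qed

end

context ri_norm_on
begin

text \<open>Up to a constant, \<open>a powr (1/n - 1) * \<phi>(a)\<close> at \<open>a = t i\<close>.\<close>
definition level_coeff :: "nat \<Rightarrow> ennreal" where
  "level_coeff i = ennreal ((2 * q) ^ i) * ff (t i)"

text \<open>The decreasing majorant of \<open>a powr (1/n - 1) * \<phi>(a)\<close>; larger indices are smaller values of \<open>a\<close>.\<close>
definition level_max :: "nat \<Rightarrow> ennreal" where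
  "level_max j = Max (level_coeff ` {..j})"

text \<open>The increments of \<open>level_max\<close>, so that summation by parts turns \<open>level_max\<close> into a positive
  combination of truncations.\<close>
definition weight :: "nat \<Rightarrow> ennreal" where
  "weight j = (case j of 0 \<Rightarrow> level_max 0 | Suc k \<Rightarrow> level_max (Suc k) - level_max k)"

definition sobolev_domain :: "((real^'n) \<Rightarrow> ennreal) \<Rightarrow> ennreal" where
  "sobolev_domain = dyadic_norm weight"

lemma level_coeff_le_max: "i \<le> j \<Longrightarrow> level_coeff i \<le> level_max j"
  unfolding level_max_def by (intro Max_ge) auto

lemma level_max_mono: "j \<le> k \<Longrightarrow> level_max j \<le> level_max k"
  unfolding level_max_def by (intro Max_mono) auto

lemma level_max_le_iff: "level_max j \<le> y \<longleftrightarrow> (\<forall>i\<le>j. level_coeff i \<le> y)"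
  unfolding level_max_def by (subst Max_le_iff) auto

lemma level_max_finite: "level_max j < \<infinity>"
  unfolding level_max_def using ff_finite[of "t _"] t_pos
  by (subst Max_less_iff) (auto simp: level_coeff_def ennreal_mult_less_top less_imp_le)

lemma level_max_pos: "0 < level_max j"
proof -
  have "0 < level_coeff 0" using ff_pos[OF t_pos[of 0]] by (simp add: level_coeff_def)
  also have "\<dots> \<le> level_max j" by (rule level_coeff_le_max) simp
  finally show ?thesis .
qed

lemma sum_weight: "(\<Sum>i\<le>j. weight i) = level_max j"
proof (induction j)
  case 0
  then show ?case by (simp add: weight_def)
next
  case (Suc j)
  then show ?case using level_max_mono[of j "Suc j"] by (simp add: weight_def add_diff_inverse_ennreal)
qed

lemma weight_le: "weight j \<le> level_max j"
  by (auto simp: weight_def split: nat.split intro: diff_le_self_ennreal)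

text \<open>Since \<open>\<phi>\<close> is increasing, only the power of \<open>a\<close> can make the majorant grow.\<close>
lemma level_max_growth: "level_max (k + i) \<le> ennreal ((2 * q) ^ i) * level_max k"
  unfolding level_max_le_iff
proof (intro allI impI)
  fix j assume j: "j \<le> k + i"
  show "level_coeff j \<le> ennreal ((2 * q) ^ i) * level_max k"
  proof (cases "j \<le> k")
    case True
    have "1 * level_coeff j \<le> ennreal ((2 * q) ^ i) * level_max k"
      using True one_le_power[OF two_q_ge_1, of i]
      by (intro mult_mono level_coeff_le_max) (auto simp: power_mult_distrib)
    then show ?thesis by simp
  next
    case False
    then have jk: "j - k \<le> i" using j by auto
    have pow: "(2 * q) ^ j = (2 * q) ^ (j - k) * (2 * q) ^ k"
      using power_add[of "2 * q" "j - k" k] False by simp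
    have "ff (t j) \<le> ff (t k)"
    proof (rule ff_mono)
      show "t j \<le> t k" using False \<Omega>_pos by (simp add: t_def frac_le)
    qed (use t_pos[of j] in simp)
    then have "level_coeff j \<le> ennreal ((2 * q) ^ j) * ff (t k)"
      unfolding level_coeff_def by (intro mult_left_mono) auto
    also have "\<dots> = ennreal ((2 * q) ^ (j - k)) * level_coeff k"
      unfolding level_coeff_def mult.assoc[symmetric] pow using q_pos
      by (subst ennreal_mult) auto
    also have "\<dots> \<le> ennreal ((2 * q) ^ i) * level_max k"
      using two_q_ge_1 jk by (intro mult_mono level_coeff_le_max ennreal_leI power_increasing) auto
    finally show ?thesis .
  qed
qed

definition geom_const :: real where "geom_const = 1 + 1 / (1 - q)"

lemma geom_const_pos: "0 < geom_const" using q_less_1 by (simp add: geom_const_def add_pos_pos)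

text \<open>Indices up to \<open>k\<close> telescope to \<open>level_max k\<close>.  Beyond \<open>k\<close> the growth \<open>(2 * q) ^ i\<close> of the
  weights is beaten by the decay \<open>1 / 2 ^ i\<close> of \<open>t\<close>, leaving a geometric series in \<open>q\<close>.\<close>
lemma weighted_sum_bound:
  "(\<Sum>j. weight j * min (ennreal (t k)) (ennreal (t j))) \<le> ennreal geom_const * (level_max k * ennreal (t k))"
proof -
  let ?f = "\<lambda>j. weight j * min (ennreal (t k)) (ennreal (t j))"
  have "(\<Sum>j. ?f j) = (\<Sum>j. ?f (j + Suc k)) + (\<Sum>j<Suc k. ?f j)"
    by (rule suminf_offset) (rule summableI)
  also have "(\<Sum>j<Suc k. ?f j) \<le> (\<Sum>j<Suc k. weight j * ennreal (t k))"
    by (intro sum_mono mult_left_mono) auto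
  also have "\<dots> = level_max k * ennreal (t k)"
    unfolding sum_distrib_right[symmetric] lessThan_Suc_atMost sum_weight ..
  also have "(\<Sum>j. ?f (j + Suc k)) \<le> (\<Sum>j. (level_max k * ennreal (t k)) * ennreal (q ^ j))"
  proof (intro suminf_le summableI)
    fix j
    have "?f (j + Suc k) \<le> level_max (k + Suc j) * ennreal (t (j + Suc k))"
      using weight_le[of "j + Suc k"] by (intro mult_mono) (auto simp: add.commute)
    also have "\<dots> \<le> (ennreal ((2 * q) ^ Suc j) * level_max k) * ennreal (t (j + Suc k))"
      by (intro mult_right_mono level_max_growth) auto
    also have "\<dots> = level_max k * (ennreal ((2 * q) ^ Suc j) * ennreal (t (j + Suc k)))"
      by (simp only: mult_ac)
    also have "ennreal ((2 * q) ^ Suc j) * ennreal (t (j + Suc k)) = ennreal (t k) * ennreal (q ^ Suc j)"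
    proof -
      have "(2 * q) ^ Suc j * t (j + Suc k) = t k * q ^ Suc j"
        by (simp add: t_def power_mult_distrib power_add)
      then show ?thesis using q_pos t_pos by (simp add: ennreal_mult[symmetric] less_imp_le del: power_Suc)
    qed
    also have "level_max k * (ennreal (t k) * ennreal (q ^ Suc j)) \<le> level_max k * (ennreal (t k) * ennreal (q ^ j))"
      using q_pos q_less_1 by (intro mult_left_mono ennreal_leI power_decreasing) auto
    finally show "?f (j + Suc k) \<le> (level_max k * ennreal (t k)) * ennreal (q ^ j)"
      by (simp only: mult_ac)
  qed
  also have "\<dots> = (level_max k * ennreal (t k)) * ennreal (1 / (1 - q))"
  proof -
    have "(\<Sum>j. ennreal (q ^ j)) = ennreal (\<Sum>j. q ^ j)"
      using q_pos q_less_1 by (intro suminf_ennreal2 summable_geometric) auto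
    then show ?thesis using q_pos q_less_1 by (simp add: suminf_geometric)
  qed
  finally have "(\<Sum>j. ?f j) \<le> (level_max k * ennreal (t k)) * ennreal (1 / (1 - q)) + level_max k * ennreal (t k)"
    by (simp add: add_mono)
  also have "\<dots> = ennreal geom_const * (level_max k * ennreal (t k))"
    using q_less_1 by (simp add: geom_const_def distrib_right add.commute mult.commute)
  finally show ?thesis .
qed

lemma ri_norm_sobolev_domain: "ri_norm \<Omega> sobolev_domain"
  unfolding sobolev_domain_def
proof (rule ri_norm_dyadic_norm)
  show "0 < weight 0" using level_max_pos[of 0] by (simp add: weight_def)
  have "min (ennreal (t 0)) (ennreal (t j)) = ennreal (t j)" for j
    using t_le_V[of j] by (simp add: t_0 min_absorb2 ennreal_leI)
  then have "(\<Sum>j. weight j * ennreal (t j)) \<le> ennreal geom_const * (level_max 0 * ennreal (t 0))"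
    using weighted_sum_bound[of 0] by simp
  also have "\<dots> < \<infinity>" using level_max_finite[of 0] by (simp add: ennreal_mult_less_top)
  finally show "(\<Sum>j. weight j * ennreal (t j)) < \<infinity>" .
qed

text \<open>One application of the construction gains a factor \<open>q ^ i\<close>.  The monotonicity of \<open>2 ^ i * \<Theta> i\<close>
  says that \<open>\<Theta>\<close> is, like a fundamental function, almost decreasing when divided by its argument; it
  absorbs the maximum in \<open>level_max\<close>.\<close>
lemma sobolev_domain_fundamental_function_le:
  assumes bound: "\<And>i. ff (t i) \<le> ennreal ((1 / q) ^ i) * \<Theta> i"
    and mono: "\<And>i k. i \<le> k \<Longrightarrow> 2 ^ i * \<Theta> i \<le> 2 ^ k * \<Theta> k"
  shows "fundamental_function \<Omega> sobolev_domain (t k) \<le> ennreal (geom_const * V) * \<Theta> k"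
proof -
  interpret Z: ri_norm_on \<Omega> sobolev_domain
    by (rule ri_norm_on.intro[OF bounded_measurable_set_axioms ri_norm_sobolev_domain])
  obtain E where E: "E \<in> sets M" "emeasure M E = min (ennreal (t k)) (ennreal V)" "Z.ff (t k) = sobolev_domain (indicator E)"
    using Z.obtain_set[of "t k"] t_pos[of k] by auto
  have Ek: "emeasure M E = ennreal (t k)"
    using E(2) t_le_V[of k] by (simp add: min_absorb1 ennreal_leI)
  have "level_max k \<le> 2 ^ k * \<Theta> k"
    unfolding level_max_le_iff
  proof (intro allI impI)
    fix i assume i: "i \<le> k"
    have "level_coeff i \<le> ennreal ((2 * q) ^ i) * (ennreal ((1 / q) ^ i) * \<Theta> i)"
      unfolding level_coeff_def by (intro mult_left_mono bound) auto
    also have "\<dots> = ennreal ((2 * q) ^ i * (1 / q) ^ i) * \<Theta> i"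
      using q_pos by (simp add: ennreal_mult mult.assoc)
    also have "(2 * q) ^ i * (1 / q) ^ i = 2 ^ i"
      unfolding power_mult_distrib[symmetric] using q_pos by simp
    also have "ennreal (2 ^ i) * \<Theta> i = 2 ^ i * \<Theta> i" unfolding ennreal_two_power ..
    also have "\<dots> \<le> 2 ^ k * \<Theta> k" by (rule mono[OF i])
    finally show "level_coeff i \<le> 2 ^ k * \<Theta> k" .
  qed
  have "Z.ff (t k) = (\<Sum>j. weight j * min (ennreal (t k)) (ennreal (t j)))"
    unfolding E(3) by (simp add: sobolev_domain_def dyadic_norm_def K_functional_indicator[OF E(1)] Ek min.commute)
  also have "\<dots> \<le> ennreal geom_const * (level_max k * ennreal (t k))" by (rule weighted_sum_bound)
  also have "\<dots> \<le> ennreal geom_const * ((2 ^ k * \<Theta> k) * ennreal (t k))"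
    by (intro mult_left_mono mult_right_mono) (use \<open>level_max k \<le> _\<close> in auto)
  also have "\<dots> = ennreal geom_const * (ennreal (2 ^ k) * ennreal (t k)) * \<Theta> k"
    unfolding ennreal_two_power by (simp only: mult_ac)
  also have "ennreal (2 ^ k) * ennreal (t k) = ennreal V"
    using t_pos[of k] by (simp add: ennreal_mult[symmetric] t_def)
  also have "ennreal geom_const * ennreal V * \<Theta> k = ennreal (geom_const * V) * \<Theta> k"
    using geom_const_pos \<Omega>_pos by (simp add: ennreal_mult)
  finally show ?thesis .
qed

lemma rho_finite_subadditive:
  assumes "finite S" "\<And>i. i \<in> S \<Longrightarrow> f i \<in> borel_measurable M"
  shows "\<rho> (\<lambda>x. \<Sum>i\<in>S. f i x) \<le> (\<Sum>i\<in>S. \<rho> (f i))"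
  using assms
proof (induction S rule: finite_induct)
  case empty
  then show ?case by (simp add: rho_zero)
next
  case (insert i S)
  have "\<rho> (\<lambda>x. f i x + (\<Sum>i\<in>S. f i x)) \<le> \<rho> (f i) + \<rho> (\<lambda>x. \<Sum>i\<in>S. f i x)"
    using insert by (intro P1_triangle borel_measurable_sum) auto
  also have "\<dots> \<le> \<rho> (f i) + (\<Sum>i\<in>S. \<rho> (f i))" using insert by (intro add_left_mono) auto
  finally show ?case using insert by simp
qed

section \<open>Slicing a function at its dyadic levels\<close>

text \<open>Almost every value of \<open>f\<close> lies below some \<open>L j\<close>, the measures \<open>t j\<close> tending to 0.  Hence \<open>f\<close> is
  dominated by a countable sum of multiples of the indicators of \<open>{f > L j}\<close>, to which countable
  subadditivity applies.\<close>
lemma layer_decomposition: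
  fixes L :: "nat \<Rightarrow> ennreal"
  assumes [measurable]: "f \<in> borel_measurable M"
    and L0: "L 0 = 0" and Lmono: "incseq L" and Lfin: "\<And>j. L j < \<infinity>"
    and small: "\<And>j. distribution_function \<Omega> f (L j) \<le> ennreal (t j)"
  shows "\<rho> f \<le> (\<Sum>j. (L (Suc j) - L j) * ff (t j))"
proof -
  define S where "S j = {x \<in> \<Omega>. f x > L j}" for j
  have S: "S j \<in> sets M" for j unfolding S_def by (rule superlevel_sets) measurable
  have eS: "emeasure M (S j) \<le> ennreal (t j)" for j
    using small[of j] by (simp add: distribution_function_def S_def)
  note tele = telescoping_ennreal[OF Lmono L0]
  have "AE x in M. x \<notin> (\<Inter>j. S j)"
  proof -
    have "emeasure M (\<Inter>j. S j) \<le> 0"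
    proof (rule LIMSEQ_le_const)
      show "(\<lambda>j. ennreal (t j)) \<longlonglongrightarrow> 0" using tendsto_ennrealI[OF t_tendsto_0] by simp
      show "\<exists>N. \<forall>j\<ge>N. emeasure M (\<Inter>j. S j) \<le> ennreal (t j)"
      proof (intro exI[of _ 0] allI impI)
        fix j
        have "emeasure M (\<Inter>j. S j) \<le> emeasure M (S j)" using S by (intro emeasure_mono) auto
        then show "emeasure M (\<Inter>j. S j) \<le> ennreal (t j)" using eS[of j] by (rule order_trans)
      qed
    qed
    then have "(\<Inter>j. S j) \<in> null_sets M" using S by (intro null_setsI) (auto simp: sets.countable_INT)
    then show ?thesis by (rule AE_not_in)
  qed
  then have "AE x in M. f x \<le> (\<Sum>j. (L (Suc j) - L j) * indicator (S j) x)"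
    using AE_space
  proof eventually_elim
    case (elim x)
    then have x: "x \<in> \<Omega>" by simp
    have ex: "\<exists>j. f x \<le> L j" using elim x by (auto simp: S_def not_less)
    define J where "J = (LEAST j. f x \<le> L j)"
    have J: "f x \<le> L J" unfolding J_def using ex by (rule LeastI_ex)
    have in_S: "x \<in> S j" if "j < J" for j
      using not_less_Least[of j "\<lambda>j. f x \<le> L j"] that x by (auto simp: J_def S_def)
    have "f x \<le> (\<Sum>j<J. (L (Suc j) - L j) * indicator (S j) x)"
      using J in_S by (simp add: tele)
    also have "\<dots> \<le> (\<Sum>j. (L (Suc j) - L j) * indicator (S j) x)"
      by (intro sum_le_suminf summableI) auto
    finally show ?case .
  qed
  then have "\<rho> f \<le> \<rho> (\<lambda>x. \<Sum>j. (L (Suc j) - L j) * indicator (S j) x)"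
    using S by (intro P2) auto
  also have "\<dots> \<le> (\<Sum>j. \<rho> (\<lambda>x. (L (Suc j) - L j) * indicator (S j) x))"
    using S by (intro rho_countable_subadditive) auto
  also have "\<dots> \<le> (\<Sum>j. (L (Suc j) - L j) * ff (t j))"
  proof (intro suminf_le summableI)
    fix j
    obtain c where c: "0 \<le> c" "L (Suc j) - L j = ennreal c"
      using Lfin[of "Suc j"] diff_le_self_ennreal[of "L (Suc j)" "L j"]
      by (cases "L (Suc j) - L j") (auto simp: top_unique)
    have "\<rho> (\<lambda>x. ennreal c * indicator (S j) x) = ennreal c * \<rho> (indicator (S j))"
      using S c by (intro P1_homogeneous) auto
    also have "\<dots> \<le> ennreal c * ff (t j)"
      using S eS t_pos[of j] by (intro mult_left_mono rho_indicator_le) auto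
    finally show "\<rho> (\<lambda>x. (L (Suc j) - L j) * indicator (S j) x) \<le> (L (Suc j) - L j) * ff (t j)"
      unfolding c(2) .
  qed
  finally show ?thesis .
qed

text \<open>Summation by parts: a point of slice \<open>j\<close> lies in \<open>{f > L i}\<close> for every \<open>i \<le> j\<close>, and the weights
  up to \<open>j\<close> add up to \<open>level_max j\<close>.  As the slices are disjoint nothing is counted twice, and
  Hardy-Littlewood bounds the integral of \<open>N\<close> over \<open>{f > L i}\<close>.\<close>
lemma weighted_slices_le_sobolev_domain:
  assumes f [measurable]: "f \<in> borel_measurable M" and N [measurable]: "N \<in> borel_measurable M"
    and Lmono: "incseq L" and small: "\<And>j. distribution_function \<Omega> f (L j) \<le> ennreal (t j)"
  shows "(\<Sum>j. level_max j * (\<integral>\<^sup>+x. N x * indicator {x. L j < f x \<and> f x < L (Suc j)} x \<partial>M))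
    \<le> sobolev_domain N"
proof -
  let ?S = "\<lambda>j. {x. L j < f x \<and> f x < L (Suc j)}"
  let ?T = "\<lambda>j. {x \<in> \<Omega>. L j < f x}"
  have sets: "?T j \<in> sets M" for j by (rule superlevel_sets[OF f])
  have [measurable]: "(\<lambda>x. N x * indicator (?S j) x) \<in> borel_measurable M" for j by measurable
  have "(\<Sum>j. level_max j * (\<integral>\<^sup>+x. N x * indicator (?S j) x \<partial>M))
     = (\<integral>\<^sup>+x. (\<Sum>j. level_max j * (N x * indicator (?S j) x)) \<partial>M)"
    by (simp add: nn_integral_suminf nn_integral_cmult)
  also have "\<dots> \<le> (\<integral>\<^sup>+x. (\<Sum>i. weight i * (N x * indicator (?T i) x)) \<partial>M)"
  proof (rule nn_integral_mono)
    fix x assume "x \<in> space M"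
    then have x: "x \<in> \<Omega>" by simp
    show "(\<Sum>j. level_max j * (N x * indicator (?S j) x)) \<le> (\<Sum>i. weight i * (N x * indicator (?T i) x))"
    proof (cases "\<exists>j. x \<in> ?S j")
      case False
      then have "(\<lambda>j. level_max j * (N x * indicator (?S j) x)) = (\<lambda>j. 0)" by auto
      then show ?thesis by simp
    next
      case True
      then obtain j where j: "L j < f x" "f x < L (Suc j)" by auto
      have uniq: "x \<notin> ?S i" if "i \<noteq> j" for i
      proof (cases "i < j")
        case True
        then have "L (Suc i) \<le> L j" using Lmono by (auto simp: incseq_def)
        then show ?thesis using j by auto
      next
        case False
        then have "L (Suc j) \<le> L i" using Lmono that by (auto simp: incseq_def)
        then show ?thesis using j by auto
      qed
      have "(\<Sum>i. level_max i * (N x * indicator (?S i) x)) = (\<Sum>i\<in>{j}. level_max i * (N x * indicator (?S i) x))"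
        using uniq by (intro suminf_finite) auto
      also have "\<dots> = level_max j * N x" using j by simp
      also have "\<dots> = (\<Sum>i\<le>j. weight i * (N x * indicator (?T i) x))"
      proof -
        have "L i < f x" if "i \<le> j" for i
          using Lmono j(1) that by (auto simp: incseq_def intro: le_less_trans)
        then show ?thesis using x by (simp add: sum_weight[symmetric] sum_distrib_right)
      qed
      also have "\<dots> \<le> (\<Sum>i. weight i * (N x * indicator (?T i) x))"
        by (intro sum_le_suminf summableI) auto
      finally show ?thesis .
    qed
  qed
  also have "\<dots> = (\<Sum>i. weight i * (\<integral>\<^sup>+x\<in>?T i. N x \<partial>M))"
    using sets by (simp add: nn_integral_suminf nn_integral_cmult)
  also have "\<dots> \<le> (\<Sum>i. weight i * K_functional N (t i))"
    using small sets by (intro suminf_le summableI mult_left_mono set_integral_le_K_functional N)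
      (auto simp: distribution_function_def)
  finally show ?thesis by (simp add: sobolev_domain_def dyadic_norm_def)
qed

end

section \<open>The first-order embedding\<close>

context ri_norm_on
begin

lemma nn_integral_M_eq_lborel:
  assumes "\<And>x. x \<notin> \<Omega> \<Longrightarrow> f x = 0"
  shows "(\<integral>\<^sup>+x. f x \<partial>M) = (\<integral>\<^sup>+x. f x \<partial>lborel)"
proof -
  have "(\<integral>\<^sup>+x. f x \<partial>M) = (\<integral>\<^sup>+x. f x * indicator \<Omega> x \<partial>lebesgue)"
    using \<Omega>_lebesgue by (subst nn_integral_restrict_space) auto
  also have "(\<lambda>x. f x * indicator \<Omega> x) = f" using assms by (auto simp: indicator_def)
  finally show ?thesis by (simp add: nn_integral_completion)
qed

text \<open>Chebyshev's inequality.\<close>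
lemma decreasing_rearrangement_mult_le_integral:
  assumes [measurable]: "f \<in> borel_measurable M" and s: "0 < s"
  shows "decreasing_rearrangement \<Omega> f (ennreal s) \<le> ennreal (1 / s) * (\<integral>\<^sup>+x. f x \<partial>M)"
  unfolding decreasing_rearrangement_le_iff[OF assms(1)]
proof -
  let ?l = "ennreal (1 / s) * (\<integral>\<^sup>+x. f x \<partial>M)"
  note S = superlevel_sets[OF assms(1)]
  have "?l * distribution_function \<Omega> f ?l = (\<integral>\<^sup>+x. ?l * indicator {x \<in> \<Omega>. f x > ?l} x \<partial>M)"
    using S by (simp add: nn_integral_cmult distribution_function_def)
  also have "\<dots> \<le> (\<integral>\<^sup>+x. f x \<partial>M)"
    by (intro nn_integral_mono) (auto simp: indicator_def)
  also have "\<dots> = ?l * ennreal s"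
  proof -
    have "?l * ennreal s = ennreal (1 / s * s) * (\<integral>\<^sup>+x. f x \<partial>M)"
      using s by (subst ennreal_mult) (auto simp: mult_ac)
    then show ?thesis using s by simp
  qed
  finally have le: "?l * distribution_function \<Omega> f ?l \<le> ?l * ennreal s" .
  show "distribution_function \<Omega> f ?l \<le> ennreal s"
  proof (cases "?l = 0")
    case True
    then have "(\<integral>\<^sup>+x. f x \<partial>M) = 0" using s by (simp add: ennreal_eq_0_iff)
    then have "AE x in M. \<not> f x > 0" by (simp add: nn_integral_0_iff_AE)
    from emeasure_eq_0_AE[OF this] show ?thesis unfolding True by (simp add: distribution_function_def)
  next
    case False
    show ?thesis
    proof (cases "?l = top")
      case True
      show ?thesis unfolding True by (simp add: distribution_function_def)
    next
      case fin: False
      show ?thesis using le False fin by (subst (asm) ennreal_mult_le_mult_iff) auto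
    qed
  qed
qed

text \<open>The function is cut at the levels \<open>L j\<close>, its rearrangement at \<open>t j\<close>.  For large \<open>j\<close> the set above
  the level is small enough for the isoperimetric estimate, which controls \<open>L (Suc j) - L j\<close> by the
  gradient in the slice.  The finitely many remaining levels only see the height \<open>L J\<close>, which
  Chebyshev's inequality bounds by the \<open>L\<^sup>1\<close> norm of \<open>u\<close>.\<close>
lemma first_order_embedding_borel:
  assumes n: "2 \<le> CARD('n)" and lip: "bounded_lipschitz_domain \<Omega>"
  obtains C where "0 \<le> C"
    "\<forall>u v. integrable_weak_gradient \<Omega> u v \<longrightarrow> (\<forall>i x. x \<notin> \<Omega> \<longrightarrow> v i x = 0) \<longrightarrow>
    norm_of \<rho> u \<le> ennreal C * (norm_of sobolev_domain u + (\<Sum>i\<in>UNIV. norm_of sobolev_domain (v i)))"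
proof -
  interpret Z: ri_norm_on \<Omega> sobolev_domain
    by (rule ri_norm_on.intro[OF bounded_measurable_set_axioms ri_norm_sobolev_domain])
  obtain Cs \<epsilon> where Cs: "0 \<le> Cs" and \<epsilon>: "0 < \<epsilon>"
    and level: "\<forall>u v \<alpha> \<beta>. integrable_weak_gradient \<Omega> u v \<longrightarrow> \<alpha> < \<beta> \<longrightarrow>
      emeasure lborel {x\<in>\<Omega>. \<bar>u x\<bar> > \<alpha>} \<le> ennreal \<epsilon> \<longrightarrow>
      ennreal (\<beta> - \<alpha>) * emeasure lborel {x\<in>\<Omega>. \<beta> \<le> \<bar>u x\<bar>}
       \<le> ennreal (Cs * root CARD('n) (measure lborel {x\<in>\<Omega>. \<beta> \<le> \<bar>u x\<bar>})) *
         (\<integral>\<^sup>+x. ennreal (\<Sum>i\<in>UNIV. \<bar>v i x\<bar>) * indicator {y. \<alpha> < \<bar>u y\<bar> \<and> \<bar>u y\<bar> < \<beta>} x \<partial>lborel)"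
    using level_set_estimate[OF n lip] by blast
  have "eventually (\<lambda>k. t k < \<epsilon>) sequentially" using t_tendsto_0 \<epsilon> by (rule order_tendstoD)
  then obtain J where J: "\<And>j. J \<le> j \<Longrightarrow> t j < \<epsilon>" by (auto simp: eventually_sequentially)
  define C1 where "C1 = Cs * (root CARD('n) (t 1) / t 1)"
  have C1: "0 \<le> C1" unfolding C1_def using Cs t_pos[of 1] by simp
  define w0 where "w0 = enn2real (weight 0)"
  have w0: "weight 0 = ennreal w0" "0 < w0"
    using level_max_pos[of 0] level_max_finite[of 0] by (auto simp: w0_def weight_def enn2real_positive_iff)
  define F where "F = enn2real (ff V)"
  have F: "ff V = ennreal F" "0 \<le> F"
    using ff_finite[of V] \<Omega>_pos by (auto simp: F_def)
  define C0 where "C0 = F / t J / w0"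
  have C0: "0 \<le> C0" using F w0 t_pos[of J] by (simp add: C0_def)
  have open_\<Omega>: "open \<Omega>" using lip by (simp add: bounded_lipschitz_domain_def)
  then have [measurable]: "\<Omega> \<in> sets borel" by simp
  show thesis
  proof (rule that[of "C0 + C1"]; (intro allI impI)?)
    show "0 \<le> C0 + C1" using C0 C1 by simp
    fix u :: "real^'n \<Rightarrow> real" and v :: "'n \<Rightarrow> real^'n \<Rightarrow> real"
    assume grad: "integrable_weak_gradient \<Omega> u v" and "\<forall>i x. x \<notin> \<Omega> \<longrightarrow> v i x = 0"
    then have v0: "v i x = 0" if "x \<notin> \<Omega>" for i x using that by blast
    have u: "integrable lborel u" "u \<in> borel_measurable borel"
      and v: "\<And>i. integrable lborel (v i)" "\<And>i. v i \<in> borel_measurable borel"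
      using grad by (auto simp: integrable_weak_gradient_def)
    note [measurable] = u(2) v(2)
    define f where "f x = ennreal \<bar>u x\<bar>" for x
    define N where "N x = ennreal (\<Sum>i\<in>UNIV. \<bar>v i x\<bar>)" for x
    have fM [measurable]: "f \<in> borel_measurable M" unfolding f_def by measurable
    have NM [measurable]: "N \<in> borel_measurable M" unfolding N_def by measurable
    define L where "L j = decreasing_rearrangement \<Omega> f (ennreal (t j))" for j
    have L_iff: "L j \<le> l \<longleftrightarrow> distribution_function \<Omega> f l \<le> ennreal (t j)" for j l
      unfolding L_def by (rule decreasing_rearrangement_le_iff[OF fM])
    have dist: "distribution_function \<Omega> f (ennreal l) = emeasure lborel {x\<in>\<Omega>. \<bar>u x\<bar> > l}" if "0 \<le> l" for l
    proof -
      have "{x\<in>\<Omega>. f x > ennreal l} = {x\<in>\<Omega>. \<bar>u x\<bar> > l}"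
        using that by (auto simp: f_def ennreal_less_iff)
      then have "distribution_function \<Omega> f (ennreal l) = emeasure lebesgue {x\<in>\<Omega>. \<bar>u x\<bar> > l}"
        by (simp add: distribution_function_def emeasure_M)
      also have "\<dots> = emeasure lborel {x\<in>\<Omega>. \<bar>u x\<bar> > l}"
      proof -
        have "{x\<in>\<Omega>. \<bar>u x\<bar> > l} \<in> sets lborel" by measurable
        then show ?thesis by simp
      qed
      finally show ?thesis .
    qed
    have int_f: "(\<integral>\<^sup>+x. f x \<partial>M) < \<infinity>"
    proof -
      have "(\<integral>\<^sup>+x. f x \<partial>M) = (\<integral>\<^sup>+x. f x * indicator \<Omega> x \<partial>lborel)"
        using \<Omega>_lebesgue by (subst nn_integral_restrict_space) (auto simp: nn_integral_completion)
      also have "\<dots> \<le> (\<integral>\<^sup>+x. f x \<partial>lborel)"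
        by (intro nn_integral_mono) (auto simp: indicator_def)
      also have "\<dots> < \<infinity>" using u(1) by (simp add: integrable_iff_bounded f_def)
      finally show ?thesis .
    qed
    have L_le: "L j \<le> ennreal (1 / t j) * (\<integral>\<^sup>+x. f x \<partial>M)" for j
      unfolding L_def using t_pos by (intro decreasing_rearrangement_mult_le_integral) auto
    have Lfin: "L j < \<infinity>" for j
      by (rule le_less_trans[OF L_le]) (use int_f in \<open>simp add: ennreal_mult_less_top\<close>)
    have L0: "L 0 = 0"
    proof -
      have "L 0 \<le> 0" unfolding L_iff t_0 distribution_function_def by (rule emeasure_M_le)
      then show ?thesis by simp
    qed
    have small: "distribution_function \<Omega> f (L j) \<le> ennreal (t j)" for j
      using L_iff[of j "L j"] by simp
    have Lmono: "incseq L"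
    proof (rule incseq_SucI)
      fix j
      have "distribution_function \<Omega> f (L (Suc j)) \<le> ennreal (t j)"
        using small[of "Suc j"] t_Suc[of j] t_pos[of "Suc j"] by (auto intro: order_trans ennreal_leI)
      then show "L j \<le> L (Suc j)" by (simp add: L_iff)
    qed
    define lam where "lam j = enn2real (L j)" for j
    have lam: "L j = ennreal (lam j)" "0 \<le> lam j" for j
      using Lfin[of j] by (auto simp: lam_def)
    define I where "I j = (\<integral>\<^sup>+x. N x * indicator {x. L j < f x \<and> f x < L (Suc j)} x \<partial>M)" for j
    have step: "L (Suc j) - L j \<le> ennreal (C1 * (2 * q) ^ j) * I j" if j: "J \<le> j" for j
    proof (rule dense_le)
      fix y assume "y < L (Suc j) - L j"
      then have y: "y < ennreal (lam (Suc j) - lam j)" using lam(2) by (simp add: lam(1) ennreal_minus)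
      then obtain r where r: "y = ennreal r" "0 \<le> r" "r < lam (Suc j) - lam j"
        by (cases y) (auto simp: ennreal_less_iff)
      show "y \<le> ennreal (C1 * (2 * q) ^ j) * I j"
      proof (cases "r = 0")
        case True
        then show ?thesis using r by simp
      next
        case False
        then have r0: "0 < r" using r by simp
        \<comment> \<open>A level strictly below the next one, so that \<open>{|u| \<ge> \<beta>}\<close> has measure at least \<open>t (Suc j)\<close>.\<close>
        define \<beta> where "\<beta> = lam j + r"
        have \<beta>: "lam j < \<beta>" "\<beta> < lam (Suc j)" "0 \<le> \<beta>" using r r0 lam(2)[of j] by (auto simp: \<beta>_def)
        define E where "E = {x\<in>\<Omega>. \<beta> \<le> \<bar>u x\<bar>}"
        have [measurable]: "E \<in> sets borel" unfolding E_def by measurable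
        have Efin: "emeasure lborel E = ennreal (measure lborel E)"
        proof (rule emeasure_eq_ennreal_measure)
          have "bounded E" using \<Omega>_bounded by (rule bounded_subset) (auto simp: E_def)
          then show "emeasure lborel E \<noteq> top" using emeasure_bounded_finite[of E] by auto
        qed
        define e where "e = measure lborel E"
        have "\<not> L (Suc j) \<le> ennreal \<beta>" using \<beta> lam by (simp add: not_le ennreal_less_iff)
        then have "ennreal (t (Suc j)) < emeasure lborel {x\<in>\<Omega>. \<bar>u x\<bar> > \<beta>}"
          unfolding L_iff using \<beta> by (simp add: dist)
        also have "\<dots> \<le> emeasure lborel E" unfolding E_def by (intro emeasure_mono) auto
        finally have te: "t (Suc j) \<le> e"
          unfolding Efin e_def[symmetric] using t_pos[of "Suc j"]
          by (simp add: ennreal_less_iff less_imp_le)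
        have e0: "0 < e" using te t_pos[of "Suc j"] by linarith
        have "emeasure lborel {x\<in>\<Omega>. \<bar>u x\<bar> > lam j} \<le> ennreal (t j)"
          using small[of j] lam dist by simp
        also have "\<dots> \<le> ennreal \<epsilon>" using J[OF j] by (intro ennreal_leI) simp
        finally have "ennreal (\<beta> - lam j) * ennreal e \<le> ennreal (Cs * root CARD('n) e) *
           (\<integral>\<^sup>+x. N x * indicator {y. lam j < \<bar>u y\<bar> \<and> \<bar>u y\<bar> < \<beta>} x \<partial>lborel)"
          using level[rule_format, OF grad \<beta>(1)] by (simp add: E_def[symmetric] Efin e_def[symmetric] N_def)
        also have "(\<integral>\<^sup>+x. N x * indicator {y. lam j < \<bar>u y\<bar> \<and> \<bar>u y\<bar> < \<beta>} x \<partial>lborel)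
           = (\<integral>\<^sup>+x. N x * indicator {y. lam j < \<bar>u y\<bar> \<and> \<bar>u y\<bar> < \<beta>} x \<partial>M)"
          by (rule nn_integral_M_eq_lborel[symmetric]) (simp add: N_def v0)
        also have "\<dots> \<le> I j"
          unfolding I_def
        proof (intro nn_integral_mono mult_left_mono)
          fix x
          show "indicator {y. lam j < \<bar>u y\<bar> \<and> \<bar>u y\<bar> < \<beta>} x \<le> (indicator {x. L j < f x \<and> f x < L (Suc j)} x :: ennreal)"
            using \<beta> lam(2) by (auto simp: indicator_def lam(1) f_def ennreal_less_iff)
        qed simp
        finally have main: "ennreal r * ennreal e \<le> ennreal (Cs * root CARD('n) e) * I j"
          by (simp add: \<beta>_def mult_left_mono)
        have "ennreal r = ennreal (1 / e) * (ennreal r * ennreal e)"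
          using e0 r0 by (simp add: ennreal_mult[symmetric])
        also have "\<dots> \<le> ennreal (1 / e) * (ennreal (Cs * root CARD('n) e) * I j)"
          by (intro mult_left_mono main) simp
        also have "\<dots> = ennreal (Cs * (root CARD('n) e / e)) * I j"
          unfolding mult.assoc[symmetric] using e0 Cs by (simp add: ennreal_mult[symmetric])
        also have "\<dots> \<le> ennreal (C1 * (2 * q) ^ j) * I j"
          unfolding C1_def mult.assoc using Cs root_over_id_le[OF te]
          by (intro mult_right_mono ennreal_leI mult_left_mono) auto
        finally show ?thesis using r by simp
      qed
    qed
    have "\<rho> f \<le> (\<Sum>j. (L (Suc j) - L j) * ff (t j))"
      by (rule layer_decomposition[OF fM L0 Lmono Lfin small])
    also have "\<dots> \<le> (\<Sum>j. (if j < J then (L (Suc j) - L j) * ff V else 0) + ennreal C1 * (level_max j * I j))"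
    proof (intro suminf_le summableI)
      fix j
      show "(L (Suc j) - L j) * ff (t j)
        \<le> (if j < J then (L (Suc j) - L j) * ff V else 0) + ennreal C1 * (level_max j * I j)"
      proof (cases "j < J")
        case True
        have "ff (t j) \<le> ff V" using t_pos[of j] t_le_V[of j] by (intro ff_mono) auto
        then have "(L (Suc j) - L j) * ff (t j) \<le> (L (Suc j) - L j) * ff V" by (intro mult_left_mono) auto
        then show ?thesis using True by (simp add: add_increasing2)
      next
        case False
        then have "(L (Suc j) - L j) * ff (t j) \<le> ennreal (C1 * (2 * q) ^ j) * I j * ff (t j)"
          by (intro mult_right_mono step) auto
        also have "\<dots> = ennreal C1 * (level_coeff j * I j)"
        proof -
          have "ennreal (C1 * (2 * q) ^ j) = ennreal C1 * ennreal ((2 * q) ^ j)"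
            using C1 q_pos by (intro ennreal_mult) auto
          then show ?thesis unfolding level_coeff_def by (simp only: mult_ac)
        qed
        also have "\<dots> \<le> ennreal C1 * (level_max j * I j)"
          by (intro mult_left_mono mult_right_mono level_coeff_le_max) auto
        finally show ?thesis using False by simp
      qed
    qed
    also have "\<dots> = (\<Sum>j. if j < J then (L (Suc j) - L j) * ff V else 0) + ennreal C1 * (\<Sum>j. level_max j * I j)"
      by (subst suminf_add[symmetric]) (auto intro: summableI)
    also have "(\<Sum>j. if j < J then (L (Suc j) - L j) * ff V else 0) = L J * ff V"
    proof -
      have "(\<Sum>j. if j < J then (L (Suc j) - L j) * ff V else 0) = (\<Sum>j<J. (L (Suc j) - L j) * ff V)"
        by (subst suminf_finite[of "{..<J}"]) auto
      also have "\<dots> = (\<Sum>j<J. L (Suc j) - L j) * ff V" by (simp add: sum_distrib_right)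
      finally show ?thesis unfolding telescoping_ennreal[OF Lmono L0] .
    qed
    also have "L J * ff V \<le> ennreal C0 * sobolev_domain f"
    proof -
      have "L J * ff V \<le> (ennreal (1 / t J) * (\<integral>\<^sup>+x. f x \<partial>M)) * ennreal F"
        unfolding F(1) by (intro mult_right_mono L_le) simp
      also have "\<dots> = ennreal (1 / t J) * ennreal F * ennreal (1 / w0) * (weight 0 * (\<integral>\<^sup>+x. f x \<partial>M))"
      proof -
        have "ennreal (1 / w0) * weight 0 = 1"
          unfolding w0(1) using w0(2) by (simp add: ennreal_mult[symmetric])
        then have "(ennreal (1 / t J) * (\<integral>\<^sup>+x. f x \<partial>M)) * ennreal F
            = (ennreal (1 / t J) * (\<integral>\<^sup>+x. f x \<partial>M)) * ennreal F * (ennreal (1 / w0) * weight 0)"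
          by simp
        then show ?thesis by (simp only: mult_ac)
      qed
      also have "ennreal (1 / t J) * ennreal F * ennreal (1 / w0) = ennreal C0"
        using t_pos[of J] F(2) w0(2) by (simp add: C0_def ennreal_mult[symmetric])
      also have "ennreal C0 * (weight 0 * (\<integral>\<^sup>+x. f x \<partial>M)) \<le> ennreal C0 * sobolev_domain f"
        unfolding sobolev_domain_def by (intro mult_left_mono integral_le_dyadic_norm fM) simp
      finally show ?thesis .
    qed
    also have "(\<Sum>j. level_max j * I j) \<le> sobolev_domain N"
      unfolding I_def by (rule weighted_slices_le_sobolev_domain[OF fM NM Lmono small])
    also have "sobolev_domain N \<le> (\<Sum>i\<in>UNIV. norm_of sobolev_domain (v i))"
    proof -
      have "N = (\<lambda>x. \<Sum>i\<in>UNIV. ennreal \<bar>v i x\<bar>)" by (auto simp: N_def sum_ennreal)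
      then show ?thesis
        unfolding norm_of_def by (simp only:) (rule Z.rho_finite_subadditive, auto)
    qed
    finally have "\<rho> f \<le> ennreal C0 * sobolev_domain f + ennreal C1 * (\<Sum>i\<in>UNIV. norm_of sobolev_domain (v i))"
      by (simp add: add_mono mult_left_mono)
    also have "\<dots> \<le> ennreal (C0 + C1) * sobolev_domain f + ennreal (C0 + C1) * (\<Sum>i\<in>UNIV. norm_of sobolev_domain (v i))"
      using C0 C1 by (intro add_mono mult_right_mono ennreal_leI) auto
    finally show "norm_of \<rho> u \<le> ennreal (C0 + C1) * (norm_of sobolev_domain u + (\<Sum>i\<in>UNIV. norm_of sobolev_domain (v i)))"
      by (simp add: norm_of_def f_def[abs_def] distrib_left)
  qed
qed

end

context ri_norm_on
begin

text \<open>The step from Borel functions on the whole space to Sobolev functions on \<open>\<Omega>\<close>.  A finite norm in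
  the domain makes \<open>u\<close> and its gradient integrable; otherwise there is nothing to prove.\<close>
lemma first_order_embedding:
  assumes n: "2 \<le> CARD('n)" and lip: "bounded_lipschitz_domain \<Omega>"
  obtains C where "0 < C"
    "\<forall>u v. (\<forall>i. has_weak_derivative \<Omega> [i] u (v i)) \<longrightarrow>
       norm_of \<rho> u \<le> ennreal C * (norm_of sobolev_domain u + (\<Sum>i\<in>UNIV. norm_of sobolev_domain (v i)))"
proof -
  interpret Z: ri_norm_on \<Omega> sobolev_domain
    by (rule ri_norm_on.intro[OF bounded_measurable_set_axioms ri_norm_sobolev_domain])
  have open_\<Omega>: "open \<Omega>" using lip by (simp add: bounded_lipschitz_domain_def)
  obtain C where C: "0 \<le> C" and borel: "\<forall>u v. integrable_weak_gradient \<Omega> u v \<longrightarrow> (\<forall>i x. x \<notin> \<Omega> \<longrightarrow> v i x = 0) \<longrightarrow>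
    norm_of \<rho> u \<le> ennreal C * (norm_of sobolev_domain u + (\<Sum>i\<in>UNIV. norm_of sobolev_domain (v i)))"
    using first_order_embedding_borel[OF n lip] by blast
  show thesis
  \<comment> \<open>A positive constant, as the right-hand side has to be infinite when a norm in it is.\<close>
  proof (rule that[of "C + 1"]; (intro allI impI)?)
    show "0 < C + 1" using C by simp
    fix u :: "real^'n \<Rightarrow> real" and v :: "'n \<Rightarrow> real^'n \<Rightarrow> real"
    assume weak: "\<forall>i. has_weak_derivative \<Omega> [i] u (v i)"
    let ?R = "norm_of sobolev_domain u + (\<Sum>i\<in>UNIV. norm_of sobolev_domain (v i))"
    show "norm_of \<rho> u \<le> ennreal (C + 1) * ?R"
    proof (cases "?R = top")
      case True
      have nz: "ennreal (C + 1) \<noteq> 0" using C by (simp add: ennreal_eq_0_iff del: ennreal_plus)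
      have "ennreal (C + 1) * ?R = top" unfolding True ennreal_mult_top using nz by (simp only: if_False)
      then show ?thesis by (simp only: top_greatest)
    next
      case False
      have meas: "u \<in> borel_measurable M" "v i \<in> borel_measurable M" for i
        using weak by (auto simp: has_weak_derivative_def locally_integrable_def)
      obtain u' where u': "u' \<in> borel_measurable borel" "\<And>x. x \<notin> \<Omega> \<Longrightarrow> u' x = 0"
        "AE x in lborel. x \<in> \<Omega> \<longrightarrow> u x = u' x"
        using lebesgue_on_borel_representative[OF open_\<Omega> meas(1)] by blast
      have "\<exists>v'. v' \<in> borel_measurable borel \<and> (\<forall>x. x \<notin> \<Omega> \<longrightarrow> v' x = 0) \<and>
        (AE x in lborel. x \<in> \<Omega> \<longrightarrow> v i x = v' x)" for i
        using lebesgue_on_borel_representative[OF open_\<Omega> meas(2)[of i]] by blast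
      then obtain v' where v': "\<And>i. v' i \<in> borel_measurable borel" "\<And>i x. x \<notin> \<Omega> \<Longrightarrow> v' i x = 0"
        "\<And>i. AE x in lborel. x \<in> \<Omega> \<longrightarrow> v i x = v' i x" by metis
      have cong: "norm_of \<sigma> f = norm_of \<sigma> f'"
        if "ri_norm \<Omega> \<sigma>" "f \<in> borel_measurable M" "f' \<in> borel_measurable borel"
          "AE x in lborel. x \<in> \<Omega> \<longrightarrow> f x = f' x" for \<sigma> f f'
      proof -
        interpret S: ri_norm_on \<Omega> \<sigma> by (rule ri_norm_on.intro[OF bounded_measurable_set_axioms that(1)])
        have [measurable]: "f \<in> borel_measurable M" "f' \<in> borel_measurable M" using that by auto
        have "AE x in M. f x = f' x" using that(4) \<Omega>_lebesgue by (simp add: AE_lebesgue_on_iff)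
        then have "AE x in M. ennreal \<bar>f x\<bar> = ennreal \<bar>f' x\<bar>" by eventually_elim simp
        then show ?thesis unfolding norm_of_def by (intro S.rho_cong_AE) measurable
      qed
      have int: "integrable lborel f'"
        if "f \<in> borel_measurable M" "f' \<in> borel_measurable borel" "\<And>x. x \<notin> \<Omega> \<Longrightarrow> f' x = 0"
          "AE x in lborel. x \<in> \<Omega> \<longrightarrow> f x = f' x" "norm_of sobolev_domain f \<noteq> top" for f f'
      proof (rule integrableI_bounded)
        show "f' \<in> borel_measurable lborel" using that by simp
        have [measurable]: "f' \<in> borel_measurable M" using that by auto
        have "weight 0 * (\<integral>\<^sup>+x. ennreal \<bar>f' x\<bar> \<partial>M) \<le> norm_of sobolev_domain f'"
          unfolding norm_of_def sobolev_domain_def by (rule integral_le_dyadic_norm) measurable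
        also have "\<dots> < \<infinity>"
          using that cong[OF ri_norm_sobolev_domain that(1,2,4)] by (simp add: less_top)
        finally have "(\<integral>\<^sup>+x. ennreal \<bar>f' x\<bar> \<partial>M) < \<infinity>"
          using level_max_pos[of 0] by (auto simp: weight_def ennreal_mult_less_top)
        then show "(\<integral>\<^sup>+x. ennreal (norm (f' x)) \<partial>lborel) < \<infinity>"
          using nn_integral_M_eq_lborel[of "\<lambda>x. ennreal \<bar>f' x\<bar>"] that(3) by simp
      qed
      have nt: "norm_of sobolev_domain u \<noteq> top" "norm_of sobolev_domain (v i) \<noteq> top" for i
        using False by auto
      have "integrable_weak_gradient \<Omega> u' v'"
        unfolding integrable_weak_gradient_def
      proof (intro conjI allI ballI)
        show "integrable lborel u'" by (rule int[OF meas(1) u' nt(1)])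
        show "integrable lborel (v' i)" for i by (rule int[OF meas(2) v' nt(2)])
        fix i \<phi> assume \<phi>: "\<phi> \<in> test_functions \<Omega>"
        note [measurable] = test_functions_borel[OF \<phi>]
          test_functions_borel[OF test_functions_partial_derivative[OF \<phi>]] meas u'(1) v'(1)
        have "(\<integral>x. u x * partial_derivative i \<phi> x \<partial>M) = - (\<integral>x. v i x * \<phi> x \<partial>M)"
          using weak \<phi> by (auto simp: has_weak_derivative_def)
        moreover have "(\<integral>x. u x * partial_derivative i \<phi> x \<partial>M) = (\<integral>x. u' x * partial_derivative i \<phi> x \<partial>lborel)"
          using u'(2,3) by (intro integral_lebesgue_on_eq_lborel \<Omega>_lebesgue) (auto elim: eventually_mono)
        moreover have "(\<integral>x. v i x * \<phi> x \<partial>M) = (\<integral>x. v' i x * \<phi> x \<partial>lborel)"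
          using v'(2) v'(3)[of i] by (intro integral_lebesgue_on_eq_lborel \<Omega>_lebesgue) (auto elim: eventually_mono)
        ultimately show "(\<integral>x. u' x * partial_derivative i \<phi> x \<partial>lborel) = - (\<integral>x. v' i x * \<phi> x \<partial>lborel)"
          by simp
      qed (use u' v' in auto)
      then have "norm_of \<rho> u' \<le> ennreal C * (norm_of sobolev_domain u' + (\<Sum>i\<in>UNIV. norm_of sobolev_domain (v' i)))"
        using borel v'(2) by blast
      also have "norm_of sobolev_domain u' + (\<Sum>i\<in>UNIV. norm_of sobolev_domain (v' i)) = ?R"
        using cong[OF ri_norm_sobolev_domain meas(1) u'(1,3)] cong[OF ri_norm_sobolev_domain meas(2) v'(1,3)]
        by simp
      also have "norm_of \<rho> u' = norm_of \<rho> u"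
        using cong[OF ri_norm_axioms meas(1) u'(1,3)] by simp
      also have "ennreal C * ?R \<le> ennreal (C + 1) * ?R" by (intro mult_right_mono ennreal_leI) auto
      finally show ?thesis .
    qed
  qed
qed

end

section \<open>Higher order by iteration\<close>

lemma has_weak_derivative_Nil: "locally_integrable \<Omega> u \<Longrightarrow> has_weak_derivative \<Omega> [] u u"
  by (simp add: has_weak_derivative_def)

lemma weakly_differentiable_weak_derivative:
  assumes "weakly_differentiable \<Omega> m u" "length is \<le> m"
  shows "has_weak_derivative \<Omega> is u (weak_derivative \<Omega> is u)"
proof (cases "is = []")
  case True
  have "locally_integrable \<Omega> u"
    using assms(1) by (auto simp: weakly_differentiable_def has_weak_derivative_def dest: spec[of _ "[]"])
  then show ?thesis using True by (simp add: weak_derivative_def has_weak_derivative_Nil)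
next
  case False
  have "\<exists>v. has_weak_derivative \<Omega> is u v" using assms by (simp add: weakly_differentiable_def)
  then show ?thesis using False by (simp add: weak_derivative_def someI_ex)
qed

text \<open>Testing with \<open>\<partial>\<^sub>i \<phi>\<close> instead of \<open>\<phi>\<close> appends \<open>i\<close> to the end of the list of directions.\<close>
lemma weak_derivative_of_weak_derivative:
  assumes "has_weak_derivative \<Omega> is u v" "has_weak_derivative \<Omega> (is @ [i]) u w"
  shows "has_weak_derivative \<Omega> [i] v w"
  unfolding has_weak_derivative_def
proof (intro conjI ballI)
  show "locally_integrable \<Omega> v" "locally_integrable \<Omega> w"
    using assms by (auto simp: has_weak_derivative_def)
  fix \<phi> assume \<phi>: "\<phi> \<in> test_functions \<Omega>"
  have "(\<integral>x. u x * iterated_partial is (partial_derivative i \<phi>) x \<partial>lebesgue_on \<Omega>)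
    = (-1) ^ length is * (\<integral>x. v x * partial_derivative i \<phi> x \<partial>lebesgue_on \<Omega>)"
    using assms(1) test_functions_partial_derivative[OF \<phi>] by (auto simp: has_weak_derivative_def)
  moreover have "(\<integral>x. u x * iterated_partial is (partial_derivative i \<phi>) x \<partial>lebesgue_on \<Omega>)
    = (-1) ^ Suc (length is) * (\<integral>x. w x * \<phi> x \<partial>lebesgue_on \<Omega>)"
    using assms(2) \<phi> by (auto simp: has_weak_derivative_def iterated_partial_append)
  ultimately have "(-1) ^ length is * (\<integral>x. v x * partial_derivative i \<phi> x \<partial>lebesgue_on \<Omega>)
    = (-1) ^ length is * (- (\<integral>x. w x * \<phi> x \<partial>lebesgue_on \<Omega>))" by simp
  then have "(\<integral>x. v x * partial_derivative i \<phi> x \<partial>lebesgue_on \<Omega>) = - (\<integral>x. w x * \<phi> x \<partial>lebesgue_on \<Omega>)"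
    by (rule mult_left_cancel[THEN iffD1, rotated]) simp
  then show "(\<integral>x. v x * iterated_partial [i] \<phi> x \<partial>lebesgue_on \<Omega>)
    = (-1) ^ length [i] * (\<integral>x. w x * \<phi> x \<partial>lebesgue_on \<Omega>)" by simp
qed

context bounded_measurable_set
begin

primrec iterated_domain :: "(((real^'n) \<Rightarrow> ennreal) \<Rightarrow> ennreal) \<Rightarrow> nat \<Rightarrow> ((real^'n) \<Rightarrow> ennreal) \<Rightarrow> ennreal" where
  "iterated_domain \<rho> 0 = \<rho>"
| "iterated_domain \<rho> (Suc k) = ri_norm_on.sobolev_domain \<Omega> (iterated_domain \<rho> k)"

lemma ri_norm_onI: "ri_norm \<Omega> \<rho> \<Longrightarrow> ri_norm_on \<Omega> \<rho>"
  by (rule ri_norm_on.intro[OF bounded_measurable_set_axioms])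

lemma ri_norm_iterated_domain: "ri_norm \<Omega> \<rho> \<Longrightarrow> ri_norm \<Omega> (iterated_domain \<rho> k)"
  by (induction k) (auto intro: ri_norm_on.ri_norm_sobolev_domain[OF ri_norm_onI])

text \<open>The norm in the \<open>k\<close>-th domain of a derivative of order at most \<open>k\<close> is controlled, by the
  first-order embedding into that domain, by the derivatives of order at most \<open>k + 1\<close> in the next
  one.\<close>
lemma iterated_embedding:
  assumes n: "2 \<le> CARD('n)" and lip: "bounded_lipschitz_domain \<Omega>" and \<rho>: "ri_norm \<Omega> \<rho>" and "k \<le> m"
  shows "\<exists>C>0. \<forall>u. weakly_differentiable \<Omega> m u \<longrightarrow>
    norm_of \<rho> u \<le> ennreal C * (\<Sum>is\<in>{is. length is \<le> k}. norm_of (iterated_domain \<rho> k) (weak_derivative \<Omega> is u))"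
  using \<open>k \<le> m\<close>
proof (induction k)
  case 0
  show ?case by (intro exI[of _ 1]) (simp add: weak_derivative_def)
next
  case (Suc k)
  let ?N = "\<lambda>k. norm_of (iterated_domain \<rho> k)"
  let ?I = "\<lambda>k. {is :: 'n list. length is \<le> k}"
  have fin: "finite (?I k)" for k using finite_lists_length_le[of "UNIV :: 'n set" k] by simp
  obtain C where C: "C > 0" and IH: "\<forall>u. weakly_differentiable \<Omega> m u \<longrightarrow>
    norm_of \<rho> u \<le> ennreal C * (\<Sum>is\<in>?I k. ?N k (weak_derivative \<Omega> is u))"
    using Suc by auto
  interpret K: ri_norm_on \<Omega> "iterated_domain \<rho> k" by (rule ri_norm_onI[OF ri_norm_iterated_domain[OF \<rho>]])
  obtain D where D: "D > 0" and step: "\<forall>u v. (\<forall>i. has_weak_derivative \<Omega> [i] u (v i)) \<longrightarrow>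
    ?N k u \<le> ennreal D * (?N (Suc k) u + (\<Sum>i\<in>UNIV. ?N (Suc k) (v i)))"
    using K.first_order_embedding[OF n lip] unfolding iterated_domain.simps by blast
  define E where "E = D * (1 + real CARD('n))"
  have E: "0 < E" using D by (simp add: E_def)
  define c where "c = C * (real (card (?I k)) * E)"
  have "card (?I k) > 0" using fin by (auto simp: card_gt_0_iff intro: exI[of _ "[]"])
  then have c: "c > 0" using C E by (simp add: c_def)
  show ?case
  proof (intro exI[of _ c] conjI allI impI c)
    fix u assume u: "weakly_differentiable \<Omega> m u"
    let ?S = "\<Sum>is\<in>?I (Suc k). ?N (Suc k) (weak_derivative \<Omega> is u)"
    have member: "?N (Suc k) (weak_derivative \<Omega> is u) \<le> ?S" if "is \<in> ?I (Suc k)" for "is"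
      by (rule member_le_sum[OF that]) (use fin in auto)
    have each: "?N k (weak_derivative \<Omega> is u) \<le> ennreal E * ?S" if "is": "is \<in> ?I k" for "is"
    proof -
      have "has_weak_derivative \<Omega> [i] (weak_derivative \<Omega> is u) (weak_derivative \<Omega> (is @ [i]) u)" for i
        using "is" Suc.prems
        by (intro weak_derivative_of_weak_derivative[of \<Omega> "is" u] weakly_differentiable_weak_derivative[OF u]) auto
      then have "?N k (weak_derivative \<Omega> is u) \<le> ennreal D * (?N (Suc k) (weak_derivative \<Omega> is u)
        + (\<Sum>i\<in>UNIV. ?N (Suc k) (weak_derivative \<Omega> (is @ [i]) u)))"
        using step[rule_format, of "weak_derivative \<Omega> is u" "\<lambda>i. weak_derivative \<Omega> (is @ [i]) u"] by blast
      also have "\<dots> \<le> ennreal D * (?S + (\<Sum>i\<in>(UNIV :: 'n set). ?S))"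
        using "is" by (intro mult_left_mono add_mono sum_mono member) auto
      also have "\<dots> = ennreal D * (1 + of_nat CARD('n)) * ?S"
        by (simp add: distrib_right distrib_left mult.assoc)
      also have "ennreal D * (1 + of_nat CARD('n)) = ennreal E"
        using D by (simp add: E_def ennreal_mult ennreal_of_nat_eq_real_of_nat)
      finally show ?thesis .
    qed
    have "norm_of \<rho> u \<le> ennreal C * (\<Sum>is\<in>?I k. ?N k (weak_derivative \<Omega> is u))" using IH u by blast
    also have "\<dots> \<le> ennreal C * (\<Sum>is\<in>?I k. ennreal E * ?S)" by (intro mult_left_mono sum_mono each) auto
    also have "\<dots> = ennreal C * (ennreal (real (card (?I k))) * ennreal E) * ?S"
      by (simp add: ennreal_of_nat_eq_real_of_nat mult_ac)
    also have "ennreal C * (ennreal (real (card (?I k))) * ennreal E) = ennreal c"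
      using C E by (simp add: c_def ennreal_mult)
    finally show "norm_of \<rho> u \<le> ennreal c * ?S" .
  qed
qed

lemma weak_derivative_le_gradient_norm: "\<bar>weak_derivative \<Omega> is u x\<bar> \<le> gradient_norm \<Omega> (length is) u x"
proof -
  have fin: "finite {js :: 'n list. length js = length is}"
    using finite_lists_length_eq[of "UNIV :: 'n set" "length is"] by simp
  have "\<bar>weak_derivative \<Omega> is u x\<bar> \<le> L2_set (\<lambda>js. \<bar>weak_derivative \<Omega> js u x\<bar>) {js. length js = length is}"
    by (rule member_le_L2_set[OF fin]) simp
  then show ?thesis by (simp add: gradient_norm_def L2_set_def)
qed

lemma sobolev_embedding_iterated_domain:
  assumes n: "2 \<le> CARD('n)" and lip: "bounded_lipschitz_domain \<Omega>" and \<rho>: "ri_norm \<Omega> \<rho>"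
  shows "sobolev_embedding \<Omega> m (iterated_domain \<rho> m) \<rho>"
proof -
  interpret Z: ri_norm_on \<Omega> "iterated_domain \<rho> m" by (rule ri_norm_onI[OF ri_norm_iterated_domain[OF \<rho>]])
  let ?N = "norm_of (iterated_domain \<rho> m)"
  let ?I = "{is :: 'n list. length is \<le> m}"
  obtain C where C: "C > 0" and emb: "\<And>u. weakly_differentiable \<Omega> m u \<Longrightarrow>
    norm_of \<rho> u \<le> ennreal C * (\<Sum>is\<in>?I. ?N (weak_derivative \<Omega> is u))"
    using iterated_embedding[OF n lip \<rho>, of m m] by auto
  show ?thesis
    unfolding sobolev_embedding_def
  proof (intro exI[of _ "C * real (card ?I)"] ballI)
    fix u assume "u \<in> sobolev_space \<Omega> m (iterated_domain \<rho> m)"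
    then have u: "weakly_differentiable \<Omega> m u"
      and g: "\<And>k. k \<le> m \<Longrightarrow> gradient_norm \<Omega> k u \<in> borel_measurable M"
      by (auto simp: sobolev_space_def ri_space_def)
    let ?S = "sobolev_norm \<Omega> m (iterated_domain \<rho> m) u"
    have each: "?N (weak_derivative \<Omega> is u) \<le> ?S" if "is": "is \<in> ?I" for "is"
    proof -
      have [measurable]: "weak_derivative \<Omega> is u \<in> borel_measurable M"
        using weakly_differentiable_weak_derivative[OF u, of "is"] "is"
        by (auto simp: has_weak_derivative_def locally_integrable_def)
      have [measurable]: "gradient_norm \<Omega> (length is) u \<in> borel_measurable M" using g "is" by simp
      have "ennreal \<bar>weak_derivative \<Omega> is u x\<bar> \<le> ennreal \<bar>gradient_norm \<Omega> (length is) u x\<bar>" for x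
        using weak_derivative_le_gradient_norm[of "is" u x] by (intro ennreal_leI) linarith
      then have "?N (weak_derivative \<Omega> is u) \<le> ?N (gradient_norm \<Omega> (length is) u)"
        unfolding norm_of_def by (intro Z.P2) auto
      also have "\<dots> \<le> ?S"
        unfolding sobolev_norm_def using "is" by (intro member_le_sum) auto
      finally show ?thesis .
    qed
    have "norm_of \<rho> u \<le> ennreal C * (\<Sum>is\<in>?I. ?N (weak_derivative \<Omega> is u))" by (rule emb[OF u])
    also have "\<dots> \<le> ennreal C * (\<Sum>is\<in>?I. ?S)" by (intro mult_left_mono sum_mono each) auto
    also have "\<dots> = ennreal (C * real (card ?I)) * ?S"
      using C by (simp add: ennreal_mult ennreal_of_nat_eq_real_of_nat mult.assoc)
    finally show "norm_of \<rho> u \<le> ennreal (C * real (card ?I)) * ?S" .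
  qed
qed

text \<open>Each step removes one factor \<open>(1 / q) ^ i\<close>.\<close>
lemma iterated_domain_fundamental_function_le:
  assumes \<rho>: "ri_norm \<Omega> \<rho>"
    and bound: "\<And>i. fundamental_function \<Omega> \<rho> (t i) \<le> ennreal ((1 / q) ^ (m * i)) * \<Theta> i"
    and mono: "\<And>i k. i \<le> k \<Longrightarrow> 2 ^ i * \<Theta> i \<le> 2 ^ k * \<Theta> k"
    and "l \<le> m"
  shows "\<exists>C>0. \<forall>i. fundamental_function \<Omega> (iterated_domain \<rho> l) (t i)
    \<le> ennreal C * (ennreal ((1 / q) ^ ((m - l) * i)) * \<Theta> i)"
  using \<open>l \<le> m\<close>
proof (induction l)
  case 0
  show ?case using bound by (intro exI[of _ 1]) simp
next
  case (Suc l)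
  interpret K: ri_norm_on \<Omega> "iterated_domain \<rho> l" by (rule ri_norm_onI[OF ri_norm_iterated_domain[OF \<rho>]])
  obtain C where C: "C > 0" and IH: "\<And>i. K.ff (t i) \<le> ennreal C * (ennreal ((1 / q) ^ ((m - l) * i)) * \<Theta> i)"
    using Suc by auto
  have ml: "m - l = Suc (m - Suc l)" using Suc.prems by simp
  define \<Psi> where "\<Psi> i = ennreal C * (ennreal ((1 / q) ^ ((m - Suc l) * i)) * \<Theta> i)" for i
  have q1: "1 \<le> 1 / q" using q_pos q_less_1 by simp
  have "fundamental_function \<Omega> K.sobolev_domain (t k) \<le> ennreal (K.geom_const * V) * \<Psi> k" for k
  proof (rule K.sobolev_domain_fundamental_function_le)
    fix i
    have "ennreal ((1 / q) ^ ((m - l) * i)) = ennreal ((1 / q) ^ i) * ennreal ((1 / q) ^ ((m - Suc l) * i))"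
      unfolding ml using q_pos by (simp add: ennreal_mult[symmetric] power_add)
    then show "K.ff (t i) \<le> ennreal ((1 / q) ^ i) * \<Psi> i"
      using IH[of i] by (simp add: \<Psi>_def mult_ac)
  next
    fix i k :: nat assume ik: "i \<le> k"
    have "2 ^ i * \<Psi> i = ennreal C * (ennreal ((1 / q) ^ ((m - Suc l) * i)) * (2 ^ i * \<Theta> i))"
      by (simp add: \<Psi>_def mult_ac)
    also have "\<dots> \<le> ennreal C * (ennreal ((1 / q) ^ ((m - Suc l) * k)) * (2 ^ k * \<Theta> k))"
      using ik by (intro mult_left_mono mult_mono mono ennreal_leI power_increasing q1 mult_le_mono2) auto
    also have "\<dots> = 2 ^ k * \<Psi> k" by (simp add: \<Psi>_def mult_ac)
    finally show "2 ^ i * \<Psi> i \<le> 2 ^ k * \<Psi> k" .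
  qed
  moreover have "ennreal (K.geom_const * V) * \<Psi> k
    = ennreal (K.geom_const * V * C) * (ennreal ((1 / q) ^ ((m - Suc l) * k)) * \<Theta> k)" for k
    using K.geom_const_pos \<Omega>_pos C by (simp add: \<Psi>_def ennreal_mult mult.assoc)
  ultimately show ?case
    using K.geom_const_pos \<Omega>_pos C by (intro exI[of _ "K.geom_const * V * C"]) simp
qed

end

section \<open>Inclusions of r.i. spaces are bounded\<close>

context bounded_measurable_set
begin

text \<open>Otherwise there are sets \<open>E j\<close> on which the second norm is more than \<open>4 ^ j\<close> times the first.  The
  series of their indicators, scaled to have norm \<open>1 / 2 ^ j\<close> in the first space, converges there
  but has infinite norm in the second space.\<close>
lemma ri_space_inclusion_fundamental_function_le:
  assumes r1: "ri_norm \<Omega> \<rho>1" and r2: "ri_norm \<Omega> \<rho>2" and incl: "ri_space \<Omega> \<rho>1 \<subseteq> ri_space \<Omega> \<rho>2"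
  shows "\<exists>C>0. \<forall>k. fundamental_function \<Omega> \<rho>2 (t k) \<le> ennreal C * fundamental_function \<Omega> \<rho>1 (t k)"
proof (rule ccontr)
  interpret r1: ri_norm_on \<Omega> \<rho>1 by (rule ri_norm_onI[OF r1])
  interpret r2: ri_norm_on \<Omega> \<rho>2 by (rule ri_norm_onI[OF r2])
  assume "\<not> (\<exists>C>0. \<forall>k. r2.ff (t k) \<le> ennreal C * r1.ff (t k))"
  then have "\<exists>k. ennreal (4 ^ j) * r1.ff (t k) < r2.ff (t k)" for j :: nat
    by (auto simp: not_le dest: spec[of _ "4 ^ j :: real"])
  then obtain k where k: "\<And>j. ennreal (4 ^ j) * r1.ff (t (k j)) < r2.ff (t (k j))" by metis
  have "\<exists>E. E \<in> sets M \<and> emeasure M E = ennreal (t (k j))" for j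
  proof -
    have "emeasure M \<Omega> = ennreal V" by (rule emeasure_M_\<Omega>)
    then show ?thesis
      using exists_subset_measure[of \<Omega> "t (k j)"] t_pos[of "k j"] t_le_V[of "k j"] sets.top[of M]
      by (auto simp: ennreal_leI)
  qed
  then obtain E where E: "\<And>j. E j \<in> sets M" "\<And>j. emeasure M (E j) = ennreal (t (k j))" by metis
  note [measurable] = E(1)
  define \<phi> where "\<phi> j = enn2real (r1.ff (t (k j)))" for j
  have \<phi>: "r1.ff (t (k j)) = ennreal (\<phi> j)" "0 < \<phi> j" for j
    using r1.ff_finite[of "t (k j)"] r1.ff_pos[of "t (k j)"] t_pos[of "k j"]
    by (auto simp: \<phi>_def enn2real_positive_iff)
  have ff1: "\<rho>1 (indicator (E j)) = ennreal (\<phi> j)" for j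
    using r1.fundamental_function_eq'[OF E] \<phi>(1)[of j] by simp
  have ff2: "\<rho>2 (indicator (E j)) = r2.ff (t (k j))" for j
    using r2.fundamental_function_eq'[OF E] by simp
  define a where "a j = (1 / 2) ^ j / \<phi> j" for j
  have a: "0 < a j" for j using \<phi>(2)[of j] by (simp add: a_def)
  define g where "g x = (\<Sum>j. ennreal (a j) * indicator (E j) x)" for x
  have gM [measurable]: "g \<in> borel_measurable M" unfolding g_def by measurable
  have "\<rho>1 g \<le> (\<Sum>j. \<rho>1 (\<lambda>x. ennreal (a j) * indicator (E j) x))"
    unfolding g_def[abs_def] by (intro r1.rho_countable_subadditive) measurable
  also have "\<dots> = (\<Sum>j. ennreal ((1 / 2) ^ j))"
  proof (rule suminf_cong)
    fix j
    have "\<rho>1 (\<lambda>x. ennreal (a j) * indicator (E j) x) = ennreal (a j) * ennreal (\<phi> j)"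
      using E(1) a[of j] by (subst r1.P1_homogeneous) (auto simp: ff1)
    also have "\<dots> = ennreal ((1 / 2) ^ j)"
      using \<phi>(2)[of j] a[of j] by (subst ennreal_mult[symmetric]) (auto simp: a_def)
    finally show "\<rho>1 (\<lambda>x. ennreal (a j) * indicator (E j) x) = ennreal ((1 / 2) ^ j)" .
  qed
  also have "\<dots> = ennreal (\<Sum>j. (1 / 2) ^ j)" by (intro suminf_ennreal2 summable_geometric) auto
  also have "\<dots> < \<infinity>" by simp
  finally have fin1: "\<rho>1 g < \<infinity>" .
  obtain C where C: "C > 0" "(\<integral>\<^sup>+x\<in>\<Omega>. g x \<partial>M) \<le> ennreal C * \<rho>1 g"
    using r1.P5[of \<Omega>] sets.top[of M] gM by (auto simp: emeasure_M_\<Omega>)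
  have "(\<integral>\<^sup>+x. g x \<partial>M) = (\<integral>\<^sup>+x\<in>\<Omega>. g x \<partial>M)" by (intro nn_integral_cong) simp
  also have "\<dots> < \<infinity>" using C fin1 by (auto simp: ennreal_mult_less_top intro: le_less_trans)
  finally have "AE x in M. g x \<noteq> \<infinity>" by (intro nn_integral_PInf_AE) auto
  \<comment> \<open>The elements of the spaces are real-valued; g is finite almost everywhere because it is integrable.\<close>
  then have ae: "AE x in M. ennreal \<bar>enn2real (g x)\<bar> = g x" by eventually_elim (auto simp: less_top)
  have n1: "norm_of \<rho>1 (\<lambda>x. enn2real (g x)) = \<rho>1 g"
    unfolding norm_of_def using ae by (intro r1.rho_cong_AE) auto
  have n2: "norm_of \<rho>2 (\<lambda>x. enn2real (g x)) = \<rho>2 g"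
    unfolding norm_of_def using ae by (intro r2.rho_cong_AE) auto
  have "(\<lambda>x. enn2real (g x)) \<in> ri_space \<Omega> \<rho>1" using fin1 n1 by (simp add: ri_space_def)
  then have "(\<lambda>x. enn2real (g x)) \<in> ri_space \<Omega> \<rho>2" using incl by blast
  then have "\<rho>2 g < \<infinity>" using n2 by (simp add: ri_space_def)
  then obtain b where b: "0 \<le> b" "\<rho>2 g = ennreal b" by (cases "\<rho>2 g") auto
  have "2 ^ j \<le> b" for j :: nat
  proof -
    have "ennreal (2 ^ j) = ennreal (a j) * (ennreal (4 ^ j) * ennreal (\<phi> j))"
    proof -
      have "2 ^ j = a j * (4 ^ j * \<phi> j)"
      proof -
        have "(4 :: real) ^ j = 2 ^ j * 2 ^ j" by (simp add: power_mult_distrib[symmetric])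
        then show ?thesis using \<phi>(2)[of j] by (simp add: a_def power_one_over)
      qed
      then show ?thesis using a[of j] \<phi>(2)[of j] by (simp add: ennreal_mult[symmetric])
    qed
    also have "\<dots> \<le> ennreal (a j) * r2.ff (t (k j))"
      using k[of j] \<phi>(1)[of j] by (intro mult_left_mono) auto
    also have "\<dots> = \<rho>2 (\<lambda>x. ennreal (a j) * indicator (E j) x)"
      using E(1) a[of j] by (subst r2.P1_homogeneous) (auto simp: ff2)
    also have "\<dots> \<le> \<rho>2 g"
    proof (rule r2.P2)
      have "(\<Sum>i\<in>{j}. ennreal (a i) * indicator (E i) x) \<le> g x" for x
        unfolding g_def by (intro sum_le_suminf summableI) auto
      then have "ennreal (a j) * indicator (E j) x \<le> g x" for x
        by (simp only: sum.insert sum.empty finite.emptyI empty_iff not_False_eq_True add_0_right)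
      then show "AE x in M. ennreal (a j) * indicator (E j) x \<le> g x" by (intro AE_I2)
    qed (use E(1) in auto)
    finally show ?thesis using b by (simp add: ennreal_le_iff)
  qed
  moreover obtain j where "b < 2 ^ j" using real_arch_pow[of 2 b] by auto
  ultimately show False by (meson not_le)
qed

section \<open>Bump functions and the lower bound for the domain\<close>

lemma flat_exp_1_ge: "1 / 2 \<le> s \<Longrightarrow> exp (- 2) \<le> flat_exp 1 s"
  by (simp add: flat_exp_def) (simp add: field_simps)

lemma box_bump_ge:
  fixes y :: "real^'n"
  assumes "\<And>i. \<bar>y $ i\<bar> \<le> 1 / 2"
  shows "exp (- 4) ^ CARD('n) \<le> box_bump 1 (- 1) 1 y"
proof -
  have "(\<Prod>i\<in>(UNIV :: 'n set). exp (- 4 :: real)) \<le> box_bump 1 (- 1) 1 y"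
    unfolding box_bump_def
  proof (intro prod_mono conjI)
    fix i
    have "exp (- 4 :: real) = exp (- 2) * exp (- 2)" by (simp add: exp_add[symmetric])
    also have "\<dots> \<le> flat_exp 1 (1 * (y $ i - (- 1) $ i)) * flat_exp 1 (1 * (1 $ i - y $ i))"
      using assms[of i] by (intro mult_mono flat_exp_1_ge flat_exp_1_bounds) auto
    finally show "exp (- 4) \<le> flat_exp 1 (1 * (y $ i - (- 1) $ i)) * flat_exp 1 (1 * (1 $ i - y $ i))" .
  qed simp
  then show ?thesis by simp
qed

lemma content_cube:
  fixes x :: "real^'n"
  assumes "0 \<le> r"
  shows "emeasure lborel (cbox (x - r *\<^sub>R 1) (x + r *\<^sub>R 1)) = ennreal ((2 * r) ^ CARD('n))"
proof -
  have ne: "cbox (x - r *\<^sub>R 1) (x + r *\<^sub>R 1) \<noteq> {}"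
    using assms by (auto simp: interval_ne_empty_cart)
  have "measure lborel (cbox (x - r *\<^sub>R 1) (x + r *\<^sub>R 1)) = (\<Prod>i\<in>(UNIV :: 'n set). 2 * r)"
    using content_cbox_cart[OF ne] by simp
  moreover have "emeasure lborel (cbox (x - r *\<^sub>R 1) (x + r *\<^sub>R 1)) \<noteq> top"
    using emeasure_bounded_finite[OF bounded_cbox, of "x - r *\<^sub>R 1" "x + r *\<^sub>R 1"] by auto
  ultimately show ?thesis by (simp add: emeasure_eq_ennreal_measure)
qed

text \<open>Test the embedding with \<open>\<eta> ((x - x0) / R)\<close> for a fixed bump \<open>\<eta>\<close>.  This function is at least
  \<open>c0\<close> on the cube \<open>Q (R / 2)\<close>, and its derivatives of order at most \<open>m\<close> are supported in the
  cube \<open>Q R\<close> and bounded there by a multiple of \<open>1 / R ^ m\<close>.  With \<open>R = R0 * q ^ i\<close> both cubes have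
  measure comparable to \<open>t i\<close>, and \<open>1 / R ^ m\<close> is a multiple of \<open>(1 / q) ^ (m * i)\<close>.\<close>
lemma sobolev_embedding_fundamental_function_le:
  assumes X: "ri_norm \<Omega> \<rho>X" and Y: "ri_norm \<Omega> \<rho>Y" and emb: "sobolev_embedding \<Omega> m \<rho>X \<rho>Y"
    and op: "open \<Omega>" and ne: "\<Omega> \<noteq> {}"
  shows "\<exists>D>0. \<forall>i. fundamental_function \<Omega> \<rho>Y (t i) \<le> ennreal D * (ennreal ((1 / q) ^ (m * i)) * fundamental_function \<Omega> \<rho>X (t i))"
proof -
  interpret X: ri_norm_on \<Omega> \<rho>X by (rule ri_norm_onI[OF X])
  interpret Y: ri_norm_on \<Omega> \<rho>Y by (rule ri_norm_onI[OF Y])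
  let ?n = "CARD('n)"
  have [measurable]: "\<Omega> \<in> sets borel" using op by simp
  obtain C' where C': "\<And>u. u \<in> sobolev_space \<Omega> m \<rho>X \<Longrightarrow> norm_of \<rho>Y u \<le> ennreal C' * sobolev_norm \<Omega> m \<rho>X u"
    using emb by (auto simp: sobolev_embedding_def)
  define C where "C = max C' 1"
  have C: "C \<ge> 1" by (simp add: C_def)
  obtain x0 where x0: "x0 \<in> \<Omega>" using ne by blast
  define Q where "Q r = cbox (x0 - r *\<^sub>R 1) (x0 + r *\<^sub>R 1)" for r :: real
  have Q_iff: "x \<in> Q r \<longleftrightarrow> (\<forall>i. \<bar>x $ i - x0 $ i\<bar> \<le> r)" for x r
    by (auto simp: Q_def mem_box_cart abs_le_iff algebra_simps)
  have Q_mono: "r \<le> s \<Longrightarrow> Q r \<subseteq> Q s" for r s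
    unfolding subset_iff Q_iff by (meson order_trans)
  obtain R0 where R0: "0 < R0" "R0 \<le> 1" "Q R0 \<subseteq> \<Omega>"
  proof -
    obtain \<epsilon> where \<epsilon>: "\<epsilon> > 0" "ball x0 \<epsilon> \<subseteq> \<Omega>" using op x0 open_contains_ball by blast
    define R0 where "R0 = min 1 (\<epsilon> / (2 * ?n))"
    have pos: "0 < R0" "R0 \<le> 1" using \<epsilon> by (auto simp: R0_def)
    have "Q R0 \<subseteq> ball x0 \<epsilon>"
    proof
      fix x assume "x \<in> Q R0"
      then have "norm (x - x0) \<le> (\<Sum>i\<in>(UNIV :: 'n set). R0)"
        using norm_le_l1_cart[of "x - x0"] sum_mono[of UNIV "\<lambda>i. \<bar>(x - x0) $ i\<bar>" "\<lambda>i. R0"]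
        by (fastforce simp: Q_iff)
      also have "\<dots> \<le> \<epsilon> / 2" 
      proof -
        have "real ?n * R0 \<le> real ?n * (\<epsilon> / (2 * real ?n))" by (intro mult_left_mono) (auto simp: R0_def)
        then show ?thesis by simp
      qed
      finally show "x \<in> ball x0 \<epsilon>" using \<epsilon> by (simp add: dist_norm norm_minus_commute)
    qed
    with \<epsilon> pos that show thesis by blast
  qed
  have Qm: "Q r \<in> sets M" if "r \<le> R0" for r
    using Q_mono[OF that] R0(3) \<Omega>_lebesgue by (auto simp: sets_restrict_space_iff Q_def)
  have Qe: "emeasure M (Q r) = ennreal ((2 * r) ^ ?n)" if "0 \<le> r" "r \<le> R0" for r
  proof -
    have "emeasure M (Q r) = emeasure lebesgue (Q r)"
      using Q_mono[OF that(2)] R0(3) by (intro emeasure_M) auto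
    also have "\<dots> = emeasure lborel (Q r)" by (simp add: Q_def)
    finally show ?thesis using content_cube[OF that(1), of x0] by (simp add: Q_def)
  qed
  have qn: "q ^ ?n = 1 / 2" unfolding q_def by (simp add: power_one_over[symmetric] power_divide)
  define \<eta> :: "real^'n \<Rightarrow> real" where "\<eta> = box_bump 1 (- 1) 1"
  have \<eta>: "\<eta> \<in> test_functions UNIV" unfolding \<eta>_def by (rule box_bump_test) auto
  have \<eta>s: "smooth \<eta>" unfolding \<eta>_def by (rule smooth_box_bump)
  let ?I = "{is :: 'n list. length is \<le> m}"
  have fin: "finite ?I" using finite_lists_length_le[of "UNIV :: 'n set" m] by simp
  have "\<forall>is. \<exists>B>0. \<forall>x. \<bar>iterated_partial is \<eta> x\<bar> \<le> B"
    using test_functions_bounded[OF test_functions_iterated_partial[OF \<eta>]] by metis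
  then obtain B where B: "\<And>is. B is > 0" "\<And>is x. \<bar>iterated_partial is \<eta> x\<bar> \<le> B is" by metis
  define B1 where "B1 = (\<Sum>is\<in>?I. B (rev is))"
  have "B (rev []) \<le> B1" unfolding B1_def using B(1) fin by (intro member_le_sum) (auto simp: less_imp_le)
  then have B1: "B1 > 0" using B(1)[of "[]"] by simp
  have support: "iterated_partial is \<eta> y = 0" if "y \<notin> cbox (- 1) 1" for "is" and y
  proof -
    have "\<eta> \<in> test_functions (cbox (- 1) 1)" unfolding \<eta>_def by (rule box_bump_test) auto
    from test_functions_zero_outside[OF test_functions_iterated_partial[OF this] that] show ?thesis .
  qed
  define c0 where "c0 = exp (- 4 :: real) ^ ?n"
  have c0: "c0 > 0" by (simp add: c0_def)
  \<comment> \<open>The volume of the small cube is at least \<open>t (i + J)\<close>; doubling J times returns to \<open>t i\<close>.\<close>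
  obtain J where J: "V / 2 ^ J \<le> R0 ^ ?n"
  proof -
    obtain J where "V / R0 ^ ?n < 2 ^ J" using real_arch_pow[of 2 "V / R0 ^ ?n"] by auto
    then have "V / 2 ^ J \<le> R0 ^ ?n" using R0 by (simp add: field_simps)
    then show thesis by (rule that)
  qed
  \<comment> \<open>Since the largest cube fits into \<open>\<Omega>\<close>, the i-th one has measure at most \<open>t i\<close>.\<close>
  have vol: "(2 * R0) ^ ?n \<le> V"
  proof -
    have "ennreal ((2 * R0) ^ ?n) \<le> ennreal V" using Qe[of R0] R0 emeasure_M_le[of "Q R0"] by simp
    then show ?thesis using \<Omega>_pos by (simp add: ennreal_le_iff)
  qed
  define D where "D = 2 ^ J / c0 * (C * (real (Suc m) * (B1 / R0 ^ m)))"
  have D: "D > 0" using c0 C B1 R0 by (simp add: D_def)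
  show ?thesis
  proof (intro exI[of _ D] conjI allI D)
    fix i :: nat
    define R where "R = R0 * q ^ i"
    have q1: "q ^ i \<le> 1" using q_pos q_less_1 by (intro power_le_one) auto
    have R: "0 < R" "R \<le> R0" "R \<le> 1"
    proof -
      show "0 < R" using R0 q_pos by (simp add: R_def)
      show "R \<le> R0" using mult_left_mono[OF q1, of R0] R0 by (simp add: R_def)
      then show "R \<le> 1" using R0 by simp
    qed
    have Rn: "R ^ ?n = R0 ^ ?n / 2 ^ i"
    proof -
      have "(q ^ i) ^ ?n = (q ^ ?n) ^ i" by (simp add: power_mult[symmetric] mult.commute)
      then show ?thesis by (simp add: R_def power_mult_distrib qn power_one_over)
    qed
    define u where "u x = \<eta> ((1 / R) *\<^sub>R x + - ((1 / R) *\<^sub>R x0))" for x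
    have coord: "((1 / R) *\<^sub>R x + - ((1 / R) *\<^sub>R x0)) $ j = (x $ j - x0 $ j) / R" for x j
      by (simp add: diff_divide_distrib)
    have in_cube: "(1 / R) *\<^sub>R x + - ((1 / R) *\<^sub>R x0) \<in> cbox (- 1) 1 \<longleftrightarrow> x \<in> Q R" for x
      using R(1) unfolding mem_box_cart Q_iff coord by (auto simp: field_simps abs_le_iff)
    have ip: "iterated_partial is u x = (1 / R) ^ length is * iterated_partial is \<eta> ((1 / R) *\<^sub>R x + - ((1 / R) *\<^sub>R x0))" for "is" x
      unfolding u_def[abs_def] iterated_partial_affine[OF \<eta>s] ..
    have smooth_u: "smooth u" unfolding u_def[abs_def] by (rule smooth_affine[OF \<eta>s])
    have uT: "u \<in> test_functions \<Omega>"
    proof -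
      have "closure {x. u x \<noteq> 0} \<subseteq> Q R"
      proof (rule closure_minimal)
        show "{x. u x \<noteq> 0} \<subseteq> Q R"
          using support[of _ "[]"] in_cube by (auto simp: u_def)
        show "closed (Q R)" unfolding Q_def by (rule closed_cbox)
      qed
      moreover have "bounded (Q R)" by (simp add: Q_def)
      ultimately show ?thesis
        using smooth_u Q_mono[OF R(2)] R0(3)
        by (auto simp: test_functions_iff compact_eq_bounded_closed intro: bounded_subset)
    qed
    have weak: "has_weak_derivative \<Omega> is u (iterated_partial (rev is) u)" for "is"
      by (rule test_functions_has_weak_derivative[OF op uT])
    have wd: "weakly_differentiable \<Omega> m u" unfolding weakly_differentiable_def using weak by blast
    have ip_le: "\<bar>iterated_partial (rev is) u x\<bar> \<le> B (rev is) * (1 / R) ^ m * indicator (Q R) x" if "is": "length is \<le> m" for "is" x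
    proof (cases "x \<in> Q R")
      case True
      have "\<bar>iterated_partial (rev is) u x\<bar> \<le> (1 / R) ^ length is * B (rev is)"
        unfolding ip using R B by (simp add: abs_mult mult_left_mono)
      also have "\<dots> \<le> (1 / R) ^ m * B (rev is)"
        using R "is" B(1)[of "rev is"] by (intro mult_right_mono power_increasing) auto
      finally show ?thesis using True by (simp add: mult.commute)
    next
      case False
      then show ?thesis using support in_cube[of x] by (simp add: ip)
    qed
    have grad_le: "norm_of \<rho>X (gradient_norm \<Omega> k u) \<le> ennreal (B1 * (1 / R) ^ m) * X.ff (t i)"
      and grad_meas: "gradient_norm \<Omega> k u \<in> borel_measurable M" if k: "k \<le> m" for k
    proof -
      let ?K = "{is :: 'n list. length is = k}"
      have finK: "finite ?K" using finite_lists_length_eq[of "UNIV :: 'n set" k] by simp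
      have wdm: "weak_derivative \<Omega> is u \<in> borel_measurable M" if "is \<in> ?K" for "is"
        using weakly_differentiable_weak_derivative[OF wd, of "is"] that k
        by (auto simp: has_weak_derivative_def locally_integrable_def)
      show gm: "gradient_norm \<Omega> k u \<in> borel_measurable M"
        unfolding gradient_norm_def[abs_def] L2_set_def using wdm by measurable
      have "AE x in M. \<forall>is\<in>?K. weak_derivative \<Omega> is u x = iterated_partial (rev is) u x"
        unfolding AE_ball_countable[OF countable_finite[OF finK]]
        using weak_derivative_unique[OF op weakly_differentiable_weak_derivative[OF wd] weak] k by auto
      then have ae: "AE x in M. ennreal \<bar>gradient_norm \<Omega> k u x\<bar> \<le> ennreal (B1 * (1 / R) ^ m) * indicator (Q R) x"
      proof eventually_elim
        case (elim x)
        have "\<bar>gradient_norm \<Omega> k u x\<bar> = gradient_norm \<Omega> k u x" by (simp add: gradient_norm_def L2_set_nonneg)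
        also have "\<dots> \<le> (\<Sum>is\<in>?K. \<bar>weak_derivative \<Omega> is u x\<bar>)"
          unfolding gradient_norm_def by (rule L2_set_le_sum_abs)
        also have "\<dots> \<le> (\<Sum>is\<in>?K. B (rev is) * (1 / R) ^ m * indicator (Q R) x)"
          using elim k ip_le by (intro sum_mono) auto
        also have "\<dots> \<le> (\<Sum>is\<in>?I. B (rev is) * (1 / R) ^ m * indicator (Q R) x)"
          using fin k B(1) R by (intro sum_mono2) (auto simp: less_imp_le)
        also have "\<dots> = B1 * (1 / R) ^ m * indicator (Q R) x" by (simp add: B1_def sum_distrib_right)
        finally have "ennreal \<bar>gradient_norm \<Omega> k u x\<bar> \<le> ennreal (B1 * (1 / R) ^ m * indicator (Q R) x)"
          by (rule ennreal_leI)
        then show ?case by (cases "x \<in> Q R") simp_all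
      qed
      have Qi: "(indicator (Q R) :: _ \<Rightarrow> ennreal) \<in> borel_measurable M" using Qm[OF R(2)] by simp
      have "norm_of \<rho>X (gradient_norm \<Omega> k u) \<le> \<rho>X (\<lambda>x. ennreal (B1 * (1 / R) ^ m) * indicator (Q R) x)"
        unfolding norm_of_def using gm Qi by (intro X.P2 ae) auto
      also have "\<dots> = ennreal (B1 * (1 / R) ^ m) * \<rho>X (indicator (Q R))"
        using B1 R Qi by (intro X.P1_homogeneous) auto
      also have "\<rho>X (indicator (Q R)) \<le> X.ff (t i)"
      proof (rule X.rho_indicator_le[OF Qm[OF R(2)]])
        have "(2 * R) ^ ?n = (2 * R0) ^ ?n / 2 ^ i" by (simp add: power_mult_distrib Rn)
        also have "\<dots> \<le> t i" using vol by (simp add: t_def divide_right_mono)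
        finally show "emeasure M (Q R) \<le> ennreal (t i)" using R by (simp add: Qe ennreal_leI)
      qed (use t_pos[of i] in simp)
      finally show "norm_of \<rho>X (gradient_norm \<Omega> k u) \<le> ennreal (B1 * (1 / R) ^ m) * X.ff (t i)"
        by (simp add: mult_left_mono)
    qed
    have "u \<in> sobolev_space \<Omega> m \<rho>X"
    proof -
      have "ennreal (B1 * (1 / R) ^ m) * X.ff (t i) < \<infinity>"
        using X.ff_finite[of "t i"] t_pos[of i] by (simp add: ennreal_mult_less_top)
      then show ?thesis
        using wd grad_le grad_meas by (auto simp: sobolev_space_def ri_space_def intro: le_less_trans)
    qed
    from C'[OF this] have "norm_of \<rho>Y u \<le> ennreal C' * sobolev_norm \<Omega> m \<rho>X u" .
    also have "\<dots> \<le> ennreal C * (\<Sum>k\<le>m. ennreal (B1 * (1 / R) ^ m) * X.ff (t i))"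
      unfolding sobolev_norm_def by (intro mult_mono sum_mono grad_le ennreal_leI) (auto simp: C_def)
    also have "\<dots> = ennreal (C * (real (Suc m) * (B1 * (1 / R) ^ m))) * X.ff (t i)"
    proof -
      have "(\<Sum>k\<le>m. ennreal (B1 * (1 / R) ^ m) * X.ff (t i)) = ennreal (real (Suc m)) * (ennreal (B1 * (1 / R) ^ m) * X.ff (t i))"
        by (simp add: ennreal_of_nat_eq_real_of_nat del: of_nat_Suc)
      moreover have "ennreal (C * (real (Suc m) * (B1 * (1 / R) ^ m)))
        = ennreal C * (ennreal (real (Suc m)) * ennreal (B1 * (1 / R) ^ m))"
        using C B1 R by (subst ennreal_mult, simp, simp, subst ennreal_mult) auto
      ultimately show ?thesis by (simp only: mult.assoc)
    qed
    finally have up: "norm_of \<rho>Y u \<le> ennreal (C * (real (Suc m) * (B1 * (1 / R) ^ m))) * X.ff (t i)" .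
    have half: "R / 2 \<le> R0" "0 \<le> R / 2" using R by auto
    have Pi: "(indicator (Q (R / 2)) :: _ \<Rightarrow> ennreal) \<in> borel_measurable M" using Qm[OF half(1)] by simp
    have "ennreal c0 * Y.ff (R ^ ?n) = ennreal c0 * \<rho>Y (indicator (Q (R / 2)))"
      using Y.fundamental_function_eq'[OF Qm[OF half(1)], of "R ^ ?n"] Qe[OF half(2,1)] by simp
    also have "\<dots> = \<rho>Y (\<lambda>x. ennreal c0 * indicator (Q (R / 2)) x)"
      using c0 Pi by (subst Y.P1_homogeneous) auto
    also have "\<dots> \<le> norm_of \<rho>Y u"
      unfolding norm_of_def
    proof (rule Y.P2)
      show "(\<lambda>x. ennreal \<bar>u x\<bar>) \<in> borel_measurable M"
        using test_functions_borel[OF uT] by measurable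
      show "AE x in M. ennreal c0 * indicator (Q (R / 2)) x \<le> ennreal \<bar>u x\<bar>"
      proof (rule AE_I2)
        fix x
        show "ennreal c0 * indicator (Q (R / 2)) x \<le> ennreal \<bar>u x\<bar>"
        proof (cases "x \<in> Q (R / 2)")
          case True
          have "c0 \<le> u x"
            unfolding u_def \<eta>_def c0_def
            by (rule box_bump_ge, unfold coord) (use True R(1) in \<open>auto simp: Q_iff field_simps\<close>)
          then show ?thesis using True by (auto intro!: ennreal_leI)
        qed simp
      qed
    qed (use Pi in auto)
    finally have low: "ennreal c0 * Y.ff (R ^ ?n) \<le> norm_of \<rho>Y u" .
    have "Y.ff (t i) \<le> 2 ^ J * Y.ff (t (i + J))" using Y.ff_dyadic_le[of i "i + J"] by simp
    also have "\<dots> \<le> 2 ^ J * Y.ff (R ^ ?n)"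
    proof (intro mult_left_mono Y.ff_mono)
      have "t (i + J) = V / 2 ^ J / 2 ^ i" by (simp add: t_def power_add)
      also have "\<dots> \<le> R ^ ?n" unfolding Rn using J by (intro divide_right_mono) auto
      finally show "t (i + J) \<le> R ^ ?n" .
    qed (use t_pos[of "i + J"] in auto)
    also have "\<dots> = ennreal (2 ^ J / c0) * (ennreal c0 * Y.ff (R ^ ?n))"
      unfolding mult.assoc[symmetric] ennreal_two_power[symmetric] using c0 by (simp add: ennreal_mult[symmetric])
    also have "\<dots> \<le> ennreal (2 ^ J / c0) * (ennreal (C * (real (Suc m) * (B1 * (1 / R) ^ m))) * X.ff (t i))"
      by (intro mult_left_mono order_trans[OF low up]) simp
    also have "\<dots> = ennreal (2 ^ J / c0 * (C * (real (Suc m) * (B1 * (1 / R) ^ m)))) * X.ff (t i)"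
      using c0 C B1 R by (subst ennreal_mult) (auto simp: mult.assoc)
    also have "2 ^ J / c0 * (C * (real (Suc m) * (B1 * (1 / R) ^ m))) = D * (1 / q) ^ (m * i)"
      using R0 q_pos by (simp add: D_def R_def power_divide power_mult_distrib power_mult[symmetric] mult.commute)
    also have "ennreal (D * (1 / q) ^ (m * i)) * X.ff (t i) = ennreal D * (ennreal ((1 / q) ^ (m * i)) * X.ff (t i))"
      using D q_pos by (subst ennreal_mult) (auto simp: mult.assoc)
    finally show "Y.ff (t i) \<le> ennreal D * (ennreal ((1 / q) ^ (m * i)) * X.ff (t i))" .
  qed
qed

section \<open>Comparing the optimal domains\<close>

text \<open>The target \<open>Y2\<close> is compared with \<open>X2\<close> by scaling, \<open>Y1\<close> with \<open>Y2\<close> by hypothesis, the iterated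
  domain of \<open>Y1\<close> with \<open>Y1\<close> by construction, and \<open>X1\<close> with the iterated domain by optimality.  The
  powers of \<open>q\<close> lost in the first step are regained in the third.\<close>
lemma optimal_domain_fundamental_function_le:
  assumes n: "2 \<le> CARD('n)" and lip: "bounded_lipschitz_domain \<Omega>"
    and Y1: "ri_norm \<Omega> \<rho>Y1" and Y2: "ri_norm \<Omega> \<rho>Y2"
    and level: "same_fundamental_level \<Omega> \<rho>Y1 \<rho>Y2"
    and X1: "optimal_domain \<Omega> m \<rho>Y1 \<rho>X1" and X2: "optimal_domain \<Omega> m \<rho>Y2 \<rho>X2"
  shows "\<exists>C>0. \<forall>s\<ge>0. fundamental_function \<Omega> \<rho>X1 s \<le> ennreal C * fundamental_function \<Omega> \<rho>X2 s"
proof -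
  have r1: "ri_norm \<Omega> \<rho>X1" and r2: "ri_norm \<Omega> \<rho>X2" and emb2: "sobolev_embedding \<Omega> m \<rho>X2 \<rho>Y2"
    using X1 X2 by (auto simp: optimal_domain_def)
  interpret X2: ri_norm_on \<Omega> \<rho>X2 by (rule ri_norm_onI[OF r2])
  let ?Z = "iterated_domain \<rho>Y1 m"
  have "open \<Omega>" "\<Omega> \<noteq> {}" using lip by (auto simp: bounded_lipschitz_domain_def)
  obtain D where D: "D > 0" "\<And>i. fundamental_function \<Omega> \<rho>Y2 (t i) \<le> ennreal D * (ennreal ((1 / q) ^ (m * i)) * X2.ff (t i))"
    using sobolev_embedding_fundamental_function_le[OF r2 Y2 emb2 \<open>open \<Omega>\<close> \<open>\<Omega> \<noteq> {}\<close>] by blast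
  obtain A where A: "A > 0" "\<And>s. s \<ge> 0 \<Longrightarrow> fundamental_function \<Omega> \<rho>Y1 s \<le> ennreal A * fundamental_function \<Omega> \<rho>Y2 s"
    using level by (auto simp: same_fundamental_level_def equivalent_functions_def)
  define \<Theta> where "\<Theta> i = ennreal (A * D) * X2.ff (t i)" for i
  have bound: "fundamental_function \<Omega> \<rho>Y1 (t i) \<le> ennreal ((1 / q) ^ (m * i)) * \<Theta> i" for i
  proof -
    have "fundamental_function \<Omega> \<rho>Y1 (t i) \<le> ennreal A * fundamental_function \<Omega> \<rho>Y2 (t i)"
      using A(2)[of "t i"] t_pos[of i] by simp
    also have "\<dots> \<le> ennreal A * (ennreal D * (ennreal ((1 / q) ^ (m * i)) * X2.ff (t i)))"
      by (intro mult_left_mono D) simp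
    also have "\<dots> = ennreal ((1 / q) ^ (m * i)) * \<Theta> i"
      using A D by (simp add: \<Theta>_def ennreal_mult mult_ac)
    finally show ?thesis .
  qed
  have mono: "2 ^ i * \<Theta> i \<le> 2 ^ k * \<Theta> k" if "i \<le> k" for i k
  proof -
    have "2 ^ i * \<Theta> i = ennreal (A * D) * (2 ^ i * X2.ff (t i))" by (simp add: \<Theta>_def mult_ac)
    also have "\<dots> \<le> ennreal (A * D) * (2 ^ i * (2 ^ (k - i) * X2.ff (t k)))"
      by (intro mult_left_mono X2.ff_dyadic_le that) auto
    also have "2 ^ i * (2 ^ (k - i) * X2.ff (t k)) = 2 ^ k * X2.ff (t k)"
      unfolding mult.assoc[symmetric] power_add[symmetric] using that by simp
    also have "ennreal (A * D) * (2 ^ k * X2.ff (t k)) = 2 ^ k * \<Theta> k" by (simp add: \<Theta>_def mult_ac)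
    finally show ?thesis .
  qed
  obtain B where B: "B > 0" "\<And>i. fundamental_function \<Omega> ?Z (t i) \<le> ennreal B * \<Theta> i"
    using iterated_domain_fundamental_function_le[where \<Theta> = \<Theta> and m = m and l = m, OF Y1 bound mono] by auto
  have "sobolev_embedding \<Omega> m ?Z \<rho>Y1" by (rule sobolev_embedding_iterated_domain[OF n lip Y1])
  then have "ri_space \<Omega> ?Z \<subseteq> ri_space \<Omega> \<rho>X1"
    using X1 ri_norm_iterated_domain[OF Y1] by (auto simp: optimal_domain_def)
  then obtain G where G: "G > 0" "\<And>k. fundamental_function \<Omega> \<rho>X1 (t k) \<le> ennreal G * fundamental_function \<Omega> ?Z (t k)"
    using ri_space_inclusion_fundamental_function_le[OF ri_norm_iterated_domain[OF Y1] r1] by blast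
  define E where "E = G * (B * (A * D))"
  have E: "E > 0" using G B A D by (simp add: E_def)
  have "fundamental_function \<Omega> \<rho>X1 (t k) \<le> ennreal E * X2.ff (t k)" for k
  proof -
    have "fundamental_function \<Omega> \<rho>X1 (t k) \<le> ennreal G * (ennreal B * \<Theta> k)"
      using G(2)[of k] mult_left_mono[OF B(2)[of k], of "ennreal G"] by (auto intro: order_trans)
    also have "\<dots> = ennreal E * X2.ff (t k)"
      using G B A D by (simp add: E_def \<Theta>_def ennreal_mult mult.assoc)
    finally show ?thesis .
  qed
  then show ?thesis
    using equivalent_functions_dyadicI[OF r1 r2 E] E by (intro exI[of _ "2 * E"]) auto
qed

end

theorem corollary4p3:
  fixes \<Omega> :: "(real^'n) set"
    and m :: nat
    and \<rho>Y1 \<rho>Y2 \<rho>X1 \<rho>X2 :: "(real^'n \<Rightarrow> ennreal) \<Rightarrow> ennreal"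
  assumes "CARD('n) \<ge> 2"
    and "m \<le> CARD('n) - 1"
    and "bounded_lipschitz_domain \<Omega>"
    and "ri_norm \<Omega> \<rho>Y1"
    and "ri_norm \<Omega> \<rho>Y2"
    and "same_fundamental_level \<Omega> \<rho>Y1 \<rho>Y2"
    and "optimal_domain \<Omega> m \<rho>Y1 \<rho>X1"
    and "optimal_domain \<Omega> m \<rho>Y2 \<rho>X2"
  shows "same_fundamental_level \<Omega> \<rho>X1 \<rho>X2"
proof -
  have \<Omega>: "open \<Omega>" "\<Omega> \<noteq> {}" "bounded \<Omega>" using assms(3) by (auto simp: bounded_lipschitz_domain_def)
  interpret bounded_measurable_set \<Omega>
  proof
    show "\<Omega> \<in> sets lebesgue" using \<Omega>(1) by (simp add: lborelD)
    show "bounded \<Omega>" by fact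
    obtain x r where r: "0 < r" "ball x r \<subseteq> \<Omega>" using \<Omega> open_contains_ball by blast
    have "0 < measure lebesgue (ball x r)" using content_ball_pos[OF r(1), of x] by simp
    also have "\<dots> \<le> measure lebesgue \<Omega>"
      using r(2) lmeasurable_open[OF \<Omega>(3,1)] by (intro measure_mono_fmeasurable) auto
    finally show "0 < measure lebesgue \<Omega>" .
  qed
  have level': "same_fundamental_level \<Omega> \<rho>Y2 \<rho>Y1"
    using assms(6) by (auto simp: same_fundamental_level_def equivalent_functions_def)
  obtain C where C: "C > 0" "\<And>s. s \<ge> 0 \<Longrightarrow> fundamental_function \<Omega> \<rho>X1 s \<le> ennreal C * fundamental_function \<Omega> \<rho>X2 s"
    using optimal_domain_fundamental_function_le[OF assms(1,3,4,5,6,7,8)] by blast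
  obtain D where D: "D > 0" "\<And>s. s \<ge> 0 \<Longrightarrow> fundamental_function \<Omega> \<rho>X2 s \<le> ennreal D * fundamental_function \<Omega> \<rho>X1 s"
    using optimal_domain_fundamental_function_le[OF assms(1,3,5,4) level' assms(8,7)] by blast
  show ?thesis
    unfolding same_fundamental_level_def equivalent_functions_def
  proof (intro exI[of _ "max C D"] conjI allI impI)
    show "0 < max C D" using C by simp
    fix s :: real assume "0 \<le> s"
    show "fundamental_function \<Omega> \<rho>X1 s \<le> ennreal (max C D) * fundamental_function \<Omega> \<rho>X2 s"
      by (rule order_trans[OF C(2)[OF \<open>0 \<le> s\<close>]]) (intro mult_right_mono ennreal_leI; simp)
    show "fundamental_function \<Omega> \<rho>X2 s \<le> ennreal (max C D) * fundamental_function \<Omega> \<rho>X1 s"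
      by (rule order_trans[OF D(2)[OF \<open>0 \<le> s\<close>]]) (intro mult_right_mono ennreal_leI; simp)
  qed
qed

end
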